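(* Let $\mathcal{C}$ be a (non-pointed) generalized near-group fusion category of type $(G,\Gamma,k_1,\cdots,k_n)$. Assume that $(k_1,\cdots,k_n)\neq (0,\cdots,0)$. Then: (1) The adjoint subcategory $\mathcal{C}_{ad}$ is non-pointed. There is a 1-1 correspondence between the non-pointed fusion subcategories of $\mathcal{C}$ and the subgroups of the universal grading group $\mathcal{U}(\mathcal{C})$. (2) For any $g\in \mathcal{U}(\mathcal{C})$, the component $\mathcal{C}_g$ of the universal grading contains at least one invertible simple object. In particular, $\operatorname{Irr}(\mathcal{C}_g)=\{\alpha_g, \alpha_g\otimes Y_1, \cdots, \alpha_g\otimes Y_s \}$, where $\alpha_g$ is an invertible simple object in $\mathcal{C}_g$ and $\operatorname{Irr}(\mathcal{C}_{ad})=\{\mathbf{1},Y_{1},\cdots,Y_{s}\}$.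
   Context: A fusion category is a $\mathbb{C}$-linear semisimple rigid tensor category with finitely many isomorphism classes of simple objects, finite-dimensional morphism spaces and simple unit object $\mathbf{1}$. $\operatorname{Irr}(\cdot)$ is the set of isomorphism classes of simple objects. A simple object $X$ is invertible if $X\otimes X^*\cong\mathbf{1}$; a fusion category is pointed if all its simple objects are invertible. Let $G=G(\mathcal{C})$ be the group of isomorphism classes of invertible simple objects of $\mathcal{C}$. It acts on $\operatorname{Irr}(\mathcal{C})$ by left tensor product, preserving the set of non-invertible simple objects. A generalized near-group fusion category is a non-pointed fusion category $\mathcal{C}$ such that $G$ acts transitively on the set of isomorphism classes of non-invertible simple objects. Let $X_1,\dots,X_n$ be a full list of the non-isomorphic non-invertible simple objects and let $\Gamma=G[X_1]=\{g\in G: g\otimes X_1\cong X_1\}$. Write $$X_1\otimes X_1^*\cong\bigoplus_{h\in \Gamma}h\oplus k_1X_{1}\oplus \cdots\oplus k_nX_{n},$$ with non-negative integers $k_1,\dots,k_n$; then $\mathcal{C}$ is said to be of type $(G,\Gamma,k_1,\dots,k_n)$. The adjoint subcategory $\mathcal{C}_{ad}$ is the fusion subcategory generated by the simple summands of $X\otimes X^*$ for all $X\in\operatorname{Irr}(\mathcal{C})$. The universal grading is the canonical faithful grading $\mathcal{C}=\bigoplus_{g\in\mathcal{U}(\mathcal{C})}\mathcal{C}_g$ (with $\mathcal{C}_g\otimes\mathcal{C}_h\subseteq\mathcal{C}_{gh}$ and all $\mathcal{C}_g\neq0$) whose trivial component is $\mathcal{C}_{ad}$; $\mathcal{U}(\mathcal{C})$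 is the universal grading group. *)

theory Defs
  imports Complex_Main "HOL-Algebra.Group"
begin

(* The hom spaces are linear subspaces of one ambient complex vector space 'm. Every small
   C-linear category has this form up to isomorphism (take the direct sum of all its hom spaces).
   The hom spaces need not be disjoint, so a morphism is always used together with its source
   and target. The operations are only constrained on objects and on hom spaces. *)
record ('o, 'm) moncat =
  Obj :: "'o set"
  Hom :: "'o \<Rightarrow> 'o \<Rightarrow> 'm set"
  Scale :: "complex \<Rightarrow> 'm \<Rightarrow> 'm"
  Comp :: "'m \<Rightarrow> 'm \<Rightarrow> 'm"  (infixr "\<cdot>\<index>" 75)
  Ide :: "'o \<Rightarrow> 'm"
  TenO :: "'o \<Rightarrow> 'o \<Rightarrow> 'o"  (infixl "\<odot>\<index>" 80)
  TenM :: "'m \<Rightarrow> 'm \<Rightarrow> 'm"  (infixl "\<star>\<index>" 80)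
  Unit :: 'o
  Assoc :: "'o \<Rightarrow> 'o \<Rightarrow> 'o \<Rightarrow> 'm"
  LUnit :: "'o \<Rightarrow> 'm"
  RUnit :: "'o \<Rightarrow> 'm"

definition full_sub :: "('o, 'm) moncat \<Rightarrow> 'o set \<Rightarrow> ('o, 'm) moncat" where
  "full_sub C D = C\<lparr>Obj := D\<rparr>"

section \<open>Linear and abelian categories\<close>

locale linear_category =
  fixes C :: "('o, 'm::ab_group_add) moncat" (structure)
  assumes vector_space: "vector_space (Scale C)"
    and hom_subspace: "\<lbrakk>x \<in> Obj C; y \<in> Obj C\<rbrakk> \<Longrightarrow> module.subspace (Scale C) (Hom C x y)"
    and ide_hom: "x \<in> Obj C \<Longrightarrow> Ide C x \<in> Hom C x x"
    and comp_hom: "\<lbrakk>x \<in> Obj C; y \<in> Obj C; z \<in> Obj C; f \<in> Hom C x y; g \<in> Hom C y z\<rbrakk>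
      \<Longrightarrow> g \<cdot> f \<in> Hom C x z"
    and comp_assoc: "\<lbrakk>w \<in> Obj C; x \<in> Obj C; y \<in> Obj C; z \<in> Obj C;
        f \<in> Hom C w x; g \<in> Hom C x y; h \<in> Hom C y z\<rbrakk> \<Longrightarrow> (h \<cdot> g) \<cdot> f = h \<cdot> (g \<cdot> f)"
    and comp_ide_left: "\<lbrakk>x \<in> Obj C; y \<in> Obj C; f \<in> Hom C x y\<rbrakk> \<Longrightarrow> Ide C y \<cdot> f = f"
    and comp_ide_right: "\<lbrakk>x \<in> Obj C; y \<in> Obj C; f \<in> Hom C x y\<rbrakk> \<Longrightarrow> f \<cdot> Ide C x = f"
    and comp_add_left: "\<lbrakk>x \<in> Obj C; y \<in> Obj C; z \<in> Obj C;
        f \<in> Hom C x y; g \<in> Hom C y z; g' \<in> Hom C y z\<rbrakk>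
      \<Longrightarrow> (g + g') \<cdot> f = (g \<cdot> f) + (g' \<cdot> f)"
    and comp_add_right: "\<lbrakk>x \<in> Obj C; y \<in> Obj C; z \<in> Obj C;
        f \<in> Hom C x y; f' \<in> Hom C x y; g \<in> Hom C y z\<rbrakk>
      \<Longrightarrow> g \<cdot> (f + f') = (g \<cdot> f) + (g \<cdot> f')"
    and comp_scale_left: "\<lbrakk>x \<in> Obj C; y \<in> Obj C; z \<in> Obj C;
        f \<in> Hom C x y; g \<in> Hom C y z\<rbrakk> \<Longrightarrow> Scale C a g \<cdot> f = Scale C a (g \<cdot> f)"
    and comp_scale_right: "\<lbrakk>x \<in> Obj C; y \<in> Obj C; z \<in> Obj C;
        f \<in> Hom C x y; g \<in> Hom C y z\<rbrakk> \<Longrightarrow> g \<cdot> Scale C a f = Scale C a (g \<cdot> f)"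

definition inverse_arrows :: "('o, 'm) moncat \<Rightarrow> 'o \<Rightarrow> 'o \<Rightarrow> 'm \<Rightarrow> 'm \<Rightarrow> bool" where
  "inverse_arrows C x y f g \<longleftrightarrow> f \<in> Hom C x y \<and> g \<in> Hom C y x \<and>
     g \<cdot>\<^bsub>C\<^esub> f = Ide C x \<and> f \<cdot>\<^bsub>C\<^esub> g = Ide C y"

definition iso_arrow :: "('o, 'm) moncat \<Rightarrow> 'o \<Rightarrow> 'o \<Rightarrow> 'm \<Rightarrow> bool" where
  "iso_arrow C x y f \<longleftrightarrow> (\<exists>g. inverse_arrows C x y f g)"

definition inv_arrow :: "('o, 'm) moncat \<Rightarrow> 'o \<Rightarrow> 'o \<Rightarrow> 'm \<Rightarrow> 'm" where
  "inv_arrow C x y f = (THE g. inverse_arrows C x y f g)"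

definition isomorphic :: "('o, 'm) moncat \<Rightarrow> 'o \<Rightarrow> 'o \<Rightarrow> bool" where
  "isomorphic C x y \<longleftrightarrow> x \<in> Obj C \<and> y \<in> Obj C \<and> (\<exists>f. iso_arrow C x y f)"

definition iso_class :: "('o, 'm) moncat \<Rightarrow> 'o \<Rightarrow> 'o set" where
  "iso_class C x = {y. isomorphic C x y}"

definition mono_arrow :: "('o, 'm) moncat \<Rightarrow> 'o \<Rightarrow> 'o \<Rightarrow> 'm \<Rightarrow> bool" where
  "mono_arrow C x y m \<longleftrightarrow> m \<in> Hom C x y \<and>
     (\<forall>w\<in>Obj C. \<forall>f\<in>Hom C w x. \<forall>g\<in>Hom C w x. m \<cdot>\<^bsub>C\<^esub> f = m \<cdot>\<^bsub>C\<^esub> g \<longrightarrow> f = g)"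

definition epi_arrow :: "('o, 'm) moncat \<Rightarrow> 'o \<Rightarrow> 'o \<Rightarrow> 'm \<Rightarrow> bool" where
  "epi_arrow C x y e \<longleftrightarrow> e \<in> Hom C x y \<and>
     (\<forall>z\<in>Obj C. \<forall>f\<in>Hom C y z. \<forall>g\<in>Hom C y z. f \<cdot>\<^bsub>C\<^esub> e = g \<cdot>\<^bsub>C\<^esub> e \<longrightarrow> f = g)"

text \<open>In the next two definitions \<open>f\<close> is a morphism from \<open>x\<close> to \<open>y\<close>; its kernel is
  \<open>k\<close> from \<open>K\<close> to \<open>x\<close>, its cokernel \<open>q\<close> from \<open>y\<close> to \<open>Q\<close>.\<close>

definition is_kernel ::
  "('o, 'm::ab_group_add) moncat \<Rightarrow> 'o \<Rightarrow> 'o \<Rightarrow> 'm \<Rightarrow> 'o \<Rightarrow> 'm \<Rightarrow> bool" where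
  "is_kernel C x y f K k \<longleftrightarrow> K \<in> Obj C \<and> k \<in> Hom C K x \<and> f \<cdot>\<^bsub>C\<^esub> k = 0 \<and>
     (\<forall>w\<in>Obj C. \<forall>g\<in>Hom C w x. f \<cdot>\<^bsub>C\<^esub> g = 0 \<longrightarrow> (\<exists>!u. u \<in> Hom C w K \<and> k \<cdot>\<^bsub>C\<^esub> u = g))"

definition is_cokernel ::
  "('o, 'm::ab_group_add) moncat \<Rightarrow> 'o \<Rightarrow> 'o \<Rightarrow> 'm \<Rightarrow> 'o \<Rightarrow> 'm \<Rightarrow> bool" where
  "is_cokernel C x y f Q q \<longleftrightarrow> Q \<in> Obj C \<and> q \<in> Hom C y Q \<and> q \<cdot>\<^bsub>C\<^esub> f = 0 \<and>
     (\<forall>z\<in>Obj C. \<forall>g\<in>Hom C y z. g \<cdot>\<^bsub>C\<^esub> f = 0 \<longrightarrow> (\<exists>!u. u \<in> Hom C Q z \<and> u \<cdot>\<^bsub>C\<^esub> q = g))"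

text \<open>\<open>X\<close> is a direct sum of the objects listed in \<open>Xs\<close>; for the empty list this says
  that \<open>X\<close> is a zero object.\<close>

definition is_direct_sum :: "('o, 'm::ab_group_add) moncat \<Rightarrow> 'o \<Rightarrow> 'o list \<Rightarrow> bool" where
  "is_direct_sum C X Xs \<longleftrightarrow> X \<in> Obj C \<and> set Xs \<subseteq> Obj C \<and>
     (\<exists>\<iota> \<pi>. (\<forall>i<length Xs. \<iota> i \<in> Hom C (Xs ! i) X \<and> \<pi> i \<in> Hom C X (Xs ! i)) \<and>
        (\<forall>i<length Xs. \<forall>j<length Xs.
           \<pi> i \<cdot>\<^bsub>C\<^esub> \<iota> j = (if i = j then Ide C (Xs ! i) else 0)) \<and>
        (\<Sum>i<length Xs. \<iota> i \<cdot>\<^bsub>C\<^esub> \<pi> i) = Ide C X)"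

definition is_summand :: "('o, 'm) moncat \<Rightarrow> 'o \<Rightarrow> 'o \<Rightarrow> bool" where
  "is_summand C Y X \<longleftrightarrow> X \<in> Obj C \<and> Y \<in> Obj C \<and>
     (\<exists>i\<in>Hom C Y X. \<exists>p\<in>Hom C X Y. p \<cdot>\<^bsub>C\<^esub> i = Ide C Y)"

locale abelian_category = linear_category +
  assumes zero_object: "\<exists>Z. is_direct_sum C Z []"
    and biproduct: "\<lbrakk>x \<in> Obj C; y \<in> Obj C\<rbrakk> \<Longrightarrow> \<exists>Z. is_direct_sum C Z [x, y]"
    and kernel: "\<lbrakk>x \<in> Obj C; y \<in> Obj C; f \<in> Hom C x y\<rbrakk> \<Longrightarrow> \<exists>K k. is_kernel C x y f K k"
    and cokernel: "\<lbrakk>x \<in> Obj C; y \<in> Obj C; f \<in> Hom C x y\<rbrakk> \<Longrightarrow> \<exists>Q q. is_cokernel C x y f Q q"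
    and mono_normal: "\<lbrakk>x \<in> Obj C; y \<in> Obj C; mono_arrow C x y m\<rbrakk>
      \<Longrightarrow> \<exists>z\<in>Obj C. \<exists>f\<in>Hom C y z. is_kernel C y z f x m"
    and epi_normal: "\<lbrakk>x \<in> Obj C; y \<in> Obj C; epi_arrow C x y e\<rbrakk>
      \<Longrightarrow> \<exists>z\<in>Obj C. \<exists>f\<in>Hom C z x. is_cokernel C z x f y e"

definition simple :: "('o, 'm::ab_group_add) moncat \<Rightarrow> 'o \<Rightarrow> bool" where
  "simple C X \<longleftrightarrow> X \<in> Obj C \<and> \<not> is_direct_sum C X [] \<and>
     (\<forall>Y\<in>Obj C. \<forall>m. mono_arrow C Y X m \<longrightarrow> is_direct_sum C Y [] \<or> iso_arrow C Y X m)"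

definition Irr :: "('o, 'm::ab_group_add) moncat \<Rightarrow> 'o set set" where
  "Irr C = iso_class C ` {X. simple C X}"

text \<open>\<open>Xs\<close> lists representatives, without repetition, of a set \<open>S\<close> of isomorphism classes.\<close>

definition represents :: "('o, 'm) moncat \<Rightarrow> 'o list \<Rightarrow> 'o set set \<Rightarrow> bool" where
  "represents C Xs S \<longleftrightarrow> distinct (map (iso_class C) Xs) \<and> iso_class C ` set Xs = S"

section \<open>Fusion categories\<close>

locale linear_monoidal_category = linear_category +
  assumes unit_obj: "Unit C \<in> Obj C"
    and tenO_obj: "\<lbrakk>x \<in> Obj C; y \<in> Obj C\<rbrakk> \<Longrightarrow> x \<odot> y \<in> Obj C"
    and tenM_hom: "\<lbrakk>x \<in> Obj C; x' \<in> Obj C; y \<in> Obj C; y' \<in> Obj C; f \<in> Hom C x x'; g \<in> Hom C y y'\<rbrakk>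
      \<Longrightarrow> f \<star> g \<in> Hom C (x \<odot> y) (x' \<odot> y')"
    and tenM_ide: "\<lbrakk>x \<in> Obj C; y \<in> Obj C\<rbrakk> \<Longrightarrow> Ide C x \<star> Ide C y = Ide C (x \<odot> y)"
    and tenM_comp: "\<lbrakk>x \<in> Obj C; x' \<in> Obj C; x'' \<in> Obj C; y \<in> Obj C; y' \<in> Obj C; y'' \<in> Obj C;
        f \<in> Hom C x x'; f' \<in> Hom C x' x''; g \<in> Hom C y y'; g' \<in> Hom C y' y''\<rbrakk>
      \<Longrightarrow> (f' \<cdot> f) \<star> (g' \<cdot> g) = (f' \<star> g') \<cdot> (f \<star> g)"
    and tenM_add_left: "\<lbrakk>x \<in> Obj C; x' \<in> Obj C; y \<in> Obj C; y' \<in> Obj C;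
        f \<in> Hom C x x'; f' \<in> Hom C x x'; g \<in> Hom C y y'\<rbrakk>
      \<Longrightarrow> (f + f') \<star> g = (f \<star> g) + (f' \<star> g)"
    and tenM_add_right: "\<lbrakk>x \<in> Obj C; x' \<in> Obj C; y \<in> Obj C; y' \<in> Obj C;
        f \<in> Hom C x x'; g \<in> Hom C y y'; g' \<in> Hom C y y'\<rbrakk>
      \<Longrightarrow> f \<star> (g + g') = (f \<star> g) + (f \<star> g')"
    and tenM_scale_left: "\<lbrakk>x \<in> Obj C; x' \<in> Obj C; y \<in> Obj C; y' \<in> Obj C;
        f \<in> Hom C x x'; g \<in> Hom C y y'\<rbrakk> \<Longrightarrow> Scale C a f \<star> g = Scale C a (f \<star> g)"
    and tenM_scale_right: "\<lbrakk>x \<in> Obj C; x' \<in> Obj C; y \<in> Obj C; y' \<in> Obj C;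
        f \<in> Hom C x x'; g \<in> Hom C y y'\<rbrakk> \<Longrightarrow> f \<star> Scale C a g = Scale C a (f \<star> g)"
    and assoc_iso: "\<lbrakk>x \<in> Obj C; y \<in> Obj C; z \<in> Obj C\<rbrakk>
      \<Longrightarrow> iso_arrow C ((x \<odot> y) \<odot> z) (x \<odot> (y \<odot> z)) (Assoc C x y z)"
    and assoc_natural: "\<lbrakk>x \<in> Obj C; x' \<in> Obj C; y \<in> Obj C; y' \<in> Obj C; z \<in> Obj C; z' \<in> Obj C;
        f \<in> Hom C x x'; g \<in> Hom C y y'; h \<in> Hom C z z'\<rbrakk>
      \<Longrightarrow> Assoc C x' y' z' \<cdot> ((f \<star> g) \<star> h) = (f \<star> (g \<star> h)) \<cdot> Assoc C x y z"
    and lunit_iso: "x \<in> Obj C \<Longrightarrow> iso_arrow C (Unit C \<odot> x) x (LUnit C x)"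
    and lunit_natural: "\<lbrakk>x \<in> Obj C; y \<in> Obj C; f \<in> Hom C x y\<rbrakk>
      \<Longrightarrow> LUnit C y \<cdot> (Ide C (Unit C) \<star> f) = f \<cdot> LUnit C x"
    and runit_iso: "x \<in> Obj C \<Longrightarrow> iso_arrow C (x \<odot> Unit C) x (RUnit C x)"
    and runit_natural: "\<lbrakk>x \<in> Obj C; y \<in> Obj C; f \<in> Hom C x y\<rbrakk>
      \<Longrightarrow> RUnit C y \<cdot> (f \<star> Ide C (Unit C)) = f \<cdot> RUnit C x"
    and pentagon: "\<lbrakk>w \<in> Obj C; x \<in> Obj C; y \<in> Obj C; z \<in> Obj C\<rbrakk>
      \<Longrightarrow> Assoc C w x (y \<odot> z) \<cdot> Assoc C (w \<odot> x) y z =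
          (Ide C w \<star> Assoc C x y z) \<cdot> Assoc C w (x \<odot> y) z \<cdot> (Assoc C w x y \<star> Ide C z)"
    and triangle: "\<lbrakk>x \<in> Obj C; y \<in> Obj C\<rbrakk>
      \<Longrightarrow> (Ide C x \<star> LUnit C y) \<cdot> Assoc C x (Unit C) y = RUnit C x \<star> Ide C y"

text \<open>\<open>Y\<close> is a left dual of \<open>X\<close> (evaluation from \<open>Y \<odot> X\<close> to the unit, coevaluation from
  the unit to \<open>X \<odot> Y\<close>); equivalently, \<open>X\<close> is a right dual of \<open>Y\<close>.\<close>

definition is_left_dual :: "('o, 'm) moncat \<Rightarrow> 'o \<Rightarrow> 'o \<Rightarrow> bool" where
  "is_left_dual C Y X \<longleftrightarrow> X \<in> Obj C \<and> Y \<in> Obj C \<and>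
     (\<exists>ev\<in>Hom C (Y \<odot>\<^bsub>C\<^esub> X) (Unit C). \<exists>coev\<in>Hom C (Unit C) (X \<odot>\<^bsub>C\<^esub> Y).
        RUnit C X \<cdot>\<^bsub>C\<^esub> (Ide C X \<star>\<^bsub>C\<^esub> ev) \<cdot>\<^bsub>C\<^esub> Assoc C X Y X \<cdot>\<^bsub>C\<^esub> (coev \<star>\<^bsub>C\<^esub> Ide C X) = LUnit C X \<and>
        LUnit C Y \<cdot>\<^bsub>C\<^esub> (ev \<star>\<^bsub>C\<^esub> Ide C Y) \<cdot>\<^bsub>C\<^esub>
          inv_arrow C ((Y \<odot>\<^bsub>C\<^esub> X) \<odot>\<^bsub>C\<^esub> Y) (Y \<odot>\<^bsub>C\<^esub> (X \<odot>\<^bsub>C\<^esub> Y)) (Assoc C Y X Y) \<cdot>\<^bsub>C\<^esub>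
          (Ide C Y \<star>\<^bsub>C\<^esub> coev) = RUnit C Y)"

definition dual :: "('o, 'm) moncat \<Rightarrow> 'o \<Rightarrow> 'o" where
  "dual C X = (SOME Y. is_left_dual C Y X)"

locale fusion_category = abelian_category + linear_monoidal_category +
  assumes finite_dimensional: "\<lbrakk>x \<in> Obj C; y \<in> Obj C\<rbrakk>
      \<Longrightarrow> \<exists>B. finite B \<and> Hom C x y = module.span (Scale C) B"
    and semisimple: "X \<in> Obj C \<Longrightarrow> \<exists>Xs. (\<forall>S\<in>set Xs. simple C S) \<and> is_direct_sum C X Xs"
    and left_rigid: "X \<in> Obj C \<Longrightarrow> \<exists>Y. is_left_dual C Y X"
    and right_rigid: "X \<in> Obj C \<Longrightarrow> \<exists>Y. is_left_dual C X Y"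
    and finite_Irr: "finite (Irr C)"
    and unit_simple: "simple C (Unit C)"

definition invertible :: "('o, 'm::ab_group_add) moncat \<Rightarrow> 'o \<Rightarrow> bool" where
  "invertible C X \<longleftrightarrow> simple C X \<and> isomorphic C (X \<odot>\<^bsub>C\<^esub> dual C X) (Unit C)"

definition pointed :: "('o, 'm::ab_group_add) moncat \<Rightarrow> bool" where
  "pointed C \<longleftrightarrow> (\<forall>X. simple C X \<longrightarrow> invertible C X)"

text \<open>The tensor product of two isomorphism classes of objects.\<close>

definition class_tensor :: "('o, 'm) moncat \<Rightarrow> 'o set \<Rightarrow> 'o set \<Rightarrow> 'o set" where
  "class_tensor C A B = {Z. \<exists>x\<in>A. \<exists>y\<in>B. isomorphic C (x \<odot>\<^bsub>C\<^esub> y) Z}"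

definition inv_group :: "('o, 'm::ab_group_add) moncat \<Rightarrow> 'o set monoid" where
  "inv_group C = \<lparr>carrier = iso_class C ` {X. invertible C X}, mult = class_tensor C,
     one = iso_class C (Unit C)\<rparr>"

abbreviation noninv_Irr :: "('o, 'm::ab_group_add) moncat \<Rightarrow> 'o set set" where
  "noninv_Irr C \<equiv> Irr C - carrier (inv_group C)"

section \<open>Fusion subcategories and gradings\<close>

definition additive_sub :: "('o, 'm::ab_group_add) moncat \<Rightarrow> 'o set \<Rightarrow> bool" where
  "additive_sub C D \<longleftrightarrow> D \<subseteq> Obj C \<and>
     (\<forall>X Xs. set Xs \<subseteq> D \<and> is_direct_sum C X Xs \<longrightarrow> X \<in> D) \<and>
     (\<forall>X\<in>D. \<forall>Y. is_summand C Y X \<longrightarrow> Y \<in> D)"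

text \<open>A fusion subcategory is full, hence given by its objects. Closure under summands makes it
  closed under isomorphism.\<close>

definition fusion_subcategory :: "('o, 'm::ab_group_add) moncat \<Rightarrow> 'o set \<Rightarrow> bool" where
  "fusion_subcategory C D \<longleftrightarrow> additive_sub C D \<and> Unit C \<in> D \<and>
     (\<forall>X\<in>D. \<forall>Y\<in>D. X \<odot>\<^bsub>C\<^esub> Y \<in> D) \<and>
     (\<forall>X\<in>D. \<forall>Y. is_left_dual C Y X \<or> is_left_dual C X Y \<longrightarrow> Y \<in> D)"

definition generated_sub :: "('o, 'm::ab_group_add) moncat \<Rightarrow> 'o set \<Rightarrow> 'o set" where
  "generated_sub C S = \<Inter>{D. fusion_subcategory C D \<and> S \<subseteq> D}"

definition adjoint_sub :: "('o, 'm::ab_group_add) moncat \<Rightarrow> 'o set" where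
  "adjoint_sub C = generated_sub C
     {Y. simple C Y \<and> (\<exists>X. simple C X \<and> is_summand C Y (X \<odot>\<^bsub>C\<^esub> dual C X))}"

definition sum_of_components ::
  "('o, 'm::ab_group_add) moncat \<Rightarrow> ('g \<Rightarrow> 'o set) \<Rightarrow> 'g set \<Rightarrow> 'o set" where
  "sum_of_components C Cg H = {X. \<exists>Xs. set Xs \<subseteq> (\<Union>h\<in>H. Cg h) \<and> is_direct_sum C X Xs}"

definition faithful_grading ::
  "('o, 'm::ab_group_add) moncat \<Rightarrow> 'g monoid \<Rightarrow> ('g \<Rightarrow> 'o set) \<Rightarrow> bool" where
  "faithful_grading C U Cg \<longleftrightarrow> group U \<and>
     (\<forall>g\<in>carrier U. additive_sub C (Cg g)) \<and>
     (\<forall>g\<in>carrier U. \<forall>h\<in>carrier U. g \<noteq> h \<longrightarrow>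
        (\<forall>X\<in>Cg g. \<forall>Y\<in>Cg h. Hom C X Y = {0})) \<and>
     Obj C = sum_of_components C Cg (carrier U) \<and>
     (\<forall>g\<in>carrier U. \<forall>h\<in>carrier U. \<forall>X\<in>Cg g. \<forall>Y\<in>Cg h.
        X \<odot>\<^bsub>C\<^esub> Y \<in> Cg (g \<otimes>\<^bsub>U\<^esub> h)) \<and>
     (\<forall>g\<in>carrier U. \<exists>X\<in>Cg g. \<not> is_direct_sum C X [])"

text \<open>The universal grading is determined up to isomorphism of gradings by being faithful
  with trivial component the adjoint subcategory.\<close>

definition universal_grading ::
  "('o, 'm::ab_group_add) moncat \<Rightarrow> 'g monoid \<Rightarrow> ('g \<Rightarrow> 'o set) \<Rightarrow> bool" where
  "universal_grading C U Cg \<longleftrightarrow> faithful_grading C U Cg \<and> Cg \<one>\<^bsub>U\<^esub> = adjoint_sub C"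

section \<open>Generalized near-group fusion categories\<close>

definition generalized_near_group :: "('o, 'm::ab_group_add) moncat \<Rightarrow> bool" where
  "generalized_near_group C \<longleftrightarrow> fusion_category C \<and> \<not> pointed C \<and>
     (\<forall>A\<in>noninv_Irr C. \<forall>B\<in>noninv_Irr C. \<exists>g\<in>carrier (inv_group C). class_tensor C g A = B)"

text \<open>Meant for categories that are not pointed, so that the list \<open>Xs\<close> of non-invertible simple
  objects is non-empty and has a first member \<open>hd Xs\<close>.\<close>

definition near_group_type ::
  "('o, 'm::ab_group_add) moncat \<Rightarrow> 'o set monoid \<Rightarrow> 'o set set \<Rightarrow> nat list \<Rightarrow> bool" where
  "near_group_type C G \<Gamma> ks \<longleftrightarrow> G = inv_group C \<and>
     (\<exists>Xs hs. represents C Xs (noninv_Irr C) \<and> length Xs = length ks \<and>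
        \<Gamma> = {g \<in> carrier G. class_tensor C g (iso_class C (hd Xs)) = iso_class C (hd Xs)} \<and>
        represents C hs \<Gamma> \<and>
        is_direct_sum C (hd Xs \<odot>\<^bsub>C\<^esub> dual C (hd Xs))
          (hs @ concat (map2 replicate ks Xs)))"

end

theory Submission
  imports Defs
begin

text \<open>
  Write \<open>X*\<close> for the dual of an object. By hypothesis some non-invertible simple \<open>N\<close> is a summand
  of \<open>X \<otimes> X*\<close> for the first non-invertible simple \<open>X\<close>, so \<open>N\<close> lies in the adjoint subcategory, which
  is therefore not pointed. Everything else follows by moving \<open>N\<close> around with invertible objects.

  Components: a component of the universal grading contains a simple object \<open>S\<close>. If \<open>S\<close> is not
  invertible, transitivity gives an invertible \<open>a\<close> with \<open>a \<otimes> N \<cong> S\<close>; since \<open>N\<close> has trivial degree, \<open>a\<close>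
  has the degree of \<open>S\<close>. Tensoring with an invertible \<open>\<alpha>\<close> of degree \<open>g\<close> is an equivalence that shifts
  degrees by \<open>g\<close>, so it maps the simple objects of the adjoint subcategory bijectively onto those of
  the component of \<open>g\<close> (\<open>component_translates\<close>).

  Subcategories: sums of the components over a subgroup \<open>H\<close> form a fusion subcategory, which contains
  the adjoint one and so is not pointed, and which determines \<open>H\<close>. Conversely, a fusion subcategory
  \<open>D\<close> that contains the adjoint one is a sum of components: if a nonzero \<open>X\<close> in \<open>D\<close> and \<open>S\<close> have the same
  degree, then \<open>S\<close> is a summand of \<open>S \<otimes> (X* \<otimes> X) \<cong> (S \<otimes> X*) \<otimes> X\<close>, where \<open>S \<otimes> X*\<close> has trivial degree
  (\<open>fusion_subcategory_containing_adjoint\<close>).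

  What remains is that a fusion subcategory \<open>D\<close> with a non-invertible simple object \<open>W\<close> contains every
  summand of \<open>X \<otimes> X*\<close>, for each simple \<open>X\<close> (\<open>nonpointed_contains_adjoint\<close>). If \<open>X\<close> is
  invertible, \<open>X \<otimes> X*\<close> is the unit; let \<open>X\<close> be non-invertible. Transitivity is about left
  translation, and \<open>X \<cong> a \<otimes> W\<close> only exhibits \<open>X \<otimes> X*\<close> as a conjugate of \<open>W \<otimes> W*\<close>. The way out is to
  translate the duals instead: a simple summand \<open>T\<close> of \<open>X*\<close> is \<open>a \<otimes> S\<close> for a simple summand \<open>S\<close> of
  \<open>W*\<close>, and then the nonzero morphism from the unit to \<open>X \<otimes> T \<cong> (X \<otimes> a) \<otimes> S\<close> forces \<open>X \<otimes> a \<cong> W\<close>,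
  whence \<open>X \<otimes> T \<cong> W \<otimes> S\<close> lies in \<open>D\<close>.

  The monoidal input consists of a few consequences of the duality axioms: tensoring with a nonzero
  object is faithful (\<open>faithful_left\<close>, \<open>faithful_right\<close>), evaluation and coevaluation detect nonzero
  morphisms (\<open>left_dual_linked_right\<close>, \<open>left_dual_linked_left\<close>), and a nonzero morphism from the unit
  to \<open>X \<otimes> W*\<close> yields one from \<open>W\<close> to \<open>X\<close> (\<open>coevaluation_linked_left\<close>). In a semisimple category a
  nonzero Hom space from or to a simple object already makes that object a summand, so most of the
  argument only asks which Hom spaces vanish.
\<close>

section \<open>Arrows with source and target\<close>

text \<open>Hom spaces may overlap, so a bare morphism does not determine its source and target and
  the composition laws cannot be used as rewrite rules. Once a morphism is bundled with its two
  objects, every side condition of these laws is computed from the terms themselves.\<close>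

datatype ('o, 'm) arrow = Arrow (src: 'o) (mor: 'm) (tgt: 'o)

context linear_category
begin

definition arr :: "('o, 'm) arrow \<Rightarrow> bool" where
  "arr f \<longleftrightarrow> src f \<in> Obj C \<and> tgt f \<in> Obj C \<and> mor f \<in> Hom C (src f) (tgt f)"

definition maps :: "('o, 'm) arrow \<Rightarrow> 'o \<Rightarrow> 'o \<Rightarrow> bool" where
  "maps f x y \<longleftrightarrow> arr f \<and> src f = x \<and> tgt f = y"

definition cmp :: "('o, 'm) arrow \<Rightarrow> ('o, 'm) arrow \<Rightarrow> ('o, 'm) arrow"  (infixr "\<bullet>" 75) where
  "g \<bullet> f = Arrow (src f) (mor g \<cdot> mor f) (tgt g)"

definition idt :: "'o \<Rightarrow> ('o, 'm) arrow" where
  "idt x = Arrow x (Ide C x) x"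

text \<open>The relation that carries the object-level reasoning below. In a semisimple category, if
  one side is simple, it says that this object is a summand of the other.\<close>

definition linked :: "'o \<Rightarrow> 'o \<Rightarrow> bool" where
  "linked x y \<longleftrightarrow> (\<exists>f. maps f x y \<and> mor f \<noteq> 0)"

lemma arr_Arrow [simp]: "arr (Arrow x f y) \<longleftrightarrow> x \<in> Obj C \<and> y \<in> Obj C \<and> f \<in> Hom C x y"
  by (simp add: arr_def)

lemma src_tgt_obj: "arr f \<Longrightarrow> src f \<in> Obj C" "arr f \<Longrightarrow> tgt f \<in> Obj C"
  by (simp_all add: arr_def)

lemma cmp_sel [simp]: "src (g \<bullet> f) = src f" "tgt (g \<bullet> f) = tgt g" "mor (g \<bullet> f) = mor g \<cdot> mor f"
  by (simp_all add: cmp_def)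

lemma idt_sel [simp]: "src (idt x) = x" "tgt (idt x) = x" "mor (idt x) = Ide C x"
  by (simp_all add: idt_def)

lemma arr_cmp [simp]: "\<lbrakk>arr f; arr g; src g = tgt f\<rbrakk> \<Longrightarrow> arr (g \<bullet> f)"
  unfolding arr_def by (auto intro: comp_hom)

lemma arr_idt [simp]: "x \<in> Obj C \<Longrightarrow> arr (idt x)"
  unfolding arr_def by (auto intro: ide_hom)

lemma cmp_assoc [simp]:
  "\<lbrakk>arr f; arr g; arr h; src g = tgt f; src h = tgt g\<rbrakk> \<Longrightarrow> (h \<bullet> g) \<bullet> f = h \<bullet> (g \<bullet> f)"
  unfolding arr_def cmp_def by (auto intro: comp_assoc)

lemma cmp_idt [simp]:
  "\<lbrakk>arr f; tgt f = x\<rbrakk> \<Longrightarrow> idt x \<bullet> f = f" "\<lbrakk>arr f; src f = x\<rbrakk> \<Longrightarrow> f \<bullet> idt x = f"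
  by (cases f; auto simp: cmp_def idt_def intro: comp_ide_left comp_ide_right)+

lemma maps_Arrow [simp]:
  "maps (Arrow x f y) x' y' \<longleftrightarrow> x = x' \<and> y = y' \<and> x \<in> Obj C \<and> y \<in> Obj C \<and> f \<in> Hom C x y"
  by (auto simp: maps_def)

lemma hom_zero [simp]: "\<lbrakk>x \<in> Obj C; y \<in> Obj C\<rbrakk> \<Longrightarrow> 0 \<in> Hom C x y"
  using hom_subspace vector_space module.subspace_0 module_iff_vector_space by metis

lemma hom_add: "\<lbrakk>x \<in> Obj C; y \<in> Obj C; f \<in> Hom C x y; g \<in> Hom C x y\<rbrakk> \<Longrightarrow> f + g \<in> Hom C x y"
  using hom_subspace vector_space module.subspace_add module_iff_vector_space by metis

lemma hom_diff: "\<lbrakk>x \<in> Obj C; y \<in> Obj C; f \<in> Hom C x y; g \<in> Hom C x y\<rbrakk> \<Longrightarrow> f - g \<in> Hom C x y"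
  using hom_subspace vector_space module.subspace_diff module_iff_vector_space by metis

lemma comp_zero_left [simp]:
  assumes "x \<in> Obj C" "y \<in> Obj C" "z \<in> Obj C" "f \<in> Hom C x y"
  shows "0 \<cdot> f = 0"
  using comp_add_left[OF assms(1-3) assms(4), of 0 0] assms by simp

lemma comp_zero_right [simp]:
  assumes "x \<in> Obj C" "y \<in> Obj C" "z \<in> Obj C" "g \<in> Hom C y z"
  shows "g \<cdot> 0 = 0"
  using comp_add_right[OF assms(1-3), of 0 0 g] assms by simp

lemma mapsD: "maps f x y \<Longrightarrow> x \<in> Obj C \<and> y \<in> Obj C \<and> mor f \<in> Hom C x y"
  by (auto simp: arr_def maps_def)

lemma maps_idt: "x \<in> Obj C \<Longrightarrow> maps (idt x) x x"
  by (simp add: maps_def)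

lemma maps_cmp: "\<lbrakk>maps f x y; maps g y z\<rbrakk> \<Longrightarrow> maps (g \<bullet> f) x z"
  by (simp add: maps_def)

lemma cmp_nonzero:
  assumes "maps f x y" "maps g y z" "mor (g \<bullet> f) \<noteq> 0"
  shows "mor f \<noteq> 0" "mor g \<noteq> 0"
  using mapsD[OF assms(1)] mapsD[OF assms(2)] assms(3) by auto

lemma comp_diff_right:
  assumes "x \<in> Obj C" "y \<in> Obj C" "z \<in> Obj C" "f \<in> Hom C x y" "f' \<in> Hom C x y" "g \<in> Hom C y z"
  shows "g \<cdot> (f - f') = (g \<cdot> f) - (g \<cdot> f')"
proof -
  have "g \<cdot> (f - f' + f') = (g \<cdot> (f - f')) + (g \<cdot> f')"
    by (rule comp_add_right) (use assms hom_diff in auto)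
  then show ?thesis by simp
qed

lemma hom_sum:
  assumes "x \<in> Obj C" "y \<in> Obj C" "\<And>i. i < n \<Longrightarrow> f i \<in> Hom C x y"
  shows "(\<Sum>i<(n::nat). f i) \<in> Hom C x y"
  using assms(3) by (induction n) (auto simp: assms intro!: hom_add)

lemma comp_sum_left:
  assumes xyz: "x \<in> Obj C" "y \<in> Obj C" "z \<in> Obj C" and g: "g \<in> Hom C x y"
    and f: "\<And>i. i < n \<Longrightarrow> f i \<in> Hom C y z"
  shows "(\<Sum>i<(n::nat). f i) \<cdot> g = (\<Sum>i<n. f i \<cdot> g)"
  using f
proof (induction n)
  case 0 then show ?case using comp_zero_left[OF xyz g] by simp
next
  case (Suc n)
  have "(\<Sum>i<n. f i) \<in> Hom C y z" using Suc.prems xyz by (intro hom_sum) auto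
  then have "(\<Sum>i<Suc n. f i) \<cdot> g = ((\<Sum>i<n. f i) \<cdot> g) + (f n \<cdot> g)"
    using comp_add_left[OF xyz g] Suc.prems by (metis lessI sum.lessThan_Suc)
  also have "(\<Sum>i<n. f i) \<cdot> g = (\<Sum>i<n. f i \<cdot> g)" using Suc.prems by (intro Suc.IH) auto
  finally show ?case by simp
qed

lemma comp_sum_right:
  assumes xyz: "x \<in> Obj C" "y \<in> Obj C" "z \<in> Obj C" and g: "g \<in> Hom C y z"
    and f: "\<And>i. i < n \<Longrightarrow> f i \<in> Hom C x y"
  shows "g \<cdot> (\<Sum>i<(n::nat). f i) = (\<Sum>i<n. g \<cdot> f i)"
  using f
proof (induction n)
  case 0 then show ?case using comp_zero_right[OF xyz g] by simp
next
  case (Suc n)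
  have "(\<Sum>i<n. f i) \<in> Hom C x y" using Suc.prems xyz by (intro hom_sum) auto
  then have "g \<cdot> (\<Sum>i<Suc n. f i) = (g \<cdot> (\<Sum>i<n. f i)) + (g \<cdot> f n)"
    using comp_add_right[OF xyz _ _ g] Suc.prems by (metis lessI sum.lessThan_Suc)
  also have "g \<cdot> (\<Sum>i<n. f i) = (\<Sum>i<n. g \<cdot> f i)" using Suc.prems by (intro Suc.IH) auto
  finally show ?case by simp
qed

lemma linkedI: "\<lbrakk>maps f x y; mor f \<noteq> 0\<rbrakk> \<Longrightarrow> linked x y"
  unfolding linked_def by blast

lemma iso_arrowE:
  assumes "iso_arrow C x y f" "x \<in> Obj C" "y \<in> Obj C"
  obtains g where "maps (Arrow x f y) x y" "maps g y x"
    "g \<bullet> Arrow x f y = idt x" "Arrow x f y \<bullet> g = idt y"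
proof -
  obtain g where "inverse_arrows C x y f g" using assms(1) unfolding iso_arrow_def by blast
  then have "maps (Arrow x f y) x y" "maps (Arrow y g x) y x"
    "Arrow y g x \<bullet> Arrow x f y = idt x" "Arrow x f y \<bullet> Arrow y g x = idt y"
    using assms by (simp_all add: inverse_arrows_def cmp_def idt_def)
  then show ?thesis by (rule that)
qed

lemma iso_arrowI:
  assumes "maps f x y" "maps g y x" "g \<bullet> f = idt x" "f \<bullet> g = idt y"
  shows "iso_arrow C x y (mor f)"
proof -
  have "inverse_arrows C x y (mor f) (mor g)"
    using mapsD[OF assms(1)] mapsD[OF assms(2)] arg_cong[OF assms(3), of mor] arg_cong[OF assms(4), of mor]
    unfolding inverse_arrows_def by simp
  then show ?thesis unfolding iso_arrow_def by blast
qed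

lemma isomorphicI:
  assumes "maps f x y" "maps g y x" "g \<bullet> f = idt x" "f \<bullet> g = idt y"
  shows "isomorphic C x y"
  using iso_arrowI[OF assms] mapsD[OF assms(1)] unfolding isomorphic_def by blast

lemma isomorphicE:
  assumes "isomorphic C x y"
  obtains f g where "maps f x y" "maps g y x" "g \<bullet> f = idt x" "f \<bullet> g = idt y"
proof -
  obtain f where f: "iso_arrow C x y f" "x \<in> Obj C" "y \<in> Obj C"
    using assms unfolding isomorphic_def by blast
  show ?thesis using iso_arrowE[OF f] that by metis
qed

lemma iso_refl: "x \<in> Obj C \<Longrightarrow> isomorphic C x x"
  by (rule isomorphicI[of "idt x" _ _ "idt x"]) (simp_all add: maps_def)

lemma iso_sym: "isomorphic C x y \<Longrightarrow> isomorphic C y x"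
  by (erule isomorphicE) (rule isomorphicI)

lemma cmp_cancel:
  assumes "g \<bullet> f = idt (src f)" "maps f x y" "maps g y x" "maps h w x"
  shows "g \<bullet> (f \<bullet> h) = h"
  using cmp_assoc[of h f g] assms by (simp add: maps_def)

lemma iso_trans:
  assumes "isomorphic C x y" "isomorphic C y z"
  shows "isomorphic C x z"
proof -
  obtain f g where f: "maps f x y" "maps g y x" "g \<bullet> f = idt x" "f \<bullet> g = idt y"
    using assms(1) by (rule isomorphicE)
  obtain h k where h: "maps h y z" "maps k z y" "k \<bullet> h = idt y" "h \<bullet> k = idt z"
    using assms(2) by (rule isomorphicE)
  show ?thesis
    by (rule isomorphicI[of "h \<bullet> f" _ _ "g \<bullet> k"])
       (use f h cmp_cancel[of k h y z f x] cmp_cancel[of f g y x k z] in \<open>simp_all add: maps_def\<close>)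
qed

lemma iso_obj: "isomorphic C x y \<Longrightarrow> x \<in> Obj C \<and> y \<in> Obj C"
  by (simp add: isomorphic_def)

lemma iso_class_eq: "x \<in> Obj C \<Longrightarrow> iso_class C x = iso_class C y \<longleftrightarrow> isomorphic C x y"
  unfolding iso_class_def using iso_refl iso_sym iso_trans by blast

lemma summandI:
  assumes "maps i y x" "maps p x y" "p \<bullet> i = idt y"
  shows "is_summand C y x"
  using mapsD[OF assms(1)] mapsD[OF assms(2)] arg_cong[OF assms(3), of mor]
  unfolding is_summand_def by auto

lemma summandE:
  assumes "is_summand C y x"
  obtains i p where "maps i y x" "maps p x y" "p \<bullet> i = idt y"
proof -
  obtain i p where "x \<in> Obj C" "y \<in> Obj C" "i \<in> Hom C y x" "p \<in> Hom C x y" "p \<cdot> i = Ide C y"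
    using assms unfolding is_summand_def by blast
  then show ?thesis by (intro that[of "Arrow y i x" "Arrow x p y"]) (auto simp: cmp_def idt_def)
qed

lemma summand_obj: "is_summand C y x \<Longrightarrow> y \<in> Obj C \<and> x \<in> Obj C"
  by (simp add: is_summand_def)

lemma iso_summand: "isomorphic C x y \<Longrightarrow> is_summand C x y"
  by (elim isomorphicE) (rule summandI)

lemma summand_trans:
  assumes "is_summand C x y" "is_summand C y z"
  shows "is_summand C x z"
proof -
  obtain f g where f: "maps f x y" "maps g y x" "g \<bullet> f = idt x"
    using assms(1) by (rule summandE)
  obtain h k where h: "maps h y z" "maps k z y" "k \<bullet> h = idt y"
    using assms(2) by (rule summandE)
  show ?thesis
    by (rule summandI[of "h \<bullet> f" _ _ "g \<bullet> k"])
       (use f h cmp_cancel[of k h y z f x] in \<open>simp_all add: maps_def\<close>)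
qed

section \<open>Nonzero morphisms and direct sums\<close>

lemma zero_iff: "is_direct_sum C x [] \<longleftrightarrow> x \<in> Obj C \<and> Ide C x = 0"
  by (auto simp: is_direct_sum_def)

lemma linked_nonzero:
  assumes "linked x y"
  shows "\<not> is_direct_sum C x []" "\<not> is_direct_sum C y []"
proof -
  obtain f where f: "maps f x y" "mor f \<noteq> 0" using assms unfolding linked_def by blast
  then have ob: "x \<in> Obj C" "y \<in> Obj C" and e: "f \<bullet> idt x = f" "idt y \<bullet> f = f"
    using mapsD by (blast, blast, simp_all add: maps_def)
  show "\<not> is_direct_sum C x []" "\<not> is_direct_sum C y []"
    using cmp_nonzero(1)[OF maps_idt f(1)] cmp_nonzero(2)[OF f(1) maps_idt] f(2) ob
    unfolding e zero_iff by simp_all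
qed

lemma summand_linked:
  assumes "is_summand C y x" "\<not> is_direct_sum C y []"
  shows "linked y x" "linked x y"
proof -
  obtain i p where ip: "maps i y x" "maps p x y" "p \<bullet> i = idt y"
    using assms(1) by (rule summandE)
  then have "mor (p \<bullet> i) \<noteq> 0" using mapsD[OF ip(1)] assms(2) by (simp only: idt_sel zero_iff) simp
  then show "linked y x" "linked x y"
    using linkedI[OF ip(1)] linkedI[OF ip(2)] cmp_nonzero[OF ip(1,2)] by blast+
qed

lemma direct_sumE:
  assumes "is_direct_sum C X Xs"
  obtains \<iota> \<pi> where "X \<in> Obj C" "set Xs \<subseteq> Obj C"
    "\<And>i. i < length Xs \<Longrightarrow> maps (\<iota> i) (Xs ! i) X" "\<And>i. i < length Xs \<Longrightarrow> maps (\<pi> i) X (Xs ! i)"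
    "\<And>i. i < length Xs \<Longrightarrow> \<pi> i \<bullet> \<iota> i = idt (Xs ! i)"
    "(\<Sum>i<length Xs. mor (\<iota> i) \<cdot> mor (\<pi> i)) = Ide C X"
proof -
  have X: "X \<in> Obj C" "set Xs \<subseteq> Obj C" using assms unfolding is_direct_sum_def by simp_all
  have ob: "Xs ! i \<in> Obj C" if "i < length Xs" for i using X(2) that by auto
  obtain \<iota> \<pi> where h: "\<forall>i<length Xs. \<iota> i \<in> Hom C (Xs ! i) X \<and> \<pi> i \<in> Hom C X (Xs ! i)"
    and d: "\<forall>i<length Xs. \<forall>j<length Xs. \<pi> i \<cdot> \<iota> j = (if i = j then Ide C (Xs ! i) else 0)"
    and s: "(\<Sum>i<length Xs. \<iota> i \<cdot> \<pi> i) = Ide C X"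
    using assms unfolding is_direct_sum_def by (elim conjE exE)
  show ?thesis
  proof (rule that[of "\<lambda>i. Arrow (Xs ! i) (\<iota> i) X" "\<lambda>i. Arrow X (\<pi> i) (Xs ! i)"])
    fix i assume i: "i < length Xs"
    show "maps (Arrow (Xs ! i) (\<iota> i) X) (Xs ! i) X" "maps (Arrow X (\<pi> i) (Xs ! i)) X (Xs ! i)"
      using h i ob[OF i] X(1) by simp_all
    show "Arrow X (\<pi> i) (Xs ! i) \<bullet> Arrow (Xs ! i) (\<iota> i) X = idt (Xs ! i)"
      using d i by (simp add: cmp_def idt_def)
  qed (use X s in simp_all)
qed

lemma direct_sum_summand:
  assumes "is_direct_sum C X Xs" "T \<in> set Xs"
  shows "is_summand C T X"
proof -
  obtain i where i: "i < length Xs" "Xs ! i = T" using assms(2) by (metis in_set_conv_nth)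
  obtain \<iota> \<pi> where
    "\<And>i. i < length Xs \<Longrightarrow> maps (\<iota> i) (Xs ! i) X"
    and "\<And>i. i < length Xs \<Longrightarrow> maps (\<pi> i) X (Xs ! i)"
    and "\<And>i. i < length Xs \<Longrightarrow> \<pi> i \<bullet> \<iota> i = idt (Xs ! i)"
    using assms(1) by (rule direct_sumE) blast
  from summandI[OF this(1-3)[OF i(1)]] show ?thesis unfolding i(2) .
qed

text \<open>The identity of \<open>X\<close> is the sum of the projections onto the summands, each followed by its
  injection, so one of the corresponding terms of \<open>f\<close> is nonzero.\<close>

lemma direct_sum_nonzero_right:
  assumes f: "maps f S X" "mor f \<noteq> 0" and sum: "is_direct_sum C X Xs"
  obtains T p where "T \<in> set Xs" "maps p X T" "mor (p \<bullet> f) \<noteq> 0"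
proof -
  obtain \<iota> \<pi> where X: "X \<in> Obj C" "set Xs \<subseteq> Obj C"
    and io: "\<And>i. i < length Xs \<Longrightarrow> maps (\<iota> i) (Xs ! i) X"
    and pi: "\<And>i. i < length Xs \<Longrightarrow> maps (\<pi> i) X (Xs ! i)"
    and s: "(\<Sum>i<length Xs. mor (\<iota> i) \<cdot> mor (\<pi> i)) = Ide C X"
    using sum by (rule direct_sumE) blast
  have c: "mor (\<iota> i) \<cdot> mor (\<pi> i) \<in> Hom C X X" if "i < length Xs" for i
    using mapsD[OF maps_cmp[OF pi io]] that by simp
  have "mor f = mor (idt X \<bullet> f)" using f by (simp add: maps_def del: cmp_sel)
  also have "\<dots> = (\<Sum>i<length Xs. mor (\<iota> i) \<cdot> mor (\<pi> i)) \<cdot> mor f" by (simp add: s)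
  also have "\<dots> = (\<Sum>i<length Xs. (mor (\<iota> i) \<cdot> mor (\<pi> i)) \<cdot> mor f)"
    by (rule comp_sum_left[of S X X]) (use mapsD[OF f(1)] c in auto)
  finally obtain i where i: "i < length Xs" "(mor (\<iota> i) \<cdot> mor (\<pi> i)) \<cdot> mor f \<noteq> 0"
    using f(2) by (metis (no_types, lifting) lessThan_iff sum.neutral)
  note m = pi[OF i(1)] io[OF i(1)]
  have "mor (\<iota> i \<bullet> (\<pi> i \<bullet> f)) \<noteq> 0"
    using i(2) cmp_assoc[of f "\<pi> i" "\<iota> i"] m f(1) by (metis cmp_sel(3) maps_def)
  from cmp_nonzero(1)[OF maps_cmp[OF f(1) m(1)] m(2) this] that[OF _ m(1)] i(1)
  show ?thesis by simp
qed

lemma linked_direct_sum_right: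
  assumes "linked S X" "is_direct_sum C X Xs"
  shows "\<exists>T\<in>set Xs. linked S T"
proof -
  obtain f where f: "maps f S X" "mor f \<noteq> 0" using assms unfolding linked_def by blast
  obtain T p where "T \<in> set Xs" "maps p X T" "mor (p \<bullet> f) \<noteq> 0"
    using direct_sum_nonzero_right[OF f assms(2)] .
  then show ?thesis using linkedI[OF maps_cmp[OF f(1)]] by blast
qed

lemma direct_sum_nonzero_left:
  assumes f: "maps f X S" "mor f \<noteq> 0" and sum: "is_direct_sum C X Xs"
  obtains T p where "T \<in> set Xs" "maps p T X" "mor (f \<bullet> p) \<noteq> 0"
proof -
  obtain \<iota> \<pi> where X: "X \<in> Obj C" "set Xs \<subseteq> Obj C"
    and io: "\<And>i. i < length Xs \<Longrightarrow> maps (\<iota> i) (Xs ! i) X"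
    and pi: "\<And>i. i < length Xs \<Longrightarrow> maps (\<pi> i) X (Xs ! i)"
    and s: "(\<Sum>i<length Xs. mor (\<iota> i) \<cdot> mor (\<pi> i)) = Ide C X"
    using sum by (rule direct_sumE) blast
  have c: "mor (\<iota> i) \<cdot> mor (\<pi> i) \<in> Hom C X X" if "i < length Xs" for i
    using mapsD[OF maps_cmp[OF pi io]] that by simp
  have "mor f = mor (f \<bullet> idt X)" using f by (simp add: maps_def del: cmp_sel)
  also have "\<dots> = mor f \<cdot> (\<Sum>i<length Xs. mor (\<iota> i) \<cdot> mor (\<pi> i))" by (simp add: s)
  also have "\<dots> = (\<Sum>i<length Xs. mor f \<cdot> (mor (\<iota> i) \<cdot> mor (\<pi> i)))"
    by (rule comp_sum_right[of X X S]) (use mapsD[OF f(1)] c in auto)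
  finally obtain i where i: "i < length Xs" "mor f \<cdot> (mor (\<iota> i) \<cdot> mor (\<pi> i)) \<noteq> 0"
    using f(2) by (metis (no_types, lifting) lessThan_iff sum.neutral)
  note m = pi[OF i(1)] io[OF i(1)]
  have "mor ((f \<bullet> \<iota> i) \<bullet> \<pi> i) \<noteq> 0"
    using i(2) cmp_assoc[of "\<pi> i" "\<iota> i" f] m f(1) by (metis cmp_sel(3) maps_def)
  from cmp_nonzero(2)[OF m(1) maps_cmp[OF m(2) f(1)] this] that[OF _ m(2)] i(1)
  show ?thesis by simp
qed

lemma linked_direct_sum_left:
  assumes "linked X S" "is_direct_sum C X Xs"
  shows "\<exists>T\<in>set Xs. linked T S"
proof -
  obtain f where f: "maps f X S" "mor f \<noteq> 0" using assms unfolding linked_def by blast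
  obtain T p where "T \<in> set Xs" "maps p T X" "mor (f \<bullet> p) \<noteq> 0"
    using direct_sum_nonzero_left[OF f assms(2)] .
  then show ?thesis using linkedI[OF maps_cmp[OF _ f(1)]] by blast
qed

lemma nonzero_linked_self: "\<lbrakk>x \<in> Obj C; \<not> is_direct_sum C x []\<rbrakk> \<Longrightarrow> linked x x"
  by (rule linkedI[OF maps_idt]) (auto simp: zero_iff)

lemma linked_summand_right:
  assumes "linked x y" "is_summand C y z"
  shows "linked x z"
proof -
  obtain f where f: "maps f x y" "mor f \<noteq> 0" using assms unfolding linked_def by blast
  obtain i p where ip: "maps i y z" "maps p z y" "p \<bullet> i = idt y" using assms(2) by (rule summandE)
  have "p \<bullet> (i \<bullet> f) = f" using cmp_cancel[of p i y z f x] f ip by (simp add: maps_def)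
  then have "mor (i \<bullet> f) \<noteq> 0" using cmp_nonzero(1)[OF maps_cmp[OF f(1) ip(1)] ip(2)] f(2) by metis
  then show ?thesis using linkedI[OF maps_cmp[OF f(1) ip(1)]] by blast
qed

lemma linked_summand_left:
  assumes "linked x y" "is_summand C x z"
  shows "linked z y"
proof -
  obtain f where f: "maps f x y" "mor f \<noteq> 0" using assms unfolding linked_def by blast
  obtain i p where ip: "maps i x z" "maps p z x" "p \<bullet> i = idt x" using assms(2) by (rule summandE)
  have "(f \<bullet> p) \<bullet> i = f" using f ip by (simp add: maps_def)
  then have "mor (f \<bullet> p) \<noteq> 0" using cmp_nonzero(2)[OF ip(1) maps_cmp[OF ip(2) f(1)]] f(2) by metis
  then show ?thesis using linkedI[OF maps_cmp[OF ip(2) f(1)]] by blast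
qed

lemma linked_iso: "\<lbrakk>linked x y; isomorphic C x x'; isomorphic C y y'\<rbrakk> \<Longrightarrow> linked x' y'"
  using linked_summand_left linked_summand_right iso_summand by metis

lemma simple_obj: "simple C S \<Longrightarrow> S \<in> Obj C"
  by (simp add: simple_def)

lemma simple_nonzero: "simple C S \<Longrightarrow> \<not> is_direct_sum C S []"
  by (simp add: simple_def)

lemma split_mono_arrow:
  assumes i: "maps i x y" and p: "maps p y x" and pi: "p \<bullet> i = idt x"
  shows "mono_arrow C x y (mor i)"
  unfolding mono_arrow_def
proof (intro conjI ballI impI)
  show "mor i \<in> Hom C x y" using mapsD[OF i] by simp
  fix w f g assume h: "w \<in> Obj C" "f \<in> Hom C w x" "g \<in> Hom C w x" "mor i \<cdot> f = mor i \<cdot> g"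
  then have m: "maps (Arrow w f x) w x" "maps (Arrow w g x) w x" using mapsD[OF i] by simp_all
  have "i \<bullet> Arrow w f x = i \<bullet> Arrow w g x" using h(4) by (simp add: cmp_def)
  then have "p \<bullet> (i \<bullet> Arrow w f x) = p \<bullet> (i \<bullet> Arrow w g x)" by (rule arg_cong)
  moreover have "p \<bullet> i = idt (src i)" using pi i by (simp add: maps_def)
  ultimately have "Arrow w f x = Arrow w g x"
    using cmp_cancel[OF _ i p m(1)] cmp_cancel[OF _ i p m(2)] by simp
  then show "f = g" by simp
qed

lemma nonzero_summand_of_simple:
  assumes "simple C S" "is_summand C T S" "\<not> is_direct_sum C T []"
  shows "isomorphic C T S"
proof -
  obtain i p where ip: "maps i T S" "maps p S T" "p \<bullet> i = idt T" using assms(2) by (rule summandE)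
  then have "iso_arrow C T S (mor i)"
    using split_mono_arrow[OF ip] assms(1,3) mapsD[OF ip(1)] unfolding simple_def by blast
  then show ?thesis using mapsD[OF ip(1)] unfolding isomorphic_def by blast
qed

text \<open>A monomorphism into \<open>T\<close> becomes one into \<open>S\<close> after composition with the isomorphism, and
  it is invertible as soon as the composite is.\<close>

lemma simple_iso:
  assumes S: "simple C S" and iso: "isomorphic C S T"
  shows "simple C T"
  unfolding simple_def
proof (intro conjI ballI allI impI)
  obtain f g where fg: "maps f S T" "maps g T S" "g \<bullet> f = idt S" "f \<bullet> g = idt T"
    using iso by (rule isomorphicE)
  show T: "T \<in> Obj C" using mapsD[OF fg(1)] by simp
  have "linked T T"
    using nonzero_linked_self[OF simple_obj simple_nonzero] S linked_iso[OF _ iso iso] by blast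
  then show "\<not> is_direct_sum C T []" by (rule linked_nonzero)
  fix Y m assume Y: "Y \<in> Obj C" and m: "mono_arrow C Y T m"
  define n where "n = Arrow Y m T"
  have n: "maps n Y T" using m Y T unfolding mono_arrow_def n_def by simp
  have "mono_arrow C Y S (mor (g \<bullet> n))"
    unfolding mono_arrow_def
  proof (intro conjI ballI impI)
    show "mor (g \<bullet> n) \<in> Hom C Y S" using mapsD[OF maps_cmp[OF n fg(2)]] by simp
    fix w a b assume w: "w \<in> Obj C" and ab: "a \<in> Hom C w Y" "b \<in> Hom C w Y"
      and eq: "mor (g \<bullet> n) \<cdot> a = mor (g \<bullet> n) \<cdot> b"
    have mab: "maps (Arrow w a Y) w Y" "maps (Arrow w b Y) w Y" using w ab Y by simp_all
    have fgn: "f \<bullet> ((g \<bullet> n) \<bullet> k) = n \<bullet> k" if "maps k w Y" for k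
      using cmp_assoc[of "n \<bullet> k" g f] fg n that by (simp add: maps_def)
    have "(g \<bullet> n) \<bullet> Arrow w a Y = (g \<bullet> n) \<bullet> Arrow w b Y" using eq by (simp add: cmp_def)
    then have "n \<bullet> Arrow w a Y = n \<bullet> Arrow w b Y" using fgn mab by metis
    then have "m \<cdot> a = m \<cdot> b" by (simp add: cmp_def n_def)
    then show "a = b" using m w ab unfolding mono_arrow_def by blast
  qed
  then have "is_direct_sum C Y [] \<or> iso_arrow C Y S (mor (g \<bullet> n))"
    using S Y unfolding simple_def by blast
  then show "is_direct_sum C Y [] \<or> iso_arrow C Y T m"
  proof
    assume "iso_arrow C Y S (mor (g \<bullet> n))"
    then obtain k where "maps (Arrow Y (mor (g \<bullet> n)) S) Y S" and k: "maps k S Y"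
      "k \<bullet> Arrow Y (mor (g \<bullet> n)) S = idt Y" "Arrow Y (mor (g \<bullet> n)) S \<bullet> k = idt S"
      using Y simple_obj[OF S] by (rule iso_arrowE)
    moreover have "Arrow Y (mor (g \<bullet> n)) S = g \<bullet> n" using n fg(2) by (simp add: cmp_def maps_def)
    ultimately have kn: "k \<bullet> (g \<bullet> n) = idt Y" "g \<bullet> (n \<bullet> k) = idt S" using n fg(2) by (simp_all add: maps_def)
    have "n \<bullet> k = f \<bullet> (g \<bullet> (n \<bullet> k))" using cmp_assoc[of "n \<bullet> k" g f] n k(1) fg by (simp add: maps_def)
    also have "\<dots> = f" unfolding kn using fg(1) by (simp add: maps_def)
    finally have "n \<bullet> (k \<bullet> g) = idt T" using cmp_assoc[of g k n] n k(1) fg by (simp add: maps_def)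
    moreover have "(k \<bullet> g) \<bullet> n = idt Y" using kn n k(1) fg by (simp add: maps_def)
    ultimately have "iso_arrow C Y T (mor n)" using n maps_cmp[OF fg(2) k(1)] by (rule_tac iso_arrowI)
    then show ?thesis by (simp add: n_def)
  qed simp
qed

end

context fusion_category
begin

section \<open>Schur's lemma and splitting\<close>

text \<open>The kernel of \<open>f\<close> is a subobject of the simple \<open>x\<close>: it is not all of \<open>x\<close> because \<open>f\<close> is
  nonzero, hence it is zero. So \<open>f\<close> is a nonzero subobject of the simple \<open>y\<close>.\<close>

lemma schur:
  assumes f: "maps f x y" "mor f \<noteq> 0" and x: "simple C x" and y: "simple C y"
  obtains g where "maps g y x" "g \<bullet> f = idt x" "f \<bullet> g = idt y"
proof -
  have ob: "x \<in> Obj C" "y \<in> Obj C" "mor f \<in> Hom C x y" using mapsD[OF f(1)] by simp_all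
  then obtain K k where K: "is_kernel C x y (mor f) K k" using kernel by blast
  then have k: "K \<in> Obj C" "k \<in> Hom C K x" "mor f \<cdot> k = 0" unfolding is_kernel_def by simp_all
  have uniq: "\<exists>!u. u \<in> Hom C w K \<and> k \<cdot> u = g"
    if "w \<in> Obj C" "g \<in> Hom C w x" "mor f \<cdot> g = 0" for w g
    using K that unfolding is_kernel_def by blast
  have "mono_arrow C K x k"
    unfolding mono_arrow_def
  proof (intro conjI ballI impI)
    fix w u v assume w: "w \<in> Obj C" and uv: "u \<in> Hom C w K" "v \<in> Hom C w K" "k \<cdot> u = k \<cdot> v"
    have "mor f \<cdot> (k \<cdot> u) = (mor f \<cdot> k) \<cdot> u" using comp_assoc[OF w k(1) ob(1,2) uv(1) k(2) ob(3)] by simp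
    also have "\<dots> = 0" unfolding k(3) using w k(1) ob(2) uv(1) by (rule comp_zero_left)
    finally show "u = v" using uniq[OF w comp_hom[OF w k(1) ob(1) uv(1) k(2)]] uv by metis
  qed (rule k)
  then consider "is_direct_sum C K []" | "iso_arrow C K x k" using x k(1) unfolding simple_def by blast
  then have K0: "Ide C K = 0"
  proof cases
    case 2
    then obtain k' where k': "k' \<in> Hom C x K" "k \<cdot> k' = Ide C x"
      unfolding iso_arrow_def inverse_arrows_def by blast
    have "mor f = mor f \<cdot> (k \<cdot> k')" unfolding k' using comp_ide_right[OF ob] by simp
    also have "\<dots> = (mor f \<cdot> k) \<cdot> k'" using comp_assoc[OF ob(1) k(1) ob(1,2) k'(1) k(2) ob(3)] by simp
    also have "\<dots> = 0" unfolding k(3) using ob(1) k(1) ob(2) k'(1) by (rule comp_zero_left)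
    finally show ?thesis using f(2) by simp
  qed (simp add: zero_iff)
  have "mono_arrow C x y (mor f)"
    unfolding mono_arrow_def
  proof (intro conjI ballI impI)
    fix w u v assume w: "w \<in> Obj C" and uv: "u \<in> Hom C w x" "v \<in> Hom C w x" "mor f \<cdot> u = mor f \<cdot> v"
    then have d: "u - v \<in> Hom C w x" "mor f \<cdot> (u - v) = 0"
      using hom_diff[OF w ob(1) uv(1,2)] comp_diff_right[OF w ob(1,2) uv(1,2) ob(3)] by simp_all
    then obtain t where t: "t \<in> Hom C w K" "k \<cdot> t = u - v" using uniq[OF w d] by blast
    have "t = Ide C K \<cdot> t" using comp_ide_left[OF w k(1) t(1)] by simp
    also have "\<dots> = 0" unfolding K0 using w k(1) k(1) t(1) by (rule comp_zero_left)
    finally show "u = v" using t(2) comp_zero_right[OF w k(1) ob(1) k(2)] by simp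
  qed (rule ob)
  then have "iso_arrow C x y (mor f)" using y ob(1) simple_nonzero[OF x] unfolding simple_def by blast
  then obtain g where g: "maps g y x"
      "g \<bullet> Arrow x (mor f) y = idt x" "Arrow x (mor f) y \<bullet> g = idt y"
    using ob(1,2) by (rule iso_arrowE)
  moreover have "Arrow x (mor f) y = f" using f(1) by (cases f) (simp add: maps_def)
  ultimately show ?thesis using that by simp
qed

lemma linked_simples_iso: "\<lbrakk>linked x y; simple C x; simple C y\<rbrakk> \<Longrightarrow> isomorphic C x y"
  unfolding linked_def by (metis schur isomorphicI)

text \<open>The morphism is nonzero on some simple summand of \<open>X\<close>, where Schur's lemma inverts it; the
  inverse followed by the inclusion of that summand is the section.\<close>

lemma split_epi_to_simple:
  assumes f: "maps f X S" "mor f \<noteq> 0" and S: "simple C S"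
  obtains s where "maps s S X" "f \<bullet> s = idt S"
proof -
  obtain Xs where Xs: "\<forall>T\<in>set Xs. simple C T" "is_direct_sum C X Xs"
    using semisimple mapsD[OF f(1)] by blast
  obtain T i where T: "T \<in> set Xs" "maps i T X" "mor (f \<bullet> i) \<noteq> 0"
    using direct_sum_nonzero_left[OF f Xs(2)] .
  obtain g where g: "maps g S T" "g \<bullet> (f \<bullet> i) = idt T" "(f \<bullet> i) \<bullet> g = idt S"
    by (rule schur[OF maps_cmp[OF T(2) f(1)] T(3) _ S]) (use Xs(1) T(1) in auto)
  show ?thesis
    by (rule that[of "i \<bullet> g"]) (use g T(2) f(1) in \<open>simp_all add: maps_def\<close>)
qed

lemma split_mono_from_simple:
  assumes f: "maps f S X" "mor f \<noteq> 0" and S: "simple C S"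
  obtains r where "maps r X S" "r \<bullet> f = idt S"
proof -
  obtain Xs where Xs: "\<forall>T\<in>set Xs. simple C T" "is_direct_sum C X Xs"
    using semisimple mapsD[OF f(1)] by blast
  obtain T p where T: "T \<in> set Xs" "maps p X T" "mor (p \<bullet> f) \<noteq> 0"
    using direct_sum_nonzero_right[OF f Xs(2)] .
  obtain g where g: "maps g T S" "g \<bullet> (p \<bullet> f) = idt S" "(p \<bullet> f) \<bullet> g = idt T"
    by (rule schur[OF maps_cmp[OF f(1) T(2)] T(3) S]) (use Xs(1) T(1) in auto)
  show ?thesis
    by (rule that[of "g \<bullet> p"]) (use g T(2) f(1) in \<open>simp_all add: maps_def\<close>)
qed

lemma linked_to_simple_summand: "\<lbrakk>linked X S; simple C S\<rbrakk> \<Longrightarrow> is_summand C S X"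
  unfolding linked_def by (metis split_epi_to_simple summandI)

lemma linked_from_simple_summand: "\<lbrakk>linked S X; simple C S\<rbrakk> \<Longrightarrow> is_summand C S X"
  unfolding linked_def by (metis split_mono_from_simple summandI)

lemma nonzero_simple_summand:
  assumes "X \<in> Obj C" "\<not> is_direct_sum C X []"
  obtains S where "simple C S" "is_summand C S X"
proof -
  obtain Xs where Xs: "\<forall>T\<in>set Xs. simple C T" "is_direct_sum C X Xs"
    using semisimple assms(1) by blast
  obtain S where "S \<in> set Xs" using assms(2) Xs(2) by (cases Xs) auto
  then show ?thesis using that Xs direct_sum_summand by blast
qed

end

context linear_monoidal_category
begin

section \<open>Calculus of tensor products\<close>

definition tns :: "('a, 'b) arrow \<Rightarrow> ('a, 'b) arrow \<Rightarrow> ('a, 'b) arrow"  (infixl "\<boxtimes>" 80) where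
  "f \<boxtimes> g = Arrow (src f \<odot> src g) (mor f \<star> mor g) (tgt f \<odot> tgt g)"

definition assoc_arr :: "'a \<Rightarrow> 'a \<Rightarrow> 'a \<Rightarrow> ('a, 'b) arrow" where
  "assoc_arr x y z = Arrow ((x \<odot> y) \<odot> z) (Assoc C x y z) (x \<odot> (y \<odot> z))"

definition assoc_inv :: "'a \<Rightarrow> 'a \<Rightarrow> 'a \<Rightarrow> ('a, 'b) arrow" where
  "assoc_inv x y z = Arrow (x \<odot> (y \<odot> z))
     (inv_arrow C ((x \<odot> y) \<odot> z) (x \<odot> (y \<odot> z)) (Assoc C x y z)) ((x \<odot> y) \<odot> z)"

definition lunit_arr :: "'a \<Rightarrow> ('a, 'b) arrow" where
  "lunit_arr x = Arrow (Unit C \<odot> x) (LUnit C x) x"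

definition lunit_inv :: "'a \<Rightarrow> ('a, 'b) arrow" where
  "lunit_inv x = Arrow x (inv_arrow C (Unit C \<odot> x) x (LUnit C x)) (Unit C \<odot> x)"

definition runit_arr :: "'a \<Rightarrow> ('a, 'b) arrow" where
  "runit_arr x = Arrow (x \<odot> Unit C) (RUnit C x) x"

definition runit_inv :: "'a \<Rightarrow> ('a, 'b) arrow" where
  "runit_inv x = Arrow x (inv_arrow C (x \<odot> Unit C) x (RUnit C x)) (x \<odot> Unit C)"

text \<open>Inverses are unique, so the definite description picks the actual inverse; this is what
  turns the structure isomorphisms into cancellable arrows.\<close>

lemma inverse_arrows_inv_arrow:
  assumes "iso_arrow C x y f" "x \<in> Obj C" "y \<in> Obj C"
  shows "inverse_arrows C x y f (inv_arrow C x y f)"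
  unfolding inv_arrow_def
proof (rule theI')
  obtain g where g: "inverse_arrows C x y f g" using assms(1) unfolding iso_arrow_def by blast
  show "\<exists>!g. inverse_arrows C x y f g"
  proof (rule ex1I[of _ g])
    fix h assume h: "inverse_arrows C x y f h"
    have "h = Ide C x \<cdot> h" using comp_ide_left[OF assms(3,2)] h unfolding inverse_arrows_def by simp
    also have "\<dots> = (g \<cdot> f) \<cdot> h" using g unfolding inverse_arrows_def by simp
    also have "\<dots> = g \<cdot> (f \<cdot> h)"
      by (rule comp_assoc[of y x y x]) (use g h assms in \<open>simp_all add: inverse_arrows_def\<close>)
    also have "\<dots> = g" using comp_ide_right[OF assms(3,2)] g h unfolding inverse_arrows_def by simp
    finally show "h = g" .
  qed (rule g)
qed

lemma tns_sel [simp]: "src (f \<boxtimes> g) = src f \<odot> src g" "tgt (f \<boxtimes> g) = tgt f \<odot> tgt g"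
  "mor (f \<boxtimes> g) = mor f \<star> mor g"
  by (simp_all add: tns_def)

lemma arr_tns [simp]: "\<lbrakk>arr f; arr g\<rbrakk> \<Longrightarrow> arr (f \<boxtimes> g)"
  unfolding arr_def by (simp add: tenO_obj tenM_hom)

lemma tns_idt [simp]: "\<lbrakk>x \<in> Obj C; y \<in> Obj C\<rbrakk> \<Longrightarrow> idt x \<boxtimes> idt y = idt (x \<odot> y)"
  by (simp add: idt_def tns_def tenM_ide)

lemma interchange:
  "\<lbrakk>arr f; arr f'; arr g; arr g'; src f' = tgt f; src g' = tgt g\<rbrakk>
    \<Longrightarrow> (f' \<boxtimes> g') \<bullet> (f \<boxtimes> g) = (f' \<bullet> f) \<boxtimes> (g' \<bullet> g)"
  unfolding arr_def
  by (auto simp: cmp_def tns_def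
      tenM_comp[of "src f" "tgt f" "tgt f'" "src g" "tgt g" "tgt g'" "mor f" "mor f'" "mor g" "mor g'"])

lemma interchange_assoc:
  assumes "arr f" "arr f'" "arr g" "arr g'" "arr h" "src f' = tgt f" "src g' = tgt g"
    "src f \<odot> src g = tgt h"
  shows "(f' \<boxtimes> g') \<bullet> ((f \<boxtimes> g) \<bullet> h) = ((f' \<bullet> f) \<boxtimes> (g' \<bullet> g)) \<bullet> h"
  using cmp_assoc[of h "f \<boxtimes> g" "f' \<boxtimes> g'"] interchange[of f f' g g'] assms by simp

lemma coherence_sel [simp]:
  "src (assoc_arr x y z) = (x \<odot> y) \<odot> z" "tgt (assoc_arr x y z) = x \<odot> (y \<odot> z)"
  "src (assoc_inv x y z) = x \<odot> (y \<odot> z)" "tgt (assoc_inv x y z) = (x \<odot> y) \<odot> z"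
  "src (lunit_arr x) = Unit C \<odot> x" "tgt (lunit_arr x) = x" "src (lunit_inv x) = x" "tgt (lunit_inv x) = Unit C \<odot> x"
  "src (runit_arr x) = x \<odot> Unit C" "tgt (runit_arr x) = x" "src (runit_inv x) = x" "tgt (runit_inv x) = x \<odot> Unit C"
  by (simp_all add: assoc_arr_def assoc_inv_def lunit_arr_def lunit_inv_def runit_arr_def runit_inv_def)

lemma coherence_inverse:
  "\<lbrakk>x \<in> Obj C; y \<in> Obj C; z \<in> Obj C\<rbrakk>
    \<Longrightarrow> arr (assoc_arr x y z) \<and> arr (assoc_inv x y z) \<and>
        assoc_inv x y z \<bullet> assoc_arr x y z = idt ((x \<odot> y) \<odot> z) \<and> assoc_arr x y z \<bullet> assoc_inv x y z = idt (x \<odot> (y \<odot> z))"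
  "x \<in> Obj C \<Longrightarrow> arr (lunit_arr x) \<and> arr (lunit_inv x) \<and>
     lunit_inv x \<bullet> lunit_arr x = idt (Unit C \<odot> x) \<and> lunit_arr x \<bullet> lunit_inv x = idt x"
  "x \<in> Obj C \<Longrightarrow> arr (runit_arr x) \<and> arr (runit_inv x) \<and>
     runit_inv x \<bullet> runit_arr x = idt (x \<odot> Unit C) \<and> runit_arr x \<bullet> runit_inv x = idt x"
  using inverse_arrows_inv_arrow[OF assoc_iso, of x y z] inverse_arrows_inv_arrow[OF lunit_iso, of x]
    inverse_arrows_inv_arrow[OF runit_iso, of x]
  by (simp_all add: inverse_arrows_def cmp_def idt_def assoc_arr_def assoc_inv_def lunit_arr_def lunit_inv_def runit_arr_def runit_inv_def
      tenO_obj unit_obj)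

lemma coherence_arr [simp]:
  "\<lbrakk>x \<in> Obj C; y \<in> Obj C; z \<in> Obj C\<rbrakk> \<Longrightarrow> arr (assoc_arr x y z)"
  "\<lbrakk>x \<in> Obj C; y \<in> Obj C; z \<in> Obj C\<rbrakk> \<Longrightarrow> arr (assoc_inv x y z)"
  "x \<in> Obj C \<Longrightarrow> arr (lunit_arr x)" "x \<in> Obj C \<Longrightarrow> arr (lunit_inv x)"
  "x \<in> Obj C \<Longrightarrow> arr (runit_arr x)" "x \<in> Obj C \<Longrightarrow> arr (runit_inv x)"
  using coherence_inverse by blast+

lemma coherence_cancel:
  "\<lbrakk>x \<in> Obj C; y \<in> Obj C; z \<in> Obj C\<rbrakk> \<Longrightarrow> assoc_inv x y z \<bullet> assoc_arr x y z = idt ((x \<odot> y) \<odot> z)"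
  "\<lbrakk>x \<in> Obj C; y \<in> Obj C; z \<in> Obj C\<rbrakk> \<Longrightarrow> assoc_arr x y z \<bullet> assoc_inv x y z = idt (x \<odot> (y \<odot> z))"
  "x \<in> Obj C \<Longrightarrow> lunit_inv x \<bullet> lunit_arr x = idt (Unit C \<odot> x)" "x \<in> Obj C \<Longrightarrow> lunit_arr x \<bullet> lunit_inv x = idt x"
  "x \<in> Obj C \<Longrightarrow> runit_inv x \<bullet> runit_arr x = idt (x \<odot> Unit C)" "x \<in> Obj C \<Longrightarrow> runit_arr x \<bullet> runit_inv x = idt x"
  using coherence_inverse by blast+

lemma assoc_arr_natural:
  "\<lbrakk>arr f; arr g; arr h; tgt f = x; tgt g = y; tgt h = z\<rbrakk>
    \<Longrightarrow> assoc_arr x y z \<bullet> ((f \<boxtimes> g) \<boxtimes> h) = (f \<boxtimes> (g \<boxtimes> h)) \<bullet> assoc_arr (src f) (src g) (src h)"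
  unfolding arr_def by (auto simp: cmp_def tns_def assoc_arr_def assoc_natural)

lemma lunit_arr_natural: "\<lbrakk>arr f; tgt f = y\<rbrakk> \<Longrightarrow> lunit_arr y \<bullet> (idt (Unit C) \<boxtimes> f) = f \<bullet> lunit_arr (src f)"
  unfolding arr_def by (auto simp: cmp_def tns_def lunit_arr_def lunit_natural)

lemma runit_arr_natural: "\<lbrakk>arr f; tgt f = y\<rbrakk> \<Longrightarrow> runit_arr y \<bullet> (f \<boxtimes> idt (Unit C)) = f \<bullet> runit_arr (src f)"
  unfolding arr_def by (auto simp: cmp_def tns_def runit_arr_def runit_natural)

lemma pentagon_arr:
  assumes "w \<in> Obj C" "x \<in> Obj C" "y \<in> Obj C" "z \<in> Obj C"
  shows "assoc_arr w x (y \<odot> z) \<bullet> assoc_arr (w \<odot> x) y z =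
    (idt w \<boxtimes> assoc_arr x y z) \<bullet> (assoc_arr w (x \<odot> y) z \<bullet> (assoc_arr w x y \<boxtimes> idt z))"
  using pentagon[OF assms] by (simp add: cmp_def tns_def assoc_arr_def idt_def)

lemma triangle_arr:
  assumes "x \<in> Obj C" "y \<in> Obj C"
  shows "(idt x \<boxtimes> lunit_arr y) \<bullet> assoc_arr x (Unit C) y = runit_arr x \<boxtimes> idt y"
  using triangle[OF assms] by (simp add: cmp_def tns_def assoc_arr_def idt_def lunit_arr_def runit_arr_def)

lemma left_dualE:
  assumes "is_left_dual C Y X"
  obtains ev coev where "X \<in> Obj C" "Y \<in> Obj C" "maps ev (Y \<odot> X) (Unit C)" "maps coev (Unit C) (X \<odot> Y)"
    "runit_arr X \<bullet> ((idt X \<boxtimes> ev) \<bullet> (assoc_arr X Y X \<bullet> (coev \<boxtimes> idt X))) = lunit_arr X"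
    "lunit_arr Y \<bullet> ((ev \<boxtimes> idt Y) \<bullet> (assoc_inv Y X Y \<bullet> (idt Y \<boxtimes> coev))) = runit_arr Y"
proof -
  obtain ev coev where o: "X \<in> Obj C" "Y \<in> Obj C"
    and m: "ev \<in> Hom C (Y \<odot> X) (Unit C)" "coev \<in> Hom C (Unit C) (X \<odot> Y)"
    and z: "RUnit C X \<cdot> (Ide C X \<star> ev) \<cdot> Assoc C X Y X \<cdot> (coev \<star> Ide C X) = LUnit C X"
      "LUnit C Y \<cdot> (ev \<star> Ide C Y) \<cdot>
          inv_arrow C ((Y \<odot> X) \<odot> Y) (Y \<odot> (X \<odot> Y)) (Assoc C Y X Y) \<cdot>
          (Ide C Y \<star> coev) = RUnit C Y"
    using assms unfolding is_left_dual_def by blast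
  show ?thesis
    by (rule that[of "Arrow (Y \<odot> X) ev (Unit C)" "Arrow (Unit C) coev (X \<odot> Y)"])
      (use o m z tenO_obj unit_obj in
        \<open>simp_all add: cmp_def tns_def assoc_arr_def assoc_inv_def idt_def lunit_arr_def runit_arr_def\<close>)
qed

lemma assoc_inv_natural:
  assumes "arr f" "arr g" "arr h" "tgt f = x" "tgt g = y" "tgt h = z"
  shows "assoc_inv x y z \<bullet> (f \<boxtimes> (g \<boxtimes> h)) = ((f \<boxtimes> g) \<boxtimes> h) \<bullet> assoc_inv (src f) (src g) (src h)"
proof -
  have o: "x \<in> Obj C" "y \<in> Obj C" "z \<in> Obj C" "src f \<in> Obj C" "src g \<in> Obj C" "src h \<in> Obj C"
    using assms src_tgt_obj by blast+
  have "((f \<boxtimes> g) \<boxtimes> h) \<bullet> assoc_inv (src f) (src g) (src h)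
      = assoc_inv x y z \<bullet> (assoc_arr x y z \<bullet> (((f \<boxtimes> g) \<boxtimes> h) \<bullet> assoc_inv (src f) (src g) (src h)))"
    by (subst cmp_assoc[symmetric]) (use assms o in \<open>simp_all add: coherence_cancel\<close>)
  also have "\<dots> = assoc_inv x y z \<bullet> ((f \<boxtimes> (g \<boxtimes> h)) \<bullet> (assoc_arr (src f) (src g) (src h) \<bullet> assoc_inv (src f) (src g) (src h)))"
    using assms o by (simp add: assoc_arr_natural flip: cmp_assoc)
  also have "\<dots> = assoc_inv x y z \<bullet> (f \<boxtimes> (g \<boxtimes> h))"
    using assms o by (simp add: coherence_cancel tenO_obj)
  finally show ?thesis by simp
qed

lemma maps_tns: "\<lbrakk>maps f x y; maps g z w\<rbrakk> \<Longrightarrow> maps (f \<boxtimes> g) (x \<odot> z) (y \<odot> w)"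
  by (simp add: maps_def)

lemma iso_tensor:
  assumes "isomorphic C x x'" "isomorphic C y y'"
  shows "isomorphic C (x \<odot> y) (x' \<odot> y')"
proof -
  obtain f g where f: "maps f x x'" "maps g x' x" "g \<bullet> f = idt x" "f \<bullet> g = idt x'"
    using assms(1) by (rule isomorphicE)
  obtain h k where h: "maps h y y'" "maps k y' y" "k \<bullet> h = idt y" "h \<bullet> k = idt y'"
    using assms(2) by (rule isomorphicE)
  note o = mapsD[OF f(1)] mapsD[OF h(1)]
  show ?thesis
    by (rule isomorphicI[OF maps_tns[OF f(1) h(1)] maps_tns[OF f(2) h(2)]])
       (use f h o in \<open>simp_all add: maps_def interchange\<close>)
qed

lemma summand_tensor:
  assumes "is_summand C x x'" "is_summand C y y'"
  shows "is_summand C (x \<odot> y) (x' \<odot> y')"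
proof -
  obtain f g where f: "maps f x x'" "maps g x' x" "g \<bullet> f = idt x"
    using assms(1) by (rule summandE)
  obtain h k where h: "maps h y y'" "maps k y' y" "k \<bullet> h = idt y"
    using assms(2) by (rule summandE)
  note o = mapsD[OF f(1)] mapsD[OF h(1)]
  show ?thesis
    by (rule summandI[OF maps_tns[OF f(1) h(1)] maps_tns[OF f(2) h(2)]])
       (use f h o in \<open>simp_all add: maps_def interchange\<close>)
qed

lemma iso_assoc:
  "\<lbrakk>x \<in> Obj C; y \<in> Obj C; z \<in> Obj C\<rbrakk> \<Longrightarrow> isomorphic C ((x \<odot> y) \<odot> z) (x \<odot> (y \<odot> z))"
  unfolding isomorphic_def using assoc_iso[of x y z] by (auto intro!: tenO_obj)

lemma iso_lunit: "x \<in> Obj C \<Longrightarrow> isomorphic C (Unit C \<odot> x) x"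
  unfolding isomorphic_def using lunit_iso[of x] by (auto intro!: tenO_obj unit_obj)

lemma iso_runit: "x \<in> Obj C \<Longrightarrow> isomorphic C (x \<odot> Unit C) x"
  unfolding isomorphic_def using runit_iso[of x] by (auto intro!: tenO_obj unit_obj)

text \<open>Composites are kept associated to the right, so a commutation rule \<open>a \<bullet> b = c \<bullet> d\<close> has to be
  applied at the head of a longer composite.\<close>

lemma reassoc:
  assumes "a \<bullet> b = c \<bullet> d" "arr a" "arr b" "arr c" "arr d" "arr k" "src a = tgt b" "src c = tgt d"
    "src b = tgt k" "src d = tgt k"
  shows "a \<bullet> (b \<bullet> k) = c \<bullet> (d \<bullet> k)"
  using cmp_assoc[of k b a] cmp_assoc[of k d c] assms by simp

lemma whisker_left:
  "\<lbrakk>arr f; arr g; src g = tgt f; x \<in> Obj C\<rbrakk> \<Longrightarrow> idt x \<boxtimes> (g \<bullet> f) = (idt x \<boxtimes> g) \<bullet> (idt x \<boxtimes> f)"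
  by (simp add: interchange)

lemma whisker_right:
  "\<lbrakk>arr f; arr g; src g = tgt f; x \<in> Obj C\<rbrakk> \<Longrightarrow> (g \<bullet> f) \<boxtimes> idt x = (g \<boxtimes> idt x) \<bullet> (f \<boxtimes> idt x)"
  by (simp add: interchange)

lemma slide:
  "\<lbrakk>maps f x x'; maps g y y'\<rbrakk> \<Longrightarrow> (f \<boxtimes> idt y') \<bullet> (idt x \<boxtimes> g) = (idt x' \<boxtimes> g) \<bullet> (f \<boxtimes> idt y)"
  using mapsD[of f] mapsD[of g] by (simp add: interchange maps_def)

lemma tns_zero: "\<lbrakk>arr f; arr g; mor f = 0 \<or> mor g = 0\<rbrakk> \<Longrightarrow> mor (f \<boxtimes> g) = 0"
  using tenM_add_left[of "src f" "tgt f" "src g" "tgt g" 0 0 "mor g"]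
    tenM_add_right[of "src f" "tgt f" "src g" "tgt g" "mor f" 0 0]
  unfolding arr_def by auto

section \<open>Left duals\<close>

text \<open>One half of the adjunction between \<open>Y \<otimes> -\<close> and \<open>X \<otimes> -\<close>: up to the unit isomorphisms,
  \<open>p\<close> is recovered from its transpose \<open>(idt X \<boxtimes> p) \<bullet> coev\<close>. Sliding \<open>p\<close> past the associator and
  the evaluation leaves exactly the zigzag identity of \<open>Y\<close>.\<close>

lemma left_dual_determines_right:
  assumes o: "X \<in> Obj C" "Y \<in> Obj C" and ev: "maps ev (Y \<odot> X) (Unit C)"
    and co: "maps coev (Unit C) (X \<odot> Y)"
    and z: "lunit_arr Y \<bullet> ((ev \<boxtimes> idt Y) \<bullet> (assoc_inv Y X Y \<bullet> (idt Y \<boxtimes> coev))) = runit_arr Y"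
    and p: "maps p Y Z"
  shows "p \<bullet> runit_arr Y = lunit_arr Z \<bullet> ((ev \<boxtimes> idt Z) \<bullet> (assoc_inv Y X Z \<bullet> (idt Y \<boxtimes> ((idt X \<boxtimes> p) \<bullet> coev))))"
proof -
  note h = o mapsD[OF p] p[unfolded maps_def] ev[unfolded maps_def] co[unfolded maps_def] unit_obj tenO_obj
  let ?r = "assoc_inv Y X Y \<bullet> (idt Y \<boxtimes> coev)"
  have "assoc_inv Y X Z \<bullet> (idt Y \<boxtimes> ((idt X \<boxtimes> p) \<bullet> coev))
      = assoc_inv Y X Z \<bullet> ((idt Y \<boxtimes> (idt X \<boxtimes> p)) \<bullet> (idt Y \<boxtimes> coev))"
    using h by (simp add: whisker_left)
  also have "\<dots> = ((idt Y \<boxtimes> idt X) \<boxtimes> p) \<bullet> ?r"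
    by (rule reassoc) (use h assoc_inv_natural[of "idt Y" "idt X" p] in simp_all)
  finally have 1: "assoc_inv Y X Z \<bullet> (idt Y \<boxtimes> ((idt X \<boxtimes> p) \<bullet> coev)) = (idt (Y \<odot> X) \<boxtimes> p) \<bullet> ?r"
    using h by simp
  have 2: "(ev \<boxtimes> idt Z) \<bullet> ((idt (Y \<odot> X) \<boxtimes> p) \<bullet> ?r) = (idt (Unit C) \<boxtimes> p) \<bullet> ((ev \<boxtimes> idt Y) \<bullet> ?r)"
    by (rule reassoc[OF slide[OF ev p]]) (use h in simp_all)
  have 3: "lunit_arr Z \<bullet> ((idt (Unit C) \<boxtimes> p) \<bullet> ((ev \<boxtimes> idt Y) \<bullet> ?r)) = p \<bullet> (lunit_arr Y \<bullet> ((ev \<boxtimes> idt Y) \<bullet> ?r))"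
    by (rule reassoc) (use h lunit_arr_natural[of p] in simp_all)
  show ?thesis unfolding 1 2 3 z ..
qed

lemma left_dual_determines_left:
  assumes o: "X \<in> Obj C" "Y \<in> Obj C" and ev: "maps ev (Y \<odot> X) (Unit C)"
    and co: "maps coev (Unit C) (X \<odot> Y)"
    and z: "runit_arr X \<bullet> ((idt X \<boxtimes> ev) \<bullet> (assoc_arr X Y X \<bullet> (coev \<boxtimes> idt X))) = lunit_arr X"
    and p: "maps p X Z"
  shows "p \<bullet> lunit_arr X = runit_arr Z \<bullet> ((idt Z \<boxtimes> ev) \<bullet> (assoc_arr Z Y X \<bullet> (((p \<boxtimes> idt Y) \<bullet> coev) \<boxtimes> idt X)))"
proof -
  note h = o mapsD[OF p] p[unfolded maps_def] ev[unfolded maps_def] co[unfolded maps_def] unit_obj tenO_obj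
  let ?r = "assoc_arr X Y X \<bullet> (coev \<boxtimes> idt X)"
  have "assoc_arr Z Y X \<bullet> (((p \<boxtimes> idt Y) \<bullet> coev) \<boxtimes> idt X)
      = assoc_arr Z Y X \<bullet> (((p \<boxtimes> idt Y) \<boxtimes> idt X) \<bullet> (coev \<boxtimes> idt X))"
    using h by (simp add: whisker_right)
  also have "\<dots> = (p \<boxtimes> (idt Y \<boxtimes> idt X)) \<bullet> ?r"
    by (rule reassoc) (use h assoc_arr_natural[of p "idt Y" "idt X"] in simp_all)
  finally have 1: "assoc_arr Z Y X \<bullet> (((p \<boxtimes> idt Y) \<bullet> coev) \<boxtimes> idt X) = (p \<boxtimes> idt (Y \<odot> X)) \<bullet> ?r"
    using h by simp
  have 2: "(idt Z \<boxtimes> ev) \<bullet> ((p \<boxtimes> idt (Y \<odot> X)) \<bullet> ?r) = (p \<boxtimes> idt (Unit C)) \<bullet> ((idt X \<boxtimes> ev) \<bullet> ?r)"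
    by (rule reassoc[OF slide[OF p ev, symmetric]]) (use h in simp_all)
  have 3: "runit_arr Z \<bullet> ((p \<boxtimes> idt (Unit C)) \<bullet> ((idt X \<boxtimes> ev) \<bullet> ?r)) = p \<bullet> (runit_arr X \<bullet> ((idt X \<boxtimes> ev) \<bullet> ?r))"
    by (rule reassoc) (use h runit_arr_natural[of p] in simp_all)
  show ?thesis unfolding 1 2 3 z ..
qed

lemma cancel_epi:
  assumes "a \<bullet> e = b \<bullet> e" "e \<bullet> s = idt y" "arr a" "arr b" "arr e" "arr s"
    "src a = y" "src b = y" "tgt e = y" "tgt s = src e"
  shows "a = b"
proof -
  have "(a \<bullet> e) \<bullet> s = (b \<bullet> e) \<bullet> s" using assms(1) by simp
  then have "a \<bullet> (e \<bullet> s) = b \<bullet> (e \<bullet> s)" using assms(3-) by simp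
  then show ?thesis unfolding assms(2) using assms(3-) by simp
qed

lemma left_dual_faithful_right:
  assumes o: "X \<in> Obj C" "Y \<in> Obj C" and ev: "maps ev (Y \<odot> X) (Unit C)"
    and co: "maps coev (Unit C) (X \<odot> Y)"
    and z: "lunit_arr Y \<bullet> ((ev \<boxtimes> idt Y) \<bullet> (assoc_inv Y X Y \<bullet> (idt Y \<boxtimes> coev))) = runit_arr Y"
    and p: "maps p Y Z" "maps p' Y Z" and eq: "(idt X \<boxtimes> p) \<bullet> coev = (idt X \<boxtimes> p') \<bullet> coev"
  shows "p = p'"
proof (rule cancel_epi)
  show "p \<bullet> runit_arr Y = p' \<bullet> runit_arr Y"
    unfolding left_dual_determines_right[OF o ev co z p(1)] left_dual_determines_right[OF o ev co z p(2)] eq ..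
  show "runit_arr Y \<bullet> runit_inv Y = idt Y" using o by (simp add: coherence_cancel)
qed (use o p in \<open>simp_all add: maps_def\<close>)

lemma left_dual_faithful_left:
  assumes o: "X \<in> Obj C" "Y \<in> Obj C" and ev: "maps ev (Y \<odot> X) (Unit C)"
    and co: "maps coev (Unit C) (X \<odot> Y)"
    and z: "runit_arr X \<bullet> ((idt X \<boxtimes> ev) \<bullet> (assoc_arr X Y X \<bullet> (coev \<boxtimes> idt X))) = lunit_arr X"
    and p: "maps p X Z" "maps p' X Z" and eq: "(p \<boxtimes> idt Y) \<bullet> coev = (p' \<boxtimes> idt Y) \<bullet> coev"
  shows "p = p'"
proof (rule cancel_epi)
  show "p \<bullet> lunit_arr X = p' \<bullet> lunit_arr X"
    unfolding left_dual_determines_left[OF o ev co z p(1)] left_dual_determines_left[OF o ev co z p(2)] eq ..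
  show "lunit_arr X \<bullet> lunit_inv X = idt X" using o by (simp add: coherence_cancel)
qed (use o p in \<open>simp_all add: maps_def\<close>)

definition zer :: "'a \<Rightarrow> 'a \<Rightarrow> ('a, 'b) arrow" where
  "zer x y = Arrow x 0 y"

lemma zer_sel [simp]: "src (zer x y) = x" "tgt (zer x y) = y" "mor (zer x y) = 0"
  by (simp_all add: zer_def)

lemma maps_zer: "\<lbrakk>x \<in> Obj C; y \<in> Obj C\<rbrakk> \<Longrightarrow> maps (zer x y) x y"
  by (simp add: zer_def)

lemma zer_eqI: "\<lbrakk>maps f x y; mor f = 0\<rbrakk> \<Longrightarrow> f = zer x y"
  by (cases f) (simp add: zer_def)

lemma cmp_zer:
  "\<lbrakk>maps f x y; z \<in> Obj C\<rbrakk> \<Longrightarrow> zer y z \<bullet> f = zer x z"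
  "\<lbrakk>maps f y z; x \<in> Obj C\<rbrakk> \<Longrightarrow> f \<bullet> zer x y = zer x z"
  using mapsD[of f] by (auto simp: zer_def cmp_def maps_def)

lemma tns_zer:
  "\<lbrakk>maps f x y; z \<in> Obj C; w \<in> Obj C\<rbrakk> \<Longrightarrow> f \<boxtimes> zer z w = zer (x \<odot> z) (y \<odot> w)"
  "\<lbrakk>maps f x y; z \<in> Obj C; w \<in> Obj C\<rbrakk> \<Longrightarrow> zer z w \<boxtimes> f = zer (z \<odot> x) (w \<odot> y)"
  using zer_eqI[OF maps_tns[OF _ maps_zer], of f x y z w] zer_eqI[OF maps_tns[OF maps_zer], of z w f x y]
    tns_zero[of f "zer z w"] tns_zero[of "zer z w" f] maps_zer[of z w]
  by (simp_all add: maps_def)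

text \<open>The transpose of a nonzero morphism is nonzero, since the zero morphism has zero transpose
  and transposition is injective.\<close>

lemma left_dual_linked_right:
  assumes d: "is_left_dual C Y X" and p: "maps p Y Z" "mor p \<noteq> 0"
  shows "linked (Unit C) (X \<odot> Z)"
proof -
  obtain ev coev where e: "X \<in> Obj C" "Y \<in> Obj C" "maps ev (Y \<odot> X) (Unit C)" "maps coev (Unit C) (X \<odot> Y)"
    and z: "lunit_arr Y \<bullet> ((ev \<boxtimes> idt Y) \<bullet> (assoc_inv Y X Y \<bullet> (idt Y \<boxtimes> coev))) = runit_arr Y"
    using d by (rule left_dualE)
  have Z: "Z \<in> Obj C" using mapsD[OF p(1)] by simp
  have m: "maps ((idt X \<boxtimes> p) \<bullet> coev) (Unit C) (X \<odot> Z)"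
    by (rule maps_cmp[OF e(4) maps_tns[OF maps_idt[OF e(1)] p(1)]])
  moreover have "mor ((idt X \<boxtimes> p) \<bullet> coev) \<noteq> 0"
  proof
    assume "mor ((idt X \<boxtimes> p) \<bullet> coev) = 0"
    then have "(idt X \<boxtimes> p) \<bullet> coev = zer (Unit C) (X \<odot> Z)" by (rule zer_eqI[OF m])
    also have "\<dots> = (idt X \<boxtimes> zer Y Z) \<bullet> coev"
      using tns_zer(1)[OF maps_idt[OF e(1)] e(2) Z] cmp_zer(1)[OF e(4)] tenO_obj[OF e(1) Z] by simp
    finally have "p = zer Y Z" by (rule left_dual_faithful_right[OF e z p(1) maps_zer[OF e(2) Z]])
    then show False using p(2) by simp
  qed
  ultimately show ?thesis by (rule linkedI)
qed

lemma left_dual_linked_left: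
  assumes d: "is_left_dual C Y X" and p: "maps p X Z" "mor p \<noteq> 0"
  shows "linked (Unit C) (Z \<odot> Y)"
proof -
  obtain ev coev where e: "X \<in> Obj C" "Y \<in> Obj C" "maps ev (Y \<odot> X) (Unit C)" "maps coev (Unit C) (X \<odot> Y)"
    and z: "runit_arr X \<bullet> ((idt X \<boxtimes> ev) \<bullet> (assoc_arr X Y X \<bullet> (coev \<boxtimes> idt X))) = lunit_arr X"
    using d by (rule left_dualE)
  have Z: "Z \<in> Obj C" using mapsD[OF p(1)] by simp
  have m: "maps ((p \<boxtimes> idt Y) \<bullet> coev) (Unit C) (Z \<odot> Y)"
    by (rule maps_cmp[OF e(4) maps_tns[OF p(1) maps_idt[OF e(2)]]])
  moreover have "mor ((p \<boxtimes> idt Y) \<bullet> coev) \<noteq> 0"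
  proof
    assume "mor ((p \<boxtimes> idt Y) \<bullet> coev) = 0"
    then have "(p \<boxtimes> idt Y) \<bullet> coev = zer (Unit C) (Z \<odot> Y)" by (rule zer_eqI[OF m])
    also have "\<dots> = (zer X Z \<boxtimes> idt Y) \<bullet> coev"
      using tns_zer(2)[OF maps_idt[OF e(2)] e(1) Z] cmp_zer(1)[OF e(4)] tenO_obj[OF Z e(2)] by simp
    finally have "p = zer X Z" by (rule left_dual_faithful_left[OF e z p(1) maps_zer[OF e(1) Z]])
    then show False using p(2) by simp
  qed
  ultimately show ?thesis by (rule linkedI)
qed

text \<open>The pentagon solved for the composite that appears when \<open>(w \<otimes> x) \<otimes> (y \<otimes> z)\<close> is rebracketed
  around the middle pair \<open>x \<otimes> y\<close>.\<close>

lemma pentagon_inverse: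
  assumes o: "w \<in> Obj C" "x \<in> Obj C" "y \<in> Obj C" "z \<in> Obj C"
  shows "(assoc_arr w x y \<boxtimes> idt z) \<bullet> assoc_inv (w \<odot> x) y z =
    assoc_inv w (x \<odot> y) z \<bullet> ((idt w \<boxtimes> assoc_inv x y z) \<bullet> assoc_arr w x (y \<odot> z))"
proof -
  note h = o tenO_obj
  let ?A = "assoc_arr w x y \<boxtimes> idt z"
  have 1: "assoc_inv w (x \<odot> y) z \<bullet> ((idt w \<boxtimes> assoc_inv x y z) \<bullet> ((idt w \<boxtimes> assoc_arr x y z) \<bullet> (assoc_arr w (x \<odot> y) z \<bullet> ?A))) = ?A"
    using h interchange_assoc[of "idt w" "idt w" "assoc_arr x y z" "assoc_inv x y z" "assoc_arr w (x \<odot> y) z \<bullet> ?A"]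
      cmp_assoc[of ?A "assoc_arr w (x \<odot> y) z" "assoc_inv w (x \<odot> y) z"]
    by (simp add: coherence_cancel)
  have "?A \<bullet> assoc_inv (w \<odot> x) y z
      = (assoc_inv w (x \<odot> y) z \<bullet> ((idt w \<boxtimes> assoc_inv x y z) \<bullet> (assoc_arr w x (y \<odot> z) \<bullet> assoc_arr (w \<odot> x) y z))) \<bullet> assoc_inv (w \<odot> x) y z"
    unfolding pentagon_arr[OF o] 1 ..
  also have "\<dots> = assoc_inv w (x \<odot> y) z \<bullet> ((idt w \<boxtimes> assoc_inv x y z) \<bullet> assoc_arr w x (y \<odot> z))"
    using h by (simp add: coherence_cancel)
  finally show ?thesis .
qed

lemma triangle_inverse:
  assumes o: "x \<in> Obj C" "y \<in> Obj C"
  shows "(runit_arr x \<boxtimes> idt y) \<bullet> assoc_inv x (Unit C) y = idt x \<boxtimes> lunit_arr y"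
  using o unit_obj tenO_obj by (simp add: coherence_cancel flip: triangle_arr)

text \<open>A nonzero \<open>c\<close> from the unit to \<open>X \<otimes> Y\<close> has the transpose \<open>T c\<close>, which closes \<open>Y\<close> up with
  \<open>W\<close> by the evaluation and is, up to unit isomorphisms, a morphism from \<open>W\<close> to \<open>X\<close>. Tensoring
  \<open>T c\<close> with \<open>Y\<close> and precomposing with the coevaluation gives back \<open>c\<close> up to isomorphisms: the
  pentagon gathers the factors \<open>Y \<otimes> W \<otimes> Y\<close>, the triangle removes the unit that the evaluation
  leaves behind, and the zigzag identity of \<open>Y\<close> does the rest. Hence \<open>T c\<close> is nonzero. Starting from
  the transpose with its unit factors still attached keeps the pentagon and triangle as the only
  coherence conditions involved.\<close>

lemma coevaluation_linked_left:
  assumes d: "is_left_dual C Y W" and X: "X \<in> Obj C" and l: "linked (Unit C) (X \<odot> Y)"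
  shows "linked W X"
proof -
  obtain c where c: "maps c (Unit C) (X \<odot> Y)" "mor c \<noteq> 0" using l unfolding linked_def by blast
  obtain ev coev where o: "W \<in> Obj C" "Y \<in> Obj C" and ev: "maps ev (Y \<odot> W) (Unit C)"
    and co: "maps coev (Unit C) (W \<odot> Y)"
    and z: "lunit_arr Y \<bullet> ((ev \<boxtimes> idt Y) \<bullet> (assoc_inv Y W Y \<bullet> (idt Y \<boxtimes> coev))) = runit_arr Y"
    using d by (rule left_dualE)
  note h = o X ev[unfolded maps_def] co[unfolded maps_def] c(1)[unfolded maps_def] unit_obj tenO_obj
  define T where "T c = (idt X \<boxtimes> ev) \<bullet> (assoc_arr X Y W \<bullet> (c \<boxtimes> idt W))" for c
  have T: "maps (T b) (Unit C \<odot> W) (X \<odot> Unit C)" if "maps b (Unit C) (X \<odot> Y)" for b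
    using h that unfolding T_def by (simp add: maps_def)
  have rec: "(idt X \<boxtimes> runit_arr Y) \<bullet> (assoc_arr X Y (Unit C) \<bullet> (b \<boxtimes> idt (Unit C)))
      = (runit_arr X \<boxtimes> idt Y) \<bullet> ((T b \<boxtimes> idt Y) \<bullet> (assoc_inv (Unit C) W Y \<bullet> (idt (Unit C) \<boxtimes> coev)))"
    if b: "maps b (Unit C) (X \<odot> Y)" for b
  proof -
    note h = h b[unfolded maps_def]
    let ?k = "assoc_arr X Y (Unit C) \<bullet> (b \<boxtimes> idt (Unit C))"
    have Tb: "T b \<boxtimes> idt Y = ((idt X \<boxtimes> ev) \<boxtimes> idt Y) \<bullet> ((assoc_arr X Y W \<boxtimes> idt Y) \<bullet> ((b \<boxtimes> idt W) \<boxtimes> idt Y))"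
      using h unfolding T_def by (simp add: whisker_right)
    have "((b \<boxtimes> idt W) \<boxtimes> idt Y) \<bullet> (assoc_inv (Unit C) W Y \<bullet> (idt (Unit C) \<boxtimes> coev))
        = assoc_inv (X \<odot> Y) W Y \<bullet> ((b \<boxtimes> (idt W \<boxtimes> idt Y)) \<bullet> (idt (Unit C) \<boxtimes> coev))"
      by (rule reassoc) (use h assoc_inv_natural[of b "idt W" "idt Y" "X \<odot> Y" W Y] in simp_all)
    also have "(b \<boxtimes> (idt W \<boxtimes> idt Y)) \<bullet> (idt (Unit C) \<boxtimes> coev) = (idt (X \<odot> Y) \<boxtimes> coev) \<bullet> (b \<boxtimes> idt (Unit C))"
      using slide[OF b co] h by simp
    finally have 1: "((b \<boxtimes> idt W) \<boxtimes> idt Y) \<bullet> (assoc_inv (Unit C) W Y \<bullet> (idt (Unit C) \<boxtimes> coev))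
      = assoc_inv (X \<odot> Y) W Y \<bullet> ((idt (X \<odot> Y) \<boxtimes> coev) \<bullet> (b \<boxtimes> idt (Unit C)))" .
    let ?m = "(idt (X \<odot> Y) \<boxtimes> coev) \<bullet> (b \<boxtimes> idt (Unit C))"
    \<comment> \<open>The pentagon moves the brackets so that the three inner factors stand together.\<close>
    have 2: "(assoc_arr X Y W \<boxtimes> idt Y) \<bullet> (assoc_inv (X \<odot> Y) W Y \<bullet> ?m)
        = assoc_inv X (Y \<odot> W) Y \<bullet> ((idt X \<boxtimes> assoc_inv Y W Y) \<bullet> (assoc_arr X Y (W \<odot> Y) \<bullet> ?m))"
      using reassoc[OF pentagon_inverse[of X Y W Y], of ?m] h by simp
    have 3: "assoc_arr X Y (W \<odot> Y) \<bullet> ?m = (idt X \<boxtimes> (idt Y \<boxtimes> coev)) \<bullet> ?k"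
      by (rule reassoc) (use h assoc_arr_natural[of "idt X" "idt Y" coev X Y "W \<odot> Y"] in simp_all)
    have 4: "((idt X \<boxtimes> ev) \<boxtimes> idt Y) \<bullet> (assoc_inv X (Y \<odot> W) Y \<bullet> r)
        = assoc_inv X (Unit C) Y \<bullet> ((idt X \<boxtimes> (ev \<boxtimes> idt Y)) \<bullet> r)"
      if "arr r" "tgt r = X \<odot> ((Y \<odot> W) \<odot> Y)" for r
      by (rule reassoc) (use h that assoc_inv_natural[of "idt X" ev "idt Y" X "Unit C" Y] in simp_all)
    \<comment> \<open>The triangle removes the unit produced by the evaluation.\<close>
    have 5: "(runit_arr X \<boxtimes> idt Y) \<bullet> (assoc_inv X (Unit C) Y \<bullet> r) = (idt X \<boxtimes> lunit_arr Y) \<bullet> r"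
      if "arr r" "tgt r = X \<odot> (Unit C \<odot> Y)" for r
      using triangle_inverse[of X Y] cmp_assoc[of r "assoc_inv X (Unit C) Y" "runit_arr X \<boxtimes> idt Y"] h that by simp
    \<comment> \<open>Now all of \<open>ev\<close>, the inverse associator and \<open>coev\<close> are tensored with \<open>X\<close> on the left, where
      the zigzag identity applies.\<close>
    have "(runit_arr X \<boxtimes> idt Y) \<bullet> ((T b \<boxtimes> idt Y) \<bullet> (assoc_inv (Unit C) W Y \<bullet> (idt (Unit C) \<boxtimes> coev)))
      = (runit_arr X \<boxtimes> idt Y) \<bullet> (((idt X \<boxtimes> ev) \<boxtimes> idt Y) \<bullet> (assoc_inv X (Y \<odot> W) Y \<bullet>
          ((idt X \<boxtimes> assoc_inv Y W Y) \<bullet> ((idt X \<boxtimes> (idt Y \<boxtimes> coev)) \<bullet> ?k))))"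
      unfolding Tb 2[symmetric] 3[symmetric] 1[symmetric] using h by simp
    also have "\<dots> = (idt X \<boxtimes> lunit_arr Y) \<bullet> ((idt X \<boxtimes> (ev \<boxtimes> idt Y)) \<bullet> ((idt X \<boxtimes> assoc_inv Y W Y) \<bullet>
        ((idt X \<boxtimes> (idt Y \<boxtimes> coev)) \<bullet> ?k)))"
      using h 4 5 by simp
    also have "\<dots> = (idt X \<boxtimes> (lunit_arr Y \<bullet> ((ev \<boxtimes> idt Y) \<bullet> (assoc_inv Y W Y \<bullet> (idt Y \<boxtimes> coev))))) \<bullet> ?k"
      using h by (simp add: whisker_left)
    finally show ?thesis unfolding z ..
  qed
  have "mor (T c) \<noteq> 0"
  proof
    assume "mor (T c) = 0"
    let ?z = "zer (Unit C) (X \<odot> Y)"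
    have mz: "maps ?z (Unit C) (X \<odot> Y)" using h by (intro maps_zer)
    have "T c = zer (Unit C \<odot> W) (X \<odot> Unit C)" using zer_eqI[OF T[OF c(1)]] \<open>mor (T c) = 0\<close> .
    also have "\<dots> = T ?z"
    proof (rule zer_eqI[OF T[OF mz], symmetric])
      have "mor (?z \<boxtimes> idt W) = 0" using tns_zero[of ?z "idt W"] mz h by (simp add: maps_def)
      then have "mor (assoc_arr X Y W \<bullet> (?z \<boxtimes> idt W)) = 0"
        using cmp_nonzero(1)[of "?z \<boxtimes> idt W" "Unit C \<odot> W" "(X \<odot> Y) \<odot> W" "assoc_arr X Y W" "X \<odot> (Y \<odot> W)"] mz h
        by (auto simp: maps_def)
      then show "mor (T ?z) = 0"
        using cmp_nonzero(1)[of "assoc_arr X Y W \<bullet> (?z \<boxtimes> idt W)" "Unit C \<odot> W" "X \<odot> (Y \<odot> W)"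
            "idt X \<boxtimes> ev" "X \<odot> Unit C"] mz h
        by (auto simp: maps_def T_def)
    qed
    finally have "T c = T ?z" .
    then have eq: "(idt X \<boxtimes> runit_arr Y) \<bullet> (assoc_arr X Y (Unit C) \<bullet> (c \<boxtimes> idt (Unit C)))
        = (idt X \<boxtimes> runit_arr Y) \<bullet> (assoc_arr X Y (Unit C) \<bullet> (?z \<boxtimes> idt (Unit C)))"
      unfolding rec[OF c(1)] rec[OF mz] by simp
    have recover: "b \<bullet> runit_arr (Unit C) = runit_arr (X \<odot> Y) \<bullet> (assoc_inv X Y (Unit C) \<bullet> ((idt X \<boxtimes> runit_inv Y) \<bullet>
        ((idt X \<boxtimes> runit_arr Y) \<bullet> (assoc_arr X Y (Unit C) \<bullet> (b \<boxtimes> idt (Unit C))))))"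
      if b: "maps b (Unit C) (X \<odot> Y)" for b
      using h b[unfolded maps_def] runit_arr_natural[of b]
        interchange_assoc[of "idt X" "idt X" "runit_arr Y" "runit_inv Y" "assoc_arr X Y (Unit C) \<bullet> (b \<boxtimes> idt (Unit C))"]
        cmp_assoc[of "b \<boxtimes> idt (Unit C)" "assoc_arr X Y (Unit C)" "assoc_inv X Y (Unit C)"]
      by (simp add: coherence_cancel)
    have "c = ?z"
    proof (rule cancel_epi)
      show "c \<bullet> runit_arr (Unit C) = ?z \<bullet> runit_arr (Unit C)" unfolding recover[OF c(1)] recover[OF mz] eq ..
      show "runit_arr (Unit C) \<bullet> runit_inv (Unit C) = idt (Unit C)" using h by (simp add: coherence_cancel)
    qed (use h mz in \<open>simp_all add: maps_def\<close>)
    then show False using c(2) by simp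
  qed
  then have "linked (Unit C \<odot> W) (X \<odot> Unit C)" using linkedI[OF T[OF c(1)]] by blast
  then show ?thesis using linked_iso iso_lunit[OF o(1)] iso_runit[OF X] by blast
qed

text \<open>Either of the two being zero would make the left unit isomorphism of \<open>X\<close> zero, by the
  zigzag identity of \<open>X\<close>.\<close>

lemma left_dual_nonzero:
  assumes ob: "X \<in> Obj C" "Y \<in> Obj C" and ev: "maps ev (Y \<odot> X) (Unit C)"
    and co: "maps coev (Unit C) (X \<odot> Y)"
    and z: "runit_arr X \<bullet> ((idt X \<boxtimes> ev) \<bullet> (assoc_arr X Y X \<bullet> (coev \<boxtimes> idt X))) = lunit_arr X"
    and X: "\<not> is_direct_sum C X []"
  shows "mor ev \<noteq> 0" "mor coev \<noteq> 0"
proof -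
  note h = ob ev[unfolded maps_def] co[unfolded maps_def] unit_obj tenO_obj
  have m: "maps (lunit_inv X) X (Unit C \<odot> X)" "maps (lunit_arr X) (Unit C \<odot> X) X" "maps (runit_arr X) (X \<odot> Unit C) X"
    "maps (idt X \<boxtimes> ev) (X \<odot> (Y \<odot> X)) (X \<odot> Unit C)"
    "maps (assoc_arr X Y X) ((X \<odot> Y) \<odot> X) (X \<odot> (Y \<odot> X))"
    "maps (coev \<boxtimes> idt X) (Unit C \<odot> X) ((X \<odot> Y) \<odot> X)"
    using h by (simp_all add: maps_def)
  have "mor (lunit_arr X \<bullet> lunit_inv X) \<noteq> 0" using X h by (simp add: coherence_cancel zero_iff del: cmp_sel)
  then have "mor (lunit_arr X) \<noteq> 0" by (rule cmp_nonzero(2)[OF m(1,2)])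
  then have "mor ((idt X \<boxtimes> ev) \<bullet> (assoc_arr X Y X \<bullet> (coev \<boxtimes> idt X))) \<noteq> 0"
    unfolding z[symmetric] by (rule cmp_nonzero(1)[OF maps_cmp[OF maps_cmp[OF m(6,5)] m(4)] m(3)])
  note nz = cmp_nonzero[OF maps_cmp[OF m(6,5)] m(4) this]
  show "mor ev \<noteq> 0" using nz(2) tns_zero[of "idt X" ev] h by auto
  show "mor coev \<noteq> 0" using cmp_nonzero(1)[OF m(6,5) nz(1)] tns_zero[of coev "idt X"] h by auto
qed

lemma tensor_nonzero_factors:
  assumes "\<not> is_direct_sum C (x \<odot> y) []" "x \<in> Obj C" "y \<in> Obj C"
  shows "\<not> is_direct_sum C x []" "\<not> is_direct_sum C y []"
  using assms tns_zero[of "idt x" "idt y"] by (auto simp: zero_iff tenO_obj tenM_ide)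

lemma tensor_sum_right:
  assumes "w \<in> Obj C" "w' \<in> Obj C" "x \<in> Obj C" "y \<in> Obj C" "g \<in> Hom C w w'"
    "\<And>i. i < n \<Longrightarrow> f i \<in> Hom C x y"
  shows "g \<star> (\<Sum>i<(n::nat). f i) = (\<Sum>i<n. g \<star> f i)"
  using assms(6)
proof (induction n)
  case 0
  show ?case using tenM_add_right[OF assms(1-5), of 0 0] assms by simp
next
  case (Suc n)
  have "(\<Sum>i<n. f i) \<in> Hom C x y" using Suc.prems assms by (intro hom_sum) auto
  then have "g \<star> (\<Sum>i<Suc n. f i) = (g \<star> (\<Sum>i<n. f i)) + (g \<star> f n)"
    using tenM_add_right[OF assms(1-5)] Suc.prems by (metis lessI sum.lessThan_Suc)
  also have "g \<star> (\<Sum>i<n. f i) = (\<Sum>i<n. g \<star> f i)" using Suc.prems by (intro Suc.IH) auto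
  finally show ?case by simp
qed

lemma tensor_sum_left:
  assumes "w \<in> Obj C" "w' \<in> Obj C" "x \<in> Obj C" "y \<in> Obj C" "g \<in> Hom C w w'"
    "\<And>i. i < n \<Longrightarrow> f i \<in> Hom C x y"
  shows "(\<Sum>i<(n::nat). f i) \<star> g = (\<Sum>i<n. f i \<star> g)"
  using assms(6)
proof (induction n)
  case 0
  show ?case using tenM_add_left[OF assms(3,4,1,2) _ _ assms(5), of 0 0] assms by simp
next
  case (Suc n)
  have "(\<Sum>i<n. f i) \<in> Hom C x y" using Suc.prems assms by (intro hom_sum) auto
  then have "(\<Sum>i<Suc n. f i) \<star> g = ((\<Sum>i<n. f i) \<star> g) + (f n \<star> g)"
    using tenM_add_left[OF assms(3,4,1,2) _ _ assms(5)] Suc.prems by (metis lessI sum.lessThan_Suc)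
  also have "(\<Sum>i<n. f i) \<star> g = (\<Sum>i<n. f i \<star> g)" using Suc.prems by (intro Suc.IH) auto
  finally show ?case by simp
qed

text \<open>Injections and projections tensored with \<open>y\<close> satisfy the same equations, by additivity of
  the tensor product.\<close>

lemma tensor_direct_sum_right:
  assumes "is_direct_sum C z Zs" and y: "y \<in> Obj C"
  shows "is_direct_sum C (y \<odot> z) (map (\<lambda>Z. y \<odot> Z) Zs)"
proof -
  have X: "z \<in> Obj C" "set Zs \<subseteq> Obj C" using assms unfolding is_direct_sum_def by simp_all
  have ob: "Zs ! i \<in> Obj C" if "i < length Zs" for i using X(2) that by auto
  obtain \<iota> \<pi> where h: "\<And>i. i < length Zs \<Longrightarrow> \<iota> i \<in> Hom C (Zs ! i) z \<and> \<pi> i \<in> Hom C z (Zs ! i)"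
    and d: "\<And>i j. \<lbrakk>i < length Zs; j < length Zs\<rbrakk> \<Longrightarrow> \<pi> i \<cdot> \<iota> j = (if i = j then Ide C (Zs ! i) else 0)"
    and s: "(\<Sum>i<length Zs. \<iota> i \<cdot> \<pi> i) = Ide C z"
    using assms unfolding is_direct_sum_def by blast
  have 1: "(Ide C y \<star> \<pi> i) \<cdot> (Ide C y \<star> \<iota> j) = (if i = j then Ide C (y \<odot> Zs ! i) else 0)"
    if "i < length Zs" "j < length Zs" for i j
  proof -
    have "(Ide C y \<star> \<pi> i) \<cdot> (Ide C y \<star> \<iota> j) = (Ide C y \<cdot> Ide C y) \<star> (\<pi> i \<cdot> \<iota> j)"
      using tenM_comp[OF y y y ob[OF that(2)] X(1) ob[OF that(1)] ide_hom[OF y]] h that y ide_hom by metis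
    then show ?thesis
      using d[OF that] tns_zero[of "idt y" "zer (Zs ! j) (Zs ! i)"] tenM_ide y ob that maps_zer[of "Zs ! j" "Zs ! i"]
        comp_ide_left[OF y y] ide_hom[OF y] by (auto simp: maps_def)
  qed
  have 2: "(\<Sum>i<length Zs. (Ide C y \<star> \<iota> i) \<cdot> (Ide C y \<star> \<pi> i)) = Ide C (y \<odot> z)"
  proof -
    have "(Ide C y \<star> \<iota> i) \<cdot> (Ide C y \<star> \<pi> i) = Ide C y \<star> (\<iota> i \<cdot> \<pi> i)" if "i < length Zs" for i
      using tenM_comp[OF y y y X(1) ob[OF that] X(1) ide_hom[OF y] ide_hom[OF y]] h[OF that]
        comp_ide_left[OF y y ide_hom[OF y]] by metis
    then have "(\<Sum>i<length Zs. (Ide C y \<star> \<iota> i) \<cdot> (Ide C y \<star> \<pi> i)) = Ide C y \<star> (\<Sum>i<length Zs. \<iota> i \<cdot> \<pi> i)"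
      using tensor_sum_right[OF y y X(1) X(1) ide_hom[OF y], of "length Zs" "\<lambda>i. \<iota> i \<cdot> \<pi> i"]
        comp_hom[OF X(1) ob X(1)] h by auto
    then show ?thesis unfolding s by (simp add: tenM_ide y X)
  qed
  show ?thesis
    unfolding is_direct_sum_def
    by (intro conjI exI[of _ "\<lambda>i. Ide C y \<star> \<iota> i"] exI[of _ "\<lambda>i. Ide C y \<star> \<pi> i"])
       (use 1 2 X y h ob tenO_obj tenM_hom ide_hom in auto)
qed

lemma tensor_direct_sum_left:
  assumes "is_direct_sum C z Zs" and y: "y \<in> Obj C"
  shows "is_direct_sum C (z \<odot> y) (map (\<lambda>Z. Z \<odot> y) Zs)"
proof -
  have X: "z \<in> Obj C" "set Zs \<subseteq> Obj C" using assms unfolding is_direct_sum_def by simp_all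
  have ob: "Zs ! i \<in> Obj C" if "i < length Zs" for i using X(2) that by auto
  obtain \<iota> \<pi> where h: "\<And>i. i < length Zs \<Longrightarrow> \<iota> i \<in> Hom C (Zs ! i) z \<and> \<pi> i \<in> Hom C z (Zs ! i)"
    and d: "\<And>i j. \<lbrakk>i < length Zs; j < length Zs\<rbrakk> \<Longrightarrow> \<pi> i \<cdot> \<iota> j = (if i = j then Ide C (Zs ! i) else 0)"
    and s: "(\<Sum>i<length Zs. \<iota> i \<cdot> \<pi> i) = Ide C z"
    using assms unfolding is_direct_sum_def by blast
  have 1: "(\<pi> i \<star> Ide C y) \<cdot> (\<iota> j \<star> Ide C y) = (if i = j then Ide C (Zs ! i \<odot> y) else 0)"
    if "i < length Zs" "j < length Zs" for i j
  proof -
    have "(\<pi> i \<star> Ide C y) \<cdot> (\<iota> j \<star> Ide C y) = (\<pi> i \<cdot> \<iota> j) \<star> (Ide C y \<cdot> Ide C y)"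
      using tenM_comp[OF ob[OF that(2)] X(1) ob[OF that(1)] y y y] h that y ide_hom by metis
    then show ?thesis
      using d[OF that] tns_zero[of "zer (Zs ! j) (Zs ! i)" "idt y"] tenM_ide y ob that maps_zer[of "Zs ! j" "Zs ! i"]
        comp_ide_left[OF y y] ide_hom[OF y] by (auto simp: maps_def)
  qed
  have 2: "(\<Sum>i<length Zs. (\<iota> i \<star> Ide C y) \<cdot> (\<pi> i \<star> Ide C y)) = Ide C (z \<odot> y)"
  proof -
    have "(\<iota> i \<star> Ide C y) \<cdot> (\<pi> i \<star> Ide C y) = (\<iota> i \<cdot> \<pi> i) \<star> Ide C y" if "i < length Zs" for i
      using tenM_comp[OF X(1) ob[OF that] X(1) y y y _ _ ide_hom[OF y] ide_hom[OF y]] h[OF that]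
        comp_ide_left[OF y y ide_hom[OF y]] by metis
    then have "(\<Sum>i<length Zs. (\<iota> i \<star> Ide C y) \<cdot> (\<pi> i \<star> Ide C y)) = (\<Sum>i<length Zs. \<iota> i \<cdot> \<pi> i) \<star> Ide C y"
      using tensor_sum_left[OF y y X(1) X(1) ide_hom[OF y], of "length Zs" "\<lambda>i. \<iota> i \<cdot> \<pi> i"]
        comp_hom[OF X(1) ob X(1)] h by auto
    then show ?thesis unfolding s by (simp add: tenM_ide y X)
  qed
  show ?thesis
    unfolding is_direct_sum_def
    by (intro conjI exI[of _ "\<lambda>i. \<iota> i \<star> Ide C y"] exI[of _ "\<lambda>i. \<pi> i \<star> Ide C y"])
       (use 1 2 X y h ob tenO_obj tenM_hom ide_hom in auto)
qed

end

context fusion_category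
begin

section \<open>Faithfulness and fullness of tensoring\<close>

text \<open>The coevaluation of the nonzero \<open>y\<close> starts at the simple unit, so it splits by some \<open>r\<close>.
  Thus \<open>b \<boxtimes> idt (Unit C)\<close>, and with it \<open>b\<close>, is recovered from \<open>b \<boxtimes> idt (y \<odot> z)\<close>, that is, from
  \<open>(b \<boxtimes> idt y) \<boxtimes> idt z\<close>.\<close>

lemma faithful_right:
  assumes f: "maps f x x'" "maps g x x'" and eq: "f \<boxtimes> idt y = g \<boxtimes> idt y"
    and y: "y \<in> Obj C" "\<not> is_direct_sum C y []"
  shows "f = g"
proof -
  obtain z where d: "is_left_dual C z y" using left_rigid[OF y(1)] by blast
  obtain ev c where o: "y \<in> Obj C" "z \<in> Obj C" and ev: "maps ev (z \<odot> y) (Unit C)" and c: "maps c (Unit C) (y \<odot> z)"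
    and zz: "runit_arr y \<bullet> ((idt y \<boxtimes> ev) \<bullet> (assoc_arr y z y \<bullet> (c \<boxtimes> idt y))) = lunit_arr y"
    using d by (rule left_dualE)
  obtain r where r: "maps r (y \<odot> z) (Unit C)" "r \<bullet> c = idt (Unit C)"
    using split_mono_from_simple[OF c left_dual_nonzero(2)[OF o ev c zz y(2)] unit_simple] .
  have ox: "x \<in> Obj C" "x' \<in> Obj C" using mapsD[OF f(1)] by simp_all
  note h = ox o unit_obj tenO_obj c[unfolded maps_def] r(1)[unfolded maps_def]
  have rec: "b \<bullet> runit_arr x = runit_arr x' \<bullet> ((idt x' \<boxtimes> r) \<bullet> (assoc_arr x' y z \<bullet> (((b \<boxtimes> idt y) \<boxtimes> idt z) \<bullet>
      (assoc_inv x y z \<bullet> (idt x \<boxtimes> c)))))" if b: "maps b x x'" for b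
  proof -
    note h = h b[unfolded maps_def]
    have "assoc_arr x' y z \<bullet> (((b \<boxtimes> idt y) \<boxtimes> idt z) \<bullet> (assoc_inv x y z \<bullet> (idt x \<boxtimes> c)))
      = (b \<boxtimes> (idt y \<boxtimes> idt z)) \<bullet> (assoc_arr x y z \<bullet> (assoc_inv x y z \<bullet> (idt x \<boxtimes> c)))"
      by (rule reassoc) (use h assoc_arr_natural[of b "idt y" "idt z" x' y z] in simp_all)
    also have "assoc_arr x y z \<bullet> (assoc_inv x y z \<bullet> (idt x \<boxtimes> c)) = idt x \<boxtimes> c"
      using h cmp_assoc[of "idt x \<boxtimes> c" "assoc_inv x y z" "assoc_arr x y z"] by (simp add: coherence_cancel)
    also have "(b \<boxtimes> (idt y \<boxtimes> idt z)) \<bullet> (idt x \<boxtimes> c) = (idt x' \<boxtimes> c) \<bullet> (b \<boxtimes> idt (Unit C))"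
      using slide[OF b c] h by simp
    also have "(idt x' \<boxtimes> r) \<bullet> ((idt x' \<boxtimes> c) \<bullet> (b \<boxtimes> idt (Unit C))) = b \<boxtimes> idt (Unit C)"
      using h r(2) interchange_assoc[of "idt x'" "idt x'" c r "b \<boxtimes> idt (Unit C)"] by simp
    finally show ?thesis using runit_arr_natural[of b x'] h by simp
  qed
  show ?thesis
  proof (rule cancel_epi)
    show "f \<bullet> runit_arr x = g \<bullet> runit_arr x" unfolding rec[OF f(1)] rec[OF f(2)] eq ..
    show "runit_arr x \<bullet> runit_inv x = idt x" using h by (simp add: coherence_cancel)
  qed (use h f in \<open>simp_all add: maps_def\<close>)
qed

text \<open>The mirror argument: here the evaluation, which ends at the simple unit, splits.\<close>

lemma faithful_left:
  assumes f: "maps f x x'" "maps g x x'" and eq: "idt y \<boxtimes> f = idt y \<boxtimes> g"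
    and y: "y \<in> Obj C" "\<not> is_direct_sum C y []"
  shows "f = g"
proof -
  obtain z where d: "is_left_dual C z y" using left_rigid[OF y(1)] by blast
  obtain ev c where o: "y \<in> Obj C" "z \<in> Obj C" and ev: "maps ev (z \<odot> y) (Unit C)" and c: "maps c (Unit C) (y \<odot> z)"
    and zz: "runit_arr y \<bullet> ((idt y \<boxtimes> ev) \<bullet> (assoc_arr y z y \<bullet> (c \<boxtimes> idt y))) = lunit_arr y"
    using d by (rule left_dualE)
  obtain r where r: "maps r (Unit C) (z \<odot> y)" "ev \<bullet> r = idt (Unit C)"
    using split_epi_to_simple[OF ev left_dual_nonzero(1)[OF o ev c zz y(2)] unit_simple] .
  have ox: "x \<in> Obj C" "x' \<in> Obj C" using mapsD[OF f(1)] by simp_all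
  note h = ox o unit_obj tenO_obj ev[unfolded maps_def] r(1)[unfolded maps_def]
  have rec: "b \<bullet> lunit_arr x = lunit_arr x' \<bullet> ((ev \<boxtimes> idt x') \<bullet> (assoc_inv z y x' \<bullet> ((idt z \<boxtimes> (idt y \<boxtimes> b)) \<bullet>
      (assoc_arr z y x \<bullet> (r \<boxtimes> idt x)))))" if b: "maps b x x'" for b
  proof -
    note h = h b[unfolded maps_def]
    have "assoc_inv z y x' \<bullet> ((idt z \<boxtimes> (idt y \<boxtimes> b)) \<bullet> (assoc_arr z y x \<bullet> (r \<boxtimes> idt x)))
      = ((idt z \<boxtimes> idt y) \<boxtimes> b) \<bullet> (assoc_inv z y x \<bullet> (assoc_arr z y x \<bullet> (r \<boxtimes> idt x)))"
      by (rule reassoc) (use h assoc_inv_natural[of "idt z" "idt y" b z y x'] in simp_all)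
    also have "assoc_inv z y x \<bullet> (assoc_arr z y x \<bullet> (r \<boxtimes> idt x)) = r \<boxtimes> idt x"
      using h cmp_assoc[of "r \<boxtimes> idt x" "assoc_arr z y x" "assoc_inv z y x"] by (simp add: coherence_cancel)
    also have "((idt z \<boxtimes> idt y) \<boxtimes> b) \<bullet> (r \<boxtimes> idt x) = (r \<boxtimes> idt x') \<bullet> (idt (Unit C) \<boxtimes> b)"
      using slide[OF r(1) b] h by simp
    also have "(ev \<boxtimes> idt x') \<bullet> ((r \<boxtimes> idt x') \<bullet> (idt (Unit C) \<boxtimes> b)) = idt (Unit C) \<boxtimes> b"
      using h r(2) interchange_assoc[of r ev "idt x'" "idt x'" "idt (Unit C) \<boxtimes> b"] by simp
    finally show ?thesis using lunit_arr_natural[of b x'] h by simp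
  qed
  show ?thesis
  proof (rule cancel_epi)
    show "f \<bullet> lunit_arr x = g \<bullet> lunit_arr x" unfolding rec[OF f(1)] rec[OF f(2)] eq ..
    show "lunit_arr x \<bullet> lunit_inv x = idt x" using h by (simp add: coherence_cancel)
  qed (use h f in \<open>simp_all add: maps_def\<close>)
qed

lemma linked_tensor_right:
  assumes "linked x x'" and y: "y \<in> Obj C" "\<not> is_direct_sum C y []"
  shows "linked (x \<odot> y) (x' \<odot> y)"
proof -
  obtain f where f: "maps f x x'" "mor f \<noteq> 0" using assms unfolding linked_def by blast
  have o: "x \<in> Obj C" "x' \<in> Obj C" using mapsD[OF f(1)] by simp_all
  note m = maps_tns[OF f(1) maps_idt[OF y(1)]]
  have "mor (f \<boxtimes> idt y) \<noteq> 0"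
    using faithful_right[OF f(1) maps_zer[OF o] _ y] zer_eqI[OF m] f(2) tns_zer(2)[OF maps_idt[OF y(1)] o]
    by force
  then show ?thesis by (rule linkedI[OF m])
qed

lemma linked_tensor_left:
  assumes "linked x x'" and y: "y \<in> Obj C" "\<not> is_direct_sum C y []"
  shows "linked (y \<odot> x) (y \<odot> x')"
proof -
  obtain f where f: "maps f x x'" "mor f \<noteq> 0" using assms unfolding linked_def by blast
  have o: "x \<in> Obj C" "x' \<in> Obj C" using mapsD[OF f(1)] by simp_all
  note m = maps_tns[OF maps_idt[OF y(1)] f(1)]
  have "mor (idt y \<boxtimes> f) \<noteq> 0"
    using faithful_left[OF f(1) maps_zer[OF o] _ y] zer_eqI[OF m] f(2) tns_zer(1)[OF maps_idt[OF y(1)] o]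
    by force
  then show ?thesis by (rule linkedI[OF m])
qed

lemma tensor_nonzero:
  assumes "x \<in> Obj C" "\<not> is_direct_sum C x []" "y \<in> Obj C" "\<not> is_direct_sum C y []"
  shows "\<not> is_direct_sum C (x \<odot> y) []"
  using linked_nonzero(1)[OF linked_tensor_right[OF nonzero_linked_self]] assms by blast

text \<open>Since \<open>b \<otimes> (a \<otimes> -)\<close> is naturally isomorphic to the identity, \<open>idt b \<boxtimes> h\<close> is the image of
  some \<open>k\<close> under this functor; faithfulness of \<open>b \<otimes> -\<close> then gives \<open>h = idt a \<boxtimes> k\<close>.\<close>

lemma tensor_full:
  assumes inv: "isomorphic C (b \<odot> a) (Unit C)" and ab: "a \<in> Obj C" "b \<in> Obj C"
    and AB: "A \<in> Obj C" "B \<in> Obj C" and hm: "maps h (a \<odot> A) (a \<odot> B)"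
  obtains k where "maps k A B" "h = idt a \<boxtimes> k"
proof -
  obtain u v where u: "maps u (b \<odot> a) (Unit C)" and v: "maps v (Unit C) (b \<odot> a)"
    and vu: "v \<bullet> u = idt (b \<odot> a)" and uv: "u \<bullet> v = idt (Unit C)"
    using inv by (rule isomorphicE)
  note h = ab AB unit_obj tenO_obj hm[unfolded maps_def] u[unfolded maps_def] v[unfolded maps_def]
  have "\<not> is_direct_sum C (b \<odot> a) []"
    using nonzero_linked_self[OF unit_obj] simple_nonzero[OF unit_simple]
      linked_iso[OF _ iso_sym[OF inv] iso_sym[OF inv]] linked_nonzero(1) by blast
  then have b: "\<not> is_direct_sum C b []" using tensor_nonzero_factors ab by blast
  \<comment> \<open>\<open>h\<close> tensored with \<open>b\<close>, and rebracketed so that it can be conjugated by the isomorphism of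
    \<open>b \<otimes> a\<close> with the unit.\<close>
  define w where "w = assoc_inv b a B \<bullet> ((idt b \<boxtimes> h) \<bullet> assoc_arr b a A)"
  have w: "maps w ((b \<odot> a) \<odot> A) ((b \<odot> a) \<odot> B)" using h by (simp add: w_def maps_def)
  define k where "k = lunit_arr B \<bullet> ((u \<boxtimes> idt B) \<bullet> (w \<bullet> ((v \<boxtimes> idt A) \<bullet> lunit_inv A)))"
  have k: "maps k A B" using h w by (simp add: k_def maps_def)
  note h = h w[unfolded maps_def] k[unfolded maps_def]
  have "k \<bullet> lunit_arr A = lunit_arr B \<bullet> ((u \<boxtimes> idt B) \<bullet> (w \<bullet> (v \<boxtimes> idt A)))"
    using h by (simp add: k_def coherence_cancel)
  then have "lunit_inv B \<bullet> (lunit_arr B \<bullet> (idt (Unit C) \<boxtimes> k)) = lunit_inv B \<bullet> (lunit_arr B \<bullet> ((u \<boxtimes> idt B) \<bullet> (w \<bullet> (v \<boxtimes> idt A))))"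
    using lunit_arr_natural[of k B] h by simp
  then have 1: "idt (Unit C) \<boxtimes> k = (u \<boxtimes> idt B) \<bullet> (w \<bullet> (v \<boxtimes> idt A))"
    using h cmp_assoc[of "idt (Unit C) \<boxtimes> k" "lunit_arr B" "lunit_inv B"]
      cmp_assoc[of "(u \<boxtimes> idt B) \<bullet> (w \<bullet> (v \<boxtimes> idt A))" "lunit_arr B" "lunit_inv B"] by (simp add: coherence_cancel)
  have "idt (b \<odot> a) \<boxtimes> k = (v \<boxtimes> idt B) \<bullet> ((idt (Unit C) \<boxtimes> k) \<bullet> (u \<boxtimes> idt A))"
    using h vu by (simp add: interchange)
  also have "\<dots> = (v \<boxtimes> idt B) \<bullet> ((u \<boxtimes> idt B) \<bullet> (w \<bullet> ((v \<boxtimes> idt A) \<bullet> (u \<boxtimes> idt A))))"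
    unfolding 1 using h by simp
  also have "(v \<boxtimes> idt A) \<bullet> (u \<boxtimes> idt A) = idt ((b \<odot> a) \<odot> A)" using h vu by (simp add: interchange)
  also have "(v \<boxtimes> idt B) \<bullet> ((u \<boxtimes> idt B) \<bullet> (w \<bullet> idt ((b \<odot> a) \<odot> A))) = w"
    using h vu interchange_assoc[of u v "idt B" "idt B" w] by simp
  finally have 2: "idt (b \<odot> a) \<boxtimes> k = w" .
  have "assoc_inv b a B \<bullet> (idt b \<boxtimes> (idt a \<boxtimes> k)) = idt (b \<odot> a) \<boxtimes> k \<bullet> assoc_inv b a A"
    using h assoc_inv_natural[of "idt b" "idt a" k b a B] by simp
  also have "\<dots> = assoc_inv b a B \<bullet> (idt b \<boxtimes> h)"
    unfolding 2 using h by (simp add: w_def coherence_cancel)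
  finally have "assoc_arr b a B \<bullet> (assoc_inv b a B \<bullet> (idt b \<boxtimes> (idt a \<boxtimes> k))) = assoc_arr b a B \<bullet> (assoc_inv b a B \<bullet> (idt b \<boxtimes> h))"
    by simp
  then have "idt b \<boxtimes> (idt a \<boxtimes> k) = idt b \<boxtimes> h"
    using h cmp_assoc[of "idt b \<boxtimes> (idt a \<boxtimes> k)" "assoc_inv b a B" "assoc_arr b a B"]
      cmp_assoc[of "idt b \<boxtimes> h" "assoc_inv b a B" "assoc_arr b a B"] by (simp add: coherence_cancel)
  then have "idt a \<boxtimes> k = h"
    by (rule faithful_left[OF maps_tns[OF maps_idt[OF ab(1)] k] hm _ ab(2) b])
  then show ?thesis using that k by blast
qed

text \<open>The inclusion of the summand stays a nonzero inclusion after tensoring with \<open>X\<close>, where it is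
  an isomorphism by simplicity, and faithfulness brings this back.\<close>

lemma summand_cancel:
  assumes "is_summand C V W" "\<not> is_direct_sum C V []" and X: "X \<in> Obj C" and S: "simple C (X \<odot> W)"
  shows "isomorphic C V W"
proof -
  obtain i p where ip: "maps i V W" "maps p W V" "p \<bullet> i = idt V" using assms(1) by (rule summandE)
  have o: "V \<in> Obj C" "W \<in> Obj C" using mapsD[OF ip(1)] by simp_all
  have X0: "\<not> is_direct_sum C X []" using tensor_nonzero_factors(1)[OF simple_nonzero[OF S] X o(2)] .
  note mi = maps_tns[OF maps_idt[OF X] ip(1)] and mp = maps_tns[OF maps_idt[OF X] ip(2)]
  have pi: "(idt X \<boxtimes> p) \<bullet> (idt X \<boxtimes> i) = idt (X \<odot> V)"
    using ip o X by (simp add: maps_def interchange)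
  have nz: "\<not> is_direct_sum C (X \<odot> V) []" using tensor_nonzero X X0 o(1) assms(2) by blast
  have "isomorphic C (X \<odot> V) (X \<odot> W)"
    by (rule nonzero_summand_of_simple[OF S summandI[OF mi mp pi] nz])
  then have sV: "simple C (X \<odot> V)" using simple_iso[OF S] iso_sym by blast
  have "mor (idt X \<boxtimes> i) \<noteq> 0"
    using cmp_nonzero(1)[OF mi mp] nz tenO_obj[OF X o(1)] unfolding pi by (simp add: zero_iff)
  then obtain g where g: "maps g (X \<odot> W) (X \<odot> V)" "g \<bullet> (idt X \<boxtimes> i) = idt (X \<odot> V)" "(idt X \<boxtimes> i) \<bullet> g = idt (X \<odot> W)"
    using schur[OF mi _ sV S] by metis
  have "idt X \<boxtimes> (i \<bullet> p) = ((idt X \<boxtimes> i) \<bullet> (idt X \<boxtimes> p)) \<bullet> ((idt X \<boxtimes> i) \<bullet> g)"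
    unfolding g(3) using ip(1,2) o X by (simp add: maps_def interchange)
  also have "\<dots> = (idt X \<boxtimes> i) \<bullet> (((idt X \<boxtimes> p) \<bullet> (idt X \<boxtimes> i)) \<bullet> g)"
    using ip(1,2) g(1) o X by (simp add: maps_def)
  also have "\<dots> = idt X \<boxtimes> idt W" unfolding pi using g o X by (simp add: maps_def)
  finally have "i \<bullet> p = idt W"
    using faithful_left[OF maps_cmp[OF ip(2,1)] maps_idt[OF o(2)] _ X X0] by blast
  then show ?thesis using isomorphicI[OF ip(1,2,3)] by blast
qed

section \<open>Invertible objects\<close>

text \<open>Take a simple summand \<open>T\<close> of \<open>a \<otimes> S\<close>. Tensoring with the inverse \<open>b\<close> shows that \<open>S\<close> is a
  summand of \<open>b \<otimes> T\<close>, and tensoring back with \<open>a\<close> that \<open>a \<otimes> S\<close> is a summand of \<open>T\<close>. Being nonzero,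
  it is all of \<open>T\<close>.\<close>

lemma simple_tensor_inverse:
  assumes S: "simple C S" and o: "a \<in> Obj C" "b \<in> Obj C"
    and ab: "isomorphic C (a \<odot> b) (Unit C)" and ba: "isomorphic C (b \<odot> a) (Unit C)"
  shows "simple C (a \<odot> S)"
proof -
  note oS = simple_obj[OF S]
  have u: "linked (Unit C) (Unit C)"
    using nonzero_linked_self[OF unit_obj] simple_nonzero[OF unit_simple] by blast
  have "linked (a \<odot> b) (a \<odot> b)" using linked_iso[OF u iso_sym[OF ab] iso_sym[OF ab]] .
  then have nz: "\<not> is_direct_sum C a []" "\<not> is_direct_sum C b []"
    using tensor_nonzero_factors linked_nonzero(1) o by blast+
  obtain T where T: "simple C T" "is_summand C T (a \<odot> S)"
    using nonzero_simple_summand[OF tenO_obj[OF o(1) oS] tensor_nonzero[OF o(1) nz(1) oS simple_nonzero[OF S]]] .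
  note oT = simple_obj[OF T(1)]
  have cancel: "isomorphic C (x \<odot> (y \<odot> z)) z"
    if "isomorphic C (x \<odot> y) (Unit C)" "x \<in> Obj C" "y \<in> Obj C" "z \<in> Obj C" for x y z
    using iso_trans[OF iso_sym[OF iso_assoc[OF that(2-4)]]
        iso_trans[OF iso_tensor[OF that(1) iso_refl[OF that(4)]] iso_lunit[OF that(4)]]] .
  have "linked (b \<odot> T) (b \<odot> (a \<odot> S))"
    using linked_tensor_left[OF summand_linked(1)[OF T(2) simple_nonzero[OF T(1)]] o(2) nz(2)] .
  then have "linked (b \<odot> T) S"
    using linked_iso[OF _ iso_refl cancel[OF ba o(2,1) oS]] tenO_obj[OF o(2) oT] by blast
  then have "is_summand C S (b \<odot> T)" by (rule linked_to_simple_summand[OF _ S])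
  then have "is_summand C (a \<odot> S) (a \<odot> (b \<odot> T))"
    using summand_tensor[OF iso_summand[OF iso_refl[OF o(1)]]] by blast
  then have "is_summand C (a \<odot> S) T"
    using summand_trans iso_summand[OF cancel[OF ab o oT]] by blast
  then have "isomorphic C (a \<odot> S) T"
    using nonzero_summand_of_simple[OF T(1)] tensor_nonzero[OF o(1) nz(1) oS simple_nonzero[OF S]] by blast
  then show ?thesis using simple_iso[OF T(1)] iso_sym by blast
qed

text \<open>By fullness of \<open>X \<otimes> -\<close> the coevaluation, read as a morphism from \<open>X \<otimes> Z\<close> to \<open>X \<otimes> Y\<close>,
  comes from some \<open>k\<close> from \<open>Z\<close> to \<open>Y\<close>, which is split because \<open>Z\<close> is simple. With a retraction \<open>r\<close>,
  the morphisms \<open>k \<bullet> r\<close> and the identity of \<open>Y\<close> have the same transpose, so they agree.\<close>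

lemma left_dual_unique_of_inverse:
  assumes d: "is_left_dual C Y X" and Z: "Z \<in> Obj C"
    and XZ: "isomorphic C (X \<odot> Z) (Unit C)" and ZX: "isomorphic C (Z \<odot> X) (Unit C)"
  shows "isomorphic C Z Y"
proof -
  obtain ev co where o: "X \<in> Obj C" "Y \<in> Obj C" and ev: "maps ev (Y \<odot> X) (Unit C)" and co: "maps co (Unit C) (X \<odot> Y)"
    and z: "runit_arr X \<bullet> ((idt X \<boxtimes> ev) \<bullet> (assoc_arr X Y X \<bullet> (co \<boxtimes> idt X))) = lunit_arr X"
      "lunit_arr Y \<bullet> ((ev \<boxtimes> idt Y) \<bullet> (assoc_inv Y X Y \<bullet> (idt Y \<boxtimes> co))) = runit_arr Y"
    using d by (rule left_dualE)
  have sZ: "simple C Z"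
    using simple_iso[OF simple_tensor_inverse[OF unit_simple Z o(1) ZX XZ] iso_runit[OF Z]] .
  have "\<not> is_direct_sum C (X \<odot> Z) []"
    using nonzero_linked_self[OF unit_obj simple_nonzero[OF unit_simple]]
      linked_iso[OF _ iso_sym[OF XZ] iso_sym[OF XZ]] linked_nonzero(1) by blast
  then have X0: "\<not> is_direct_sum C X []" using tensor_nonzero_factors(1) o(1) Z by blast
  obtain c' c where c: "maps c' (X \<odot> Z) (Unit C)" "maps c (Unit C) (X \<odot> Z)" "c \<bullet> c' = idt (X \<odot> Z)"
      "c' \<bullet> c = idt (Unit C)"
    using XZ by (rule isomorphicE)
  obtain k where k: "maps k Z Y" "co \<bullet> c' = idt X \<boxtimes> k"
    using tensor_full[OF ZX o(1) Z Z o(2) maps_cmp[OF c(1) co]] .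
  note h = o Z unit_obj tenO_obj c(1,2)[unfolded maps_def] co[unfolded maps_def] k(1)[unfolded maps_def]
  have cok: "co = (idt X \<boxtimes> k) \<bullet> c" unfolding k(2)[symmetric] using h c by simp
  have "mor co \<noteq> 0" using left_dual_nonzero(2)[OF o ev co z(1) X0] .
  then have "mor (idt X \<boxtimes> k) \<noteq> 0"
    unfolding cok by (rule cmp_nonzero(2)[OF c(2) maps_tns[OF maps_idt[OF o(1)] k(1)]])
  then have "mor k \<noteq> 0" using tns_zero[of "idt X" k] h by auto
  then obtain r where r: "maps r Y Z" "r \<bullet> k = idt Z" using split_mono_from_simple[OF k(1) _ sZ] by metis
  note h = h r(1)[unfolded maps_def]
  have "(idt X \<boxtimes> (k \<bullet> r)) \<bullet> co = (idt X \<boxtimes> (k \<bullet> r \<bullet> k)) \<bullet> c"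
    unfolding cok using h interchange_assoc[of "idt X" "idt X" k "k \<bullet> r" c] by simp
  also have "\<dots> = (idt X \<boxtimes> idt Y) \<bullet> co" unfolding r(2) using h cok by simp
  finally have "k \<bullet> r = idt Y"
    by (rule left_dual_faithful_right[OF o ev co z(2) maps_cmp[OF r(1) k(1)] maps_idt[OF o(2)]])
  then show ?thesis using isomorphicI[OF k(1) r(1) r(2)] by blast
qed

lemma dual_is_left_dual: "X \<in> Obj C \<Longrightarrow> is_left_dual C (dual C X) X"
  unfolding dual_def using someI_ex[OF left_rigid] .

lemma left_dual_obj: "is_left_dual C Y X \<Longrightarrow> X \<in> Obj C \<and> Y \<in> Obj C"
  by (simp add: is_left_dual_def)

lemma left_dual_linked:
  assumes "is_left_dual C Y X" "\<not> is_direct_sum C X []"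
  shows "linked (Y \<odot> X) (Unit C)" "linked (Unit C) (X \<odot> Y)"
proof -
  obtain ev co where o: "X \<in> Obj C" "Y \<in> Obj C" and ev: "maps ev (Y \<odot> X) (Unit C)" and co: "maps co (Unit C) (X \<odot> Y)"
    and z: "runit_arr X \<bullet> ((idt X \<boxtimes> ev) \<bullet> (assoc_arr X Y X \<bullet> (co \<boxtimes> idt X))) = lunit_arr X"
    using assms(1) by (rule left_dualE)
  note n = left_dual_nonzero[OF o ev co z assms(2)]
  show "linked (Y \<odot> X) (Unit C)" using linkedI[OF ev n(1)] .
  show "linked (Unit C) (X \<odot> Y)" using linkedI[OF co n(2)] .
qed

text \<open>Invertibility without reference to a chosen dual: unlike the condition on \<open>dual C X\<close>, this
  one is evidently symmetric and invariant under isomorphism.\<close>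

definition inverse_pair :: "'a \<Rightarrow> 'a \<Rightarrow> bool" where
  "inverse_pair X Z \<longleftrightarrow> X \<in> Obj C \<and> Z \<in> Obj C \<and>
     isomorphic C (X \<odot> Z) (Unit C) \<and> isomorphic C (Z \<odot> X) (Unit C)"

lemma inverse_pair_sym: "inverse_pair X Z \<Longrightarrow> inverse_pair Z X"
  by (simp add: inverse_pair_def)

text \<open>From \<open>X \<otimes> (Y \<otimes> X) \<cong> (X \<otimes> Y) \<otimes> X \<cong> X\<close> this object is simple, while the evaluation splits the
  unit off \<open>Y \<otimes> X\<close>; cancelling \<open>X\<close> shows that nothing else is left in \<open>Y \<otimes> X\<close>.\<close>

lemma inverse_pair_left_dual:
  assumes X: "simple C X" and d: "is_left_dual C Y X" and XY: "isomorphic C (X \<odot> Y) (Unit C)"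
  shows "inverse_pair X Y"
proof -
  have o: "X \<in> Obj C" "Y \<in> Obj C" using left_dual_obj[OF d] by simp_all
  have "isomorphic C (X \<odot> (Y \<odot> X)) X"
    using iso_trans[OF iso_sym[OF iso_assoc[OF o(1,2,1)]]
        iso_trans[OF iso_tensor[OF XY iso_refl[OF o(1)]] iso_lunit[OF o(1)]]] .
  then have "simple C (X \<odot> (Y \<odot> X))" using simple_iso[OF X] iso_sym by blast
  moreover have "is_summand C (Unit C) (Y \<odot> X)"
    using linked_to_simple_summand[OF left_dual_linked(1)[OF d simple_nonzero[OF X]] unit_simple] .
  ultimately have "isomorphic C (Unit C) (Y \<odot> X)"
    using summand_cancel[OF _ simple_nonzero[OF unit_simple] o(1)] by blast
  then show ?thesis using o XY iso_sym unfolding inverse_pair_def by blast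
qed

lemma inverse_pair_tensor_simple:
  "\<lbrakk>inverse_pair a b; simple C S\<rbrakk> \<Longrightarrow> simple C (a \<odot> S)"
  unfolding inverse_pair_def by (intro simple_tensor_inverse[of S a b]) auto

lemma inverse_pair_simple:
  assumes "inverse_pair a b"
  shows "simple C a"
  using simple_iso[OF inverse_pair_tensor_simple[OF assms unit_simple] iso_runit] assms
  unfolding inverse_pair_def by blast

lemma inverse_pair_cancel:
  assumes "inverse_pair a b" "x \<in> Obj C"
  shows "isomorphic C (a \<odot> (b \<odot> x)) x"
  using iso_trans[OF iso_sym[OF iso_assoc[of a b x]]
      iso_trans[OF iso_tensor[of "a \<odot> b" "Unit C", OF _ iso_refl[of x]] iso_lunit[of x]]] assms
  unfolding inverse_pair_def by blast

text \<open>Any left dual may stand in for the chosen one. This is needed because a fusion subcategory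
  makes its own choice of duals.\<close>

lemma invertible_left_dual_iff:
  assumes "simple C X" "is_left_dual C Y X"
  shows "invertible C X \<longleftrightarrow> isomorphic C (X \<odot> Y) (Unit C)"
proof -
  have *: "isomorphic C (X \<odot> Y') (Unit C)"
    if "isomorphic C (X \<odot> Y) (Unit C)" "is_left_dual C Y X" "is_left_dual C Y' X" for Y Y'
  proof -
    have p: "inverse_pair X Y" using inverse_pair_left_dual[OF assms(1) that(2,1)] .
    then have "isomorphic C Y Y'"
      using left_dual_unique_of_inverse[OF that(3)] unfolding inverse_pair_def by blast
    then show ?thesis
      using iso_trans[OF iso_tensor[OF iso_refl[OF simple_obj[OF assms(1)]] iso_sym] that(1)] by blast
  qed
  show ?thesis
    using *[OF _ assms(2) dual_is_left_dual] *[OF _ dual_is_left_dual assms(2)] assms(1) simple_obj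
    unfolding invertible_def by blast
qed

lemma invertible_iff: "invertible C X \<longleftrightarrow> (\<exists>Z. inverse_pair X Z)"
proof
  assume "invertible C X"
  then show "\<exists>Z. inverse_pair X Z"
    using inverse_pair_left_dual[OF _ dual_is_left_dual] simple_obj unfolding invertible_def by blast
next
  assume "\<exists>Z. inverse_pair X Z"
  then obtain Z where p: "inverse_pair X Z" by blast
  then have o: "X \<in> Obj C" "Z \<in> Obj C" and i: "isomorphic C (X \<odot> Z) (Unit C)" "isomorphic C (Z \<odot> X) (Unit C)"
    unfolding inverse_pair_def by simp_all
  have "isomorphic C Z (dual C X)" using left_dual_unique_of_inverse[OF dual_is_left_dual[OF o(1)] o(2) i] .
  then have "isomorphic C (X \<odot> dual C X) (Unit C)"
    using iso_trans[OF iso_tensor[OF iso_refl[OF o(1)] iso_sym] i(1)] by blast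
  then show "invertible C X" using inverse_pair_simple[OF p] unfolding invertible_def by blast
qed

lemma invertible_simple: "invertible C X \<Longrightarrow> simple C X"
  by (simp add: invertible_def)

lemma inverse_pair_iso:
  assumes "inverse_pair X Z" "isomorphic C X X'"
  shows "inverse_pair X' Z"
proof -
  have o: "X \<in> Obj C" "Z \<in> Obj C" "X' \<in> Obj C"
    and i: "isomorphic C (X \<odot> Z) (Unit C)" "isomorphic C (Z \<odot> X) (Unit C)"
    using assms iso_obj unfolding inverse_pair_def by blast+
  show ?thesis
    using o iso_trans[OF iso_tensor[OF iso_sym[OF assms(2)] iso_refl[OF o(2)]] i(1)]
      iso_trans[OF iso_tensor[OF iso_refl[OF o(2)] iso_sym[OF assms(2)]] i(2)]
    unfolding inverse_pair_def by blast
qed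

lemma invertible_iso: "\<lbrakk>invertible C X; isomorphic C X X'\<rbrakk> \<Longrightarrow> invertible C X'"
  unfolding invertible_iff using inverse_pair_iso by blast

section \<open>Fusion subcategories\<close>

lemma additive_subD:
  assumes "additive_sub C D"
  shows "X \<in> D \<Longrightarrow> X \<in> Obj C" "\<lbrakk>X \<in> D; is_summand C Y X\<rbrakk> \<Longrightarrow> Y \<in> D"
    "\<lbrakk>set Xs \<subseteq> D; is_direct_sum C X Xs\<rbrakk> \<Longrightarrow> X \<in> D"
  using assms unfolding additive_sub_def by blast+

lemma additive_sub_iso: "\<lbrakk>additive_sub C D; X \<in> D; isomorphic C X Y\<rbrakk> \<Longrightarrow> Y \<in> D"
  using additive_subD(2) iso_summand iso_sym by blast

lemma full_sub_simps [simp]: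
  "Obj (full_sub C D) = D" "Hom (full_sub C D) = Hom C" "Comp (full_sub C D) = Comp C"
  "Ide (full_sub C D) = Ide C" "TenO (full_sub C D) = TenO C" "TenM (full_sub C D) = TenM C"
  "Unit (full_sub C D) = Unit C" "Assoc (full_sub C D) = Assoc C" "LUnit (full_sub C D) = LUnit C"
  "RUnit (full_sub C D) = RUnit C"
  by (simp_all add: full_sub_def)

lemma iso_arrow_full_sub [simp]: "iso_arrow (full_sub C D) x y f = iso_arrow C x y f"
  by (simp add: iso_arrow_def inverse_arrows_def)

lemma isomorphic_full_sub:
  assumes "D \<subseteq> Obj C"
  shows "isomorphic (full_sub C D) x y \<longleftrightarrow> x \<in> D \<and> y \<in> D \<and> isomorphic C x y"
  using assms by (auto simp: isomorphic_def)

lemma iso_class_full_sub: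
  assumes D: "additive_sub C D"
  shows "x \<in> D \<Longrightarrow> iso_class (full_sub C D) x = iso_class C x"
    "x \<notin> D \<Longrightarrow> iso_class (full_sub C D) x = {}"
  using additive_sub_iso[OF D] additive_subD(1)[OF D] isomorphic_full_sub[of D]
  unfolding iso_class_def by blast+

lemma zero_full_sub:
  assumes "D \<subseteq> Obj C" "x \<in> D"
  shows "is_direct_sum (full_sub C D) x [] \<longleftrightarrow> is_direct_sum C x []"
  using assms by (auto simp: is_direct_sum_def)

text \<open>A monomorphism of the subcategory is only tested against objects of \<open>D\<close>. That suffices:
  into a simple object it is either zero, and then its source is zero, or split, and then it is
  invertible. In the other direction, a simple summand in \<open>C\<close> of a simple object of \<open>D\<close> again lies in
  \<open>D\<close>, so its inclusion is an isomorphism.\<close>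

lemma simple_full_sub:
  assumes D: "additive_sub C D"
  shows "simple (full_sub C D) X \<longleftrightarrow> X \<in> D \<and> simple C X"
proof
  have DO: "D \<subseteq> Obj C" using additive_subD(1)[OF D] by blast
  assume X: "X \<in> D \<and> simple C X"
  show "simple (full_sub C D) X"
    unfolding simple_def full_sub_simps
  proof (intro conjI ballI allI impI)
    show "X \<in> D" "\<not> is_direct_sum (full_sub C D) X []"
      using X simple_nonzero zero_full_sub[OF DO] by simp_all
    fix Y m assume Y: "Y \<in> D" and m: "mono_arrow (full_sub C D) Y X m"
    have o: "Y \<in> Obj C" "X \<in> Obj C" using X Y DO by auto
    have mm: "maps (Arrow Y m X) Y X" using m o unfolding mono_arrow_def by simp
    have inj: "f = g" if "f \<in> Hom C Y Y" "g \<in> Hom C Y Y" "m \<cdot> f = m \<cdot> g" for f g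
      using m Y that unfolding mono_arrow_def by simp
    show "is_direct_sum (full_sub C D) Y [] \<or> iso_arrow (full_sub C D) Y X m"
    proof (cases "m = 0")
      case True
      then have "m \<cdot> Ide C Y = m \<cdot> 0" using o ide_hom[OF o(1)] by (simp add: comp_zero_left[OF o(1,1,2)])
      then have "Ide C Y = 0" using inj ide_hom[OF o(1)] o by simp
      then show ?thesis using o Y by (simp add: zero_full_sub[OF DO] zero_iff)
    next
      case False
      obtain s where s: "maps s X Y" "Arrow Y m X \<bullet> s = idt X"
        using split_epi_to_simple[OF mm _ conjunct2[OF X]] False by auto
      have "Arrow Y m X \<bullet> (s \<bullet> Arrow Y m X) = (Arrow Y m X \<bullet> s) \<bullet> Arrow Y m X"
        using s(1) mm by (simp add: maps_def)
      also have "\<dots> = Arrow Y m X" unfolding s(2) using mm by (simp add: maps_def)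
      finally have "m \<cdot> mor (s \<bullet> Arrow Y m X) = m \<cdot> Ide C Y"
        using mm comp_ide_right[of Y X m] by (simp add: cmp_def)
      then have "mor (s \<bullet> Arrow Y m X) = Ide C Y"
        using inj mapsD[OF maps_cmp[OF mm s(1)]] ide_hom[OF o(1)] by blast
      then have "s \<bullet> Arrow Y m X = idt Y" using s(1) by (simp add: cmp_def idt_def maps_def)
      then show ?thesis using iso_arrowI[OF mm s(1) _ s(2)] by simp
    qed
  qed
next
  have DO: "D \<subseteq> Obj C" using additive_subD(1)[OF D] by blast
  assume X: "simple (full_sub C D) X"
  then have XD: "X \<in> D" and X0: "\<not> is_direct_sum C X []"
    using zero_full_sub[OF DO] unfolding simple_def by auto
  have XO: "X \<in> Obj C" using XD DO by blast
  obtain S where S: "simple C S" "is_summand C S X" using nonzero_simple_summand[OF XO X0] .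
  have SD: "S \<in> D" using additive_subD(2)[OF D XD S(2)] .
  obtain i p where ip: "maps i S X" "maps p X S" "p \<bullet> i = idt S" using S(2) by (rule summandE)
  have "mono_arrow (full_sub C D) S X (mor i)"
    using split_mono_arrow[OF ip] DO unfolding mono_arrow_def by auto
  then have "iso_arrow C S X (mor i)"
    using X SD simple_nonzero[OF S(1)] zero_full_sub[OF DO SD] unfolding simple_def by auto
  then have "isomorphic C S X" using simple_obj[OF S(1)] XO unfolding isomorphic_def by blast
  then show "X \<in> D \<and> simple C X" using simple_iso[OF S(1)] XD by blast
qed

lemma fusion_subcategoryD:
  assumes "fusion_subcategory C D"
  shows "additive_sub C D" "Unit C \<in> D" "\<lbrakk>X \<in> D; Y \<in> D\<rbrakk> \<Longrightarrow> X \<odot> Y \<in> D"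
    "\<lbrakk>X \<in> D; is_left_dual C Y X\<rbrakk> \<Longrightarrow> Y \<in> D" "\<lbrakk>X \<in> D; is_left_dual C X Y\<rbrakk> \<Longrightarrow> Y \<in> D"
  using assms unfolding fusion_subcategory_def by blast+

lemma invertible_full_sub:
  assumes D: "fusion_subcategory C D"
  shows "invertible (full_sub C D) X \<longleftrightarrow> X \<in> D \<and> invertible C X"
proof (cases "X \<in> D \<and> simple C X")
  case False
  then show ?thesis
    using simple_full_sub[OF fusion_subcategoryD(1)[OF D]] unfolding invertible_def by blast
next
  case True
  note A = fusion_subcategoryD(1)[OF D]
  have DO: "D \<subseteq> Obj C" using additive_subD(1)[OF A] by blast
  have ld: "is_left_dual (full_sub C D) Y X \<longleftrightarrow> Y \<in> D \<and> is_left_dual C Y X" for Y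
    using True DO unfolding is_left_dual_def by (auto simp: inv_arrow_def inverse_arrows_def)
  have "is_left_dual (full_sub C D) (dual (full_sub C D) X) X"
    unfolding dual_def
    by (rule someI_ex) (use ld left_rigid[OF simple_obj] fusion_subcategoryD(4)[OF D] True in blast)
  then have d: "dual (full_sub C D) X \<in> D" "is_left_dual C (dual (full_sub C D) X) X" unfolding ld by simp_all
  show ?thesis
    using invertible_left_dual_iff[OF conjunct2[OF True] d(2)] True fusion_subcategoryD(2,3)[OF D] d(1)
    unfolding invertible_def[of "full_sub C D"] simple_full_sub[OF A] full_sub_simps isomorphic_full_sub[OF DO]
    by blast
qed

lemma pointed_full_sub:
  assumes "fusion_subcategory C D"
  shows "pointed (full_sub C D) \<longleftrightarrow> (\<forall>X\<in>D. simple C X \<longrightarrow> invertible C X)"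
  unfolding pointed_def simple_full_sub[OF fusion_subcategoryD(1)[OF assms]] invertible_full_sub[OF assms]
  by blast

lemma fusion_subcategory_Obj: "fusion_subcategory C (Obj C)"
  unfolding fusion_subcategory_def additive_sub_def
  using unit_obj tenO_obj left_dual_obj summand_obj by (auto simp: is_direct_sum_def)

lemma fusion_subcategory_generated:
  assumes "S \<subseteq> Obj C"
  shows "fusion_subcategory C (generated_sub C S)"
proof -
  have 1: "fusion_subcategory C (\<Inter>F)" if F: "F \<noteq> {}" "\<And>D. D \<in> F \<Longrightarrow> fusion_subcategory C D" for F
    unfolding fusion_subcategory_def additive_sub_def
  proof (intro conjI allI ballI impI)
    show "\<Inter>F \<subseteq> Obj C" using F additive_subD(1)[OF fusion_subcategoryD(1)] by blast
    show "X \<in> \<Inter>F" if "set Xs \<subseteq> \<Inter>F \<and> is_direct_sum C X Xs" for X Xs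
      using that additive_subD(3)[OF fusion_subcategoryD(1)[OF F(2)]] by blast
    show "Y \<in> \<Inter>F" if "X \<in> \<Inter>F" "is_summand C Y X" for X Y
      using that additive_subD(2)[OF fusion_subcategoryD(1)[OF F(2)]] by blast
    show "Unit C \<in> \<Inter>F" using fusion_subcategoryD(2)[OF F(2)] by blast
    show "X \<odot> Y \<in> \<Inter>F" if "X \<in> \<Inter>F" "Y \<in> \<Inter>F" for X Y
      using that fusion_subcategoryD(3)[OF F(2)] by blast
    show "Y \<in> \<Inter>F" if "X \<in> \<Inter>F" "is_left_dual C Y X \<or> is_left_dual C X Y" for X Y
      using that fusion_subcategoryD(4,5)[OF F(2)] by blast
  qed
  show ?thesis
    unfolding generated_sub_def by (rule 1) (use fusion_subcategory_Obj assms in blast)+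
qed

lemma generated_sub_contains: "S \<subseteq> generated_sub C S"
  unfolding generated_sub_def by blast

lemma generated_sub_least: "\<lbrakk>fusion_subcategory C D; S \<subseteq> D\<rbrakk> \<Longrightarrow> generated_sub C S \<subseteq> D"
  unfolding generated_sub_def by blast

lemma fusion_subcategory_adjoint: "fusion_subcategory C (adjoint_sub C)"
  unfolding adjoint_sub_def by (rule fusion_subcategory_generated) (use simple_obj in blast)

lemma adjoint_sub_contains:
  assumes "simple C Y" "simple C X" "is_summand C Y (X \<odot> dual C X)"
  shows "Y \<in> adjoint_sub C"
  unfolding adjoint_sub_def by (rule subsetD[OF generated_sub_contains]) (use assms in auto)

lemma irr_full_sub:
  assumes D: "additive_sub C D"
  shows "Irr (full_sub C D) = iso_class C ` {X \<in> D. simple C X}"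
  unfolding Irr_def using simple_full_sub[OF D] iso_class_full_sub(1)[OF D] by (auto simp: image_iff)

text \<open>Representatives expressed by isomorphisms in \<open>C\<close> alone. An object outside \<open>D\<close> has an empty
  isomorphism class in the full subcategory, which is how a list of representatives is forced to
  lie in \<open>D\<close>.\<close>

lemma represents_full_sub_iff:
  assumes D: "additive_sub C D"
  shows "represents (full_sub C D) Xs (Irr (full_sub C D)) \<longleftrightarrow>
    (\<forall>X\<in>set Xs. X \<in> D \<and> simple C X) \<and>
    (\<forall>i<length Xs. \<forall>j<length Xs. isomorphic C (Xs ! i) (Xs ! j) \<longrightarrow> i = j) \<and>
    (\<forall>S\<in>D. simple C S \<longrightarrow> (\<exists>X\<in>set Xs. isomorphic C X S))" (is "?L \<longleftrightarrow> ?R")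
proof
  assume L: ?L
  have S: "X \<in> D \<and> simple C X" if "X \<in> set Xs" for X
  proof -
    have "iso_class (full_sub C D) X \<in> iso_class C ` {X \<in> D. simple C X}"
      using L that unfolding represents_def irr_full_sub[OF D] by blast
    then obtain Y where Y: "Y \<in> D" "simple C Y" "iso_class (full_sub C D) X = iso_class C Y" by blast
    have "iso_class C Y \<noteq> {}" using iso_refl[OF simple_obj[OF Y(2)]] unfolding iso_class_def by blast
    then have XD: "X \<in> D" using Y(3) iso_class_full_sub(2)[OF D] by metis
    then have "isomorphic C X Y"
      using Y(3) iso_class_full_sub(1)[OF D] iso_class_eq additive_subD(1)[OF D] by metis
    then show ?thesis using XD simple_iso[OF Y(2)] iso_sym by blast
  qed
  have cl: "iso_class (full_sub C D) X = iso_class C X" if "X \<in> set Xs" for X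
    using S[OF that] iso_class_full_sub(1)[OF D] by blast
  have "i = j" if "i < length Xs" "j < length Xs" "isomorphic C (Xs ! i) (Xs ! j)" for i j
  proof -
    have "iso_class C (Xs ! i) = iso_class C (Xs ! j)" using that(3) iso_class_eq iso_obj by blast
    then have "map (iso_class (full_sub C D)) Xs ! i = map (iso_class (full_sub C D)) Xs ! j"
      using that cl by simp
    then show ?thesis
      using L that nth_eq_iff_index_eq[of "map (iso_class (full_sub C D)) Xs" i j]
      unfolding represents_def by simp
  qed
  moreover have "\<exists>X\<in>set Xs. isomorphic C X T" if "T \<in> D" "simple C T" for T
  proof -
    have "iso_class C T \<in> iso_class (full_sub C D) ` set Xs"
      using L that unfolding represents_def irr_full_sub[OF D] by blast
    then obtain X where "X \<in> set Xs" "iso_class C X = iso_class C T" using cl by force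
    then show ?thesis using iso_class_eq S simple_obj by blast
  qed
  ultimately show ?R using S by blast
next
  assume R: ?R
  then have cl: "iso_class (full_sub C D) X = iso_class C X" if "X \<in> set Xs" for X
    using that iso_class_full_sub(1)[OF D] by blast
  have o: "X \<in> Obj C" if "X \<in> set Xs" for X using R that simple_obj by blast
  have "distinct (map (iso_class (full_sub C D)) Xs)"
    unfolding distinct_conv_nth
  proof (intro allI impI)
    fix i j assume ij: "i < length (map (iso_class (full_sub C D)) Xs)"
      "j < length (map (iso_class (full_sub C D)) Xs)" "i \<noteq> j"
    then have "\<not> isomorphic C (Xs ! i) (Xs ! j)" using R unfolding length_map by blast
    then have "iso_class C (Xs ! i) \<noteq> iso_class C (Xs ! j)" using iso_class_eq[OF o] ij by simp
    then show "map (iso_class (full_sub C D)) Xs ! i \<noteq> map (iso_class (full_sub C D)) Xs ! j"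
      using ij cl by simp
  qed
  moreover have "iso_class (full_sub C D) ` set Xs = iso_class C ` {X \<in> D. simple C X}"
  proof -
    have "iso_class C T \<in> iso_class C ` set Xs" if T: "T \<in> D" "simple C T" for T
    proof -
      obtain X where X: "X \<in> set Xs" "isomorphic C X T" using R T by blast
      then show ?thesis using iso_class_eq[OF o[OF X(1)]] by blast
    qed
    moreover have "iso_class (full_sub C D) ` set Xs = iso_class C ` set Xs" using cl by (rule image_cong[OF refl])
    ultimately show ?thesis using R by auto
  qed
  ultimately show ?L unfolding represents_def irr_full_sub[OF D] by blast
qed

section \<open>Non-pointed fusion subcategories contain the adjoint one\<close>

text \<open>Tensoring the morphism from the unit to \<open>X \<otimes> T\<close> with the inverse of \<open>T\<close> gives a nonzero
  morphism from that inverse to \<open>X\<close>, both of which are simple.\<close>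

lemma invertible_factor:
  assumes X: "simple C X" and l: "linked (Unit C) (X \<odot> T)" and T: "invertible C T"
  shows "invertible C X"
proof -
  obtain T' where p: "inverse_pair T T'" using T unfolding invertible_iff by blast
  note sT' = inverse_pair_simple[OF inverse_pair_sym[OF p]]
  have o: "X \<in> Obj C" "T \<in> Obj C" "T' \<in> Obj C" and i: "isomorphic C (T \<odot> T') (Unit C)"
    using p simple_obj[OF X] unfolding inverse_pair_def by simp_all
  have "isomorphic C ((X \<odot> T) \<odot> T') X"
    using iso_trans[OF iso_assoc[OF o] iso_trans[OF iso_tensor[OF iso_refl[OF o(1)] i] iso_runit[OF o(1)]]] .
  then have "linked T' X"
    using linked_iso[OF linked_tensor_right[OF l o(3) simple_nonzero[OF sT']] iso_lunit[OF o(3)]] by blast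
  then have "isomorphic C T' X" using linked_simples_iso sT' X by blast
  then show ?thesis using inverse_pair_iso[OF inverse_pair_sym[OF p]] unfolding invertible_iff by blast
qed

text \<open>Undoing the translation makes \<open>X\<close> a summand of \<open>W \<otimes> b\<close>; redoing it makes \<open>X \<otimes> a\<close> a
  nonzero summand of the simple \<open>W\<close>.\<close>

lemma linked_right_translate_iso:
  assumes p: "inverse_pair a b" and W: "simple C W" and X: "simple C X" and l: "linked W (X \<odot> a)"
  shows "isomorphic C (X \<odot> a) W"
proof -
  note sa = inverse_pair_simple[OF p] and sb = inverse_pair_simple[OF inverse_pair_sym[OF p]]
  note o = simple_obj[OF W] simple_obj[OF X] simple_obj[OF sa] simple_obj[OF sb]
  have c: "isomorphic C ((y \<odot> u) \<odot> v) y" if "inverse_pair u v" "y \<in> Obj C" for y u v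
    using iso_trans[OF iso_assoc[of y u v] iso_trans[OF iso_tensor[OF iso_refl[of y], of "u \<odot> v"] iso_runit[of y]]] that
    unfolding inverse_pair_def by blast
  have "linked (W \<odot> b) ((X \<odot> a) \<odot> b)" using linked_tensor_right[OF l o(4) simple_nonzero[OF sb]] .
  then have "linked (W \<odot> b) X"
    using linked_iso[OF _ iso_refl[OF tenO_obj[OF o(1,4)]] c[OF p o(2)]] by blast
  then have "is_summand C (X \<odot> a) ((W \<odot> b) \<odot> a)"
    using summand_tensor[OF linked_to_simple_summand[OF _ X] iso_summand[OF iso_refl[OF o(3)]]] by blast
  then have "is_summand C (X \<odot> a) W"
    using summand_trans iso_summand[OF c[OF inverse_pair_sym[OF p] o(1)]] by blast
  then show ?thesis
    using nonzero_summand_of_simple[OF W] tensor_nonzero o simple_nonzero[OF X] simple_nonzero[OF sa] by blast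
qed

lemma simple_summand_of_left_dual:
  assumes "is_left_dual C Y X" "simple C S" "is_summand C S Y"
  shows "linked (Unit C) (X \<odot> S)"
  using left_dual_linked_right[OF assms(1)] summand_linked(2)[OF assms(3) simple_nonzero[OF assms(2)]]
  unfolding linked_def by blast

text \<open>Let \<open>Z\<close> be a simple summand of \<open>X \<otimes> X*\<close> for a non-invertible simple \<open>X\<close>, hence of \<open>X \<otimes> T\<close> for some simple summand \<open>T\<close> of
  \<open>X*\<close>. It is enough to find \<open>X \<otimes> T\<close> in \<open>D\<close>, and this follows by comparing \<open>T\<close> with a simple summand
  \<open>S\<close> of the dual of \<open>W\<close>: writing \<open>T \<cong> a \<otimes> S\<close> with \<open>a\<close> invertible, the coevaluation of \<open>X\<close> becomes a
  nonzero morphism from the unit to \<open>(X \<otimes> a) \<otimes> S\<close>, which forces \<open>X \<otimes> a \<cong> W\<close>.\<close>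

lemma nonpointed_contains_adjoint:
  assumes transitive: "\<And>A B. \<lbrakk>simple C A; \<not> invertible C A; simple C B; \<not> invertible C B\<rbrakk>
      \<Longrightarrow> \<exists>a. invertible C a \<and> isomorphic C (a \<odot> A) B"
    and D: "fusion_subcategory C D" and W: "W \<in> D" "simple C W" "\<not> invertible C W"
  shows "adjoint_sub C \<subseteq> D"
  unfolding adjoint_sub_def
proof (rule generated_sub_least[OF D], rule subsetI)
  note A = fusion_subcategoryD(1)[OF D]
  fix Z assume "Z \<in> {Y. simple C Y \<and> (\<exists>X. simple C X \<and> is_summand C Y (X \<odot> dual C X))}"
  then obtain X where Z: "simple C Z" and X: "simple C X" and ZX: "is_summand C Z (X \<odot> dual C X)" by blast
  note oX = simple_obj[OF X]
  show "Z \<in> D"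
  proof (cases "invertible C X")
    case True
    then have "is_summand C Z (Unit C)"
      using summand_trans[OF ZX iso_summand] unfolding invertible_def by blast
    then show ?thesis using additive_subD(2)[OF A fusion_subcategoryD(2)[OF D]] by blast
  next
    case False
    obtain Ts where Ts: "\<forall>T\<in>set Ts. simple C T" "is_direct_sum C (dual C X) Ts"
      using semisimple left_dual_obj[OF dual_is_left_dual[OF oX]] by blast
    obtain T where T: "T \<in> set Ts" "linked Z (X \<odot> T)"
      using linked_direct_sum_right[OF summand_linked(1)[OF ZX simple_nonzero[OF Z]]
          tensor_direct_sum_right[OF Ts(2) oX]] by auto
    have sT: "simple C T" using T(1) Ts(1) by blast
    have lT: "linked (Unit C) (X \<odot> T)"
      using simple_summand_of_left_dual[OF dual_is_left_dual[OF oX] sT direct_sum_summand[OF Ts(2) T(1)]] .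
    define V where "V = dual C W"
    have dV: "is_left_dual C V W" unfolding V_def using dual_is_left_dual simple_obj[OF W(2)] by blast
    have "\<not> is_direct_sum C V []"
      using tensor_nonzero_factors(2) linked_nonzero(2)[OF left_dual_linked(2)[OF dV simple_nonzero[OF W(2)]]]
        left_dual_obj[OF dV] by blast
    then obtain S where S: "simple C S" "is_summand C S V"
      using nonzero_simple_summand left_dual_obj[OF dV] by blast
    have SD: "S \<in> D" using additive_subD(2)[OF A fusion_subcategoryD(4)[OF D W(1) dV] S(2)] .
    have lS: "linked (Unit C) (W \<odot> S)" using simple_summand_of_left_dual[OF dV S] .
    \<comment> \<open>Transitivity applies to \<open>S\<close> and \<open>T\<close> because an invertible one would make \<open>W\<close> or \<open>X\<close>
      invertible.\<close>
    have "\<not> invertible C S" "\<not> invertible C T"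
      using invertible_factor[OF W(2) lS] invertible_factor[OF X lT] W(3) False by blast+
    then obtain a where a: "invertible C a" "isomorphic C (a \<odot> S) T" using transitive S(1) sT by blast
    obtain b where ab: "inverse_pair a b" using a(1) unfolding invertible_iff by blast
    note oa = simple_obj[OF invertible_simple[OF a(1)]] and oS = simple_obj[OF S(1)]
    have XT: "isomorphic C ((X \<odot> a) \<odot> S) (X \<odot> T)"
      using iso_trans[OF iso_assoc[OF oX oa oS] iso_tensor[OF iso_refl[OF oX] a(2)]] .
    have "linked (Unit C) ((X \<odot> a) \<odot> S)" using linked_iso[OF lT iso_refl[OF unit_obj] iso_sym[OF XT]] .
    \<comment> \<open>The comparison with \<open>W\<close> uses its full dual \<open>V\<close>, of which \<open>S\<close> is a summand.\<close>
    then have "linked (Unit C) ((X \<odot> a) \<odot> V)"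
      using linked_summand_right summand_tensor[OF iso_summand[OF iso_refl] S(2)] tenO_obj[OF oX oa] by blast
    then have "linked W (X \<odot> a)" using coevaluation_linked_left[OF dV tenO_obj[OF oX oa]] by blast
    then have "isomorphic C (X \<odot> a) W" using linked_right_translate_iso[OF ab W(2) X] by blast
    then have "isomorphic C (W \<odot> S) (X \<odot> T)"
      using iso_trans[OF iso_tensor[OF iso_sym iso_refl[OF oS]] XT] by blast
    then have "X \<odot> T \<in> D" using additive_sub_iso[OF A fusion_subcategoryD(3)[OF D W(1) SD]] by blast
    then show ?thesis using additive_subD(2)[OF A] linked_from_simple_summand[OF T(2) Z] by blast
  qed
qed

end

section \<open>The universal grading\<close>

locale graded_fusion_category = fusion_category +
  fixes U :: "'g monoid" and Cg :: "'g \<Rightarrow> 'a set"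
  assumes grading: "universal_grading C U Cg"
begin

lemma gradingD:
  shows "group U" "\<forall>g\<in>carrier U. additive_sub C (Cg g)"
    "\<forall>g\<in>carrier U. \<forall>h\<in>carrier U. g \<noteq> h \<longrightarrow> (\<forall>X\<in>Cg g. \<forall>Y\<in>Cg h. Hom C X Y = {0})"
    "Obj C = sum_of_components C Cg (carrier U)"
    "\<forall>g\<in>carrier U. \<forall>h\<in>carrier U. \<forall>X\<in>Cg g. \<forall>Y\<in>Cg h. X \<odot> Y \<in> Cg (g \<otimes>\<^bsub>U\<^esub> h)"
    "\<forall>g\<in>carrier U. \<exists>X\<in>Cg g. \<not> is_direct_sum C X []"
    "Cg \<one>\<^bsub>U\<^esub> = adjoint_sub C"
  using grading[unfolded universal_grading_def faithful_grading_def] by - (elim conjE, assumption)+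

lemmas group_U = gradingD(1)

lemmas component_one = gradingD(7)

lemma component_additive: "g \<in> carrier U \<Longrightarrow> additive_sub C (Cg g)"
  using gradingD(2) by blast

lemma component_tensor:
  "\<lbrakk>g \<in> carrier U; h \<in> carrier U; X \<in> Cg g; Y \<in> Cg h\<rbrakk> \<Longrightarrow> X \<odot> Y \<in> Cg (g \<otimes>\<^bsub>U\<^esub> h)"
  using gradingD(5) by blast

lemma component_linked:
  assumes gh: "g \<in> carrier U" "h \<in> carrier U" and XY: "X \<in> Cg g" "Y \<in> Cg h" and l: "linked X Y"
  shows "g = h"
proof (rule ccontr)
  assume "g \<noteq> h"
  then have "Hom C X Y = {0}"
    using gradingD(3) gh XY by blast
  moreover obtain f where "maps f X Y" "mor f \<noteq> 0" using l unfolding linked_def by blast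
  ultimately show False using mapsD[of f X Y] by simp
qed

lemma component_simple:
  assumes "g \<in> carrier U"
  obtains S where "simple C S" "S \<in> Cg g"
proof -
  note A = component_additive[OF assms]
  obtain X where X: "X \<in> Cg g" "\<not> is_direct_sum C X []"
    using gradingD(6) assms by blast
  obtain S where "simple C S" "is_summand C S X"
    using nonzero_simple_summand[OF additive_subD(1)[OF A X(1)] X(2)] .
  then show ?thesis using that additive_subD(2)[OF A X(1)] by blast
qed

lemma simple_graded:
  assumes "simple C S"
  obtains g where "g \<in> carrier U" "S \<in> Cg g"
proof -
  have "S \<in> sum_of_components C Cg (carrier U)"
    using gradingD(4) simple_obj[OF assms] by simp
  then obtain Xs where Xs: "set Xs \<subseteq> (\<Union>g\<in>carrier U. Cg g)" "is_direct_sum C S Xs"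
    unfolding sum_of_components_def by blast
  obtain X where X: "X \<in> set Xs" "linked S X"
    using linked_direct_sum_right[OF nonzero_linked_self Xs(2)] assms simple_obj simple_nonzero by blast
  then obtain g where g: "g \<in> carrier U" "X \<in> Cg g" using Xs(1) by blast
  have "S \<in> Cg g"
    using additive_subD(2)[OF component_additive[OF g(1)] g(2) linked_from_simple_summand[OF X(2) assms]] .
  then show ?thesis using that g(1) by blast
qed

lemma unit_component: "Unit C \<in> Cg \<one>\<^bsub>U\<^esub>"
  unfolding component_one using fusion_subcategoryD(2)[OF fusion_subcategory_adjoint] .

lemma component_product_unit:
  assumes "g \<in> carrier U" "h \<in> carrier U" "X \<in> Cg g" "Y \<in> Cg h"
    and "linked (Unit C) (X \<odot> Y) \<or> linked (X \<odot> Y) (Unit C)"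
  shows "g \<otimes>\<^bsub>U\<^esub> h = \<one>\<^bsub>U\<^esub>"
proof -
  interpret U: group U by (rule group_U)
  note t = component_tensor[OF assms(1-4)]
  show ?thesis
    using component_linked[OF U.one_closed U.m_closed[OF assms(1,2)] unit_component t]
      component_linked[OF U.m_closed[OF assms(1,2)] U.one_closed t unit_component] assms(5) by metis
qed

text \<open>Different components have no morphisms between them, so the degrees of the simple summands of
  an object do not depend on the decomposition. Membership can then be tested on simple summands,
  which makes the closure properties of these subcategories easy to check.\<close>

lemma sum_of_components_iff:
  assumes H: "H \<subseteq> carrier U"
  shows "X \<in> sum_of_components C Cg H \<longleftrightarrow>
    X \<in> Obj C \<and> (\<forall>S. simple C S \<longrightarrow> is_summand C S X \<longrightarrow> (\<exists>h\<in>H. S \<in> Cg h))"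
proof
  assume "X \<in> sum_of_components C Cg H"
  then obtain Xs where Xs: "set Xs \<subseteq> (\<Union>h\<in>H. Cg h)" "is_direct_sum C X Xs"
    unfolding sum_of_components_def by blast
  have "\<exists>h\<in>H. S \<in> Cg h" if S: "simple C S" "is_summand C S X" for S
  proof -
    obtain Y where Y: "Y \<in> set Xs" "linked S Y"
      using linked_direct_sum_right[OF summand_linked(1)[OF S(2) simple_nonzero[OF S(1)]] Xs(2)] by blast
    then obtain h where h: "h \<in> H" "Y \<in> Cg h" using Xs(1) by blast
    then have "S \<in> Cg h"
      using additive_subD(2)[OF component_additive h(2) linked_from_simple_summand[OF Y(2) S(1)]] H by blast
    then show ?thesis using h(1) by blast
  qed
  then show "X \<in> Obj C \<and> (\<forall>S. simple C S \<longrightarrow> is_summand C S X \<longrightarrow> (\<exists>h\<in>H. S \<in> Cg h))"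
    using Xs(2) unfolding is_direct_sum_def by blast
next
  assume X: "X \<in> Obj C \<and> (\<forall>S. simple C S \<longrightarrow> is_summand C S X \<longrightarrow> (\<exists>h\<in>H. S \<in> Cg h))"
  then obtain Xs where Xs: "\<forall>T\<in>set Xs. simple C T" "is_direct_sum C X Xs" using semisimple by blast
  then have "set Xs \<subseteq> (\<Union>h\<in>H. Cg h)" using X direct_sum_summand by blast
  then show "X \<in> sum_of_components C Cg H" using Xs(2) unfolding sum_of_components_def by blast
qed

lemma simple_in_sum_of_components:
  assumes H: "H \<subseteq> carrier U" and g: "g \<in> carrier U" and S: "simple C S" "S \<in> Cg g"
  shows "S \<in> sum_of_components C Cg H \<longleftrightarrow> g \<in> H"
proof
  assume "S \<in> sum_of_components C Cg H"
  then obtain h where h: "h \<in> H" "S \<in> Cg h"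
    unfolding sum_of_components_iff[OF H] using S(1) iso_summand[OF iso_refl[OF simple_obj[OF S(1)]]] by blast
  then have "g = h"
    using component_linked[OF g _ S(2) h(2) nonzero_linked_self] H S(1) simple_obj simple_nonzero by blast
  then show "g \<in> H" using h(1) by simp
next
  assume "g \<in> H"
  then show "S \<in> sum_of_components C Cg H"
    unfolding sum_of_components_iff[OF H]
    using simple_obj[OF S(1)] additive_subD(2)[OF component_additive[OF g] S(2)] by blast
qed

text \<open>Every closure property is a statement about degrees: a simple summand of a product has a
  degree \<open>g h\<close>, and one of a dual of \<open>X\<close> pairs with some summand of \<open>X\<close> to the unit, so its degree is
  the inverse of an element of \<open>H\<close>.\<close>

lemma sum_of_components_fusion:
  assumes "subgroup H U"
  shows "fusion_subcategory C (sum_of_components C Cg H)" (is "fusion_subcategory C ?D")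
proof -
  interpret U: group U by (rule group_U)
  interpret H: subgroup H U by fact
  note iff = sum_of_components_iff[OF H.subset]
  have deg: "\<exists>h\<in>H. X \<in> Cg h" if "X \<in> set Xs" "set Xs \<subseteq> (\<Union>h\<in>H. Cg h)" for X Xs using that by blast
  have inv_mem: "g \<in> H" if "h \<in> H" "g \<in> carrier U" "h \<otimes>\<^bsub>U\<^esub> g = \<one>\<^bsub>U\<^esub> \<or> g \<otimes>\<^bsub>U\<^esub> h = \<one>\<^bsub>U\<^esub>" for g h
    using that U.inv_equality U.inv_inv H.m_inv_closed H.mem_carrier by metis
  show ?thesis
    unfolding fusion_subcategory_def additive_sub_def
  proof (intro conjI allI ballI impI)
    show "?D \<subseteq> Obj C" using iff by blast
    show "X \<in> ?D" if h: "set Xs \<subseteq> ?D \<and> is_direct_sum C X Xs" for X Xs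
      unfolding iff
    proof (intro conjI allI impI)
      show "X \<in> Obj C" using h unfolding is_direct_sum_def by blast
      fix S assume S: "simple C S" "is_summand C S X"
      obtain Y where Y: "Y \<in> set Xs" "linked S Y"
        using linked_direct_sum_right[OF summand_linked(1)[OF S(2) simple_nonzero[OF S(1)]]] h by blast
      then have "is_summand C S Y" "Y \<in> ?D" using linked_from_simple_summand S(1) h by blast+
      then show "\<exists>h\<in>H. S \<in> Cg h" using S(1) unfolding iff by blast
    qed
    show "Y \<in> ?D" if "X \<in> ?D" "is_summand C Y X" for X Y
      using that summand_trans summand_obj unfolding iff by blast
    show "Unit C \<in> ?D"
      using simple_in_sum_of_components[OF H.subset U.one_closed unit_simple unit_component] by simp
    show "X \<odot> Y \<in> ?D" if XY: "X \<in> ?D" "Y \<in> ?D" for X Y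
      unfolding iff
    proof (intro conjI allI impI)
      have o: "X \<in> Obj C" "Y \<in> Obj C" using XY unfolding iff by blast+
      then show "X \<odot> Y \<in> Obj C" by (rule tenO_obj)
      fix S assume S: "simple C S" "is_summand C S (X \<odot> Y)"
      obtain Xs Ys where Xs: "set Xs \<subseteq> (\<Union>h\<in>H. Cg h)" "is_direct_sum C X Xs"
        and Ys: "set Ys \<subseteq> (\<Union>h\<in>H. Cg h)" "is_direct_sum C Y Ys"
        using XY unfolding sum_of_components_def by blast
      obtain X' where X': "X' \<in> set Xs" "linked S (X' \<odot> Y)"
        using linked_direct_sum_right[OF summand_linked(1)[OF S(2) simple_nonzero[OF S(1)]]
            tensor_direct_sum_left[OF Xs(2) o(2)]] by auto
      have oX': "X' \<in> Obj C" using direct_sum_summand[OF Xs(2) X'(1)] summand_obj by blast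
      obtain Y' where Y': "Y' \<in> set Ys" "linked S (X' \<odot> Y')"
        using linked_direct_sum_right[OF X'(2) tensor_direct_sum_right[OF Ys(2) oX']] by auto
      obtain g h where gh: "g \<in> H" "h \<in> H" "X' \<in> Cg g" "Y' \<in> Cg h"
        using deg[OF X'(1) Xs(1)] deg[OF Y'(1) Ys(1)] by blast
      then have "X' \<odot> Y' \<in> Cg (g \<otimes>\<^bsub>U\<^esub> h)" using component_tensor H.mem_carrier by blast
      then have "S \<in> Cg (g \<otimes>\<^bsub>U\<^esub> h)"
        using additive_subD(2)[OF component_additive] linked_from_simple_summand[OF Y'(2) S(1)]
          H.m_closed[OF gh(1,2)] H.mem_carrier by blast
      then show "\<exists>h\<in>H. S \<in> Cg h" using H.m_closed[OF gh(1,2)] by blast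
    qed
    show "Y \<in> ?D" if X: "X \<in> ?D" and d: "is_left_dual C Y X \<or> is_left_dual C X Y" for X Y
      unfolding iff
    proof (intro conjI allI impI)
      show "Y \<in> Obj C" using d left_dual_obj by blast
      fix S assume S: "simple C S" "is_summand C S Y"
      note oS = simple_obj[OF S(1)]
      obtain Xs where Xs: "set Xs \<subseteq> (\<Union>h\<in>H. Cg h)" "is_direct_sum C X Xs"
        using X unfolding sum_of_components_def by blast
      obtain g where g: "g \<in> carrier U" "S \<in> Cg g" using simple_graded[OF S(1)] .
      obtain f where f: "maps f Y S" "mor f \<noteq> 0"
        using summand_linked(2)[OF S(2) simple_nonzero[OF S(1)]] unfolding linked_def by blast
      have "\<exists>X'\<in>set Xs. linked (Unit C) (X' \<odot> S) \<or> linked (Unit C) (S \<odot> X')"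
        using d
      proof
        assume "is_left_dual C Y X"
        from linked_direct_sum_right[OF left_dual_linked_right[OF this f] tensor_direct_sum_left[OF Xs(2) oS]]
        show ?thesis by auto
      next
        assume "is_left_dual C X Y"
        from linked_direct_sum_right[OF left_dual_linked_left[OF this f] tensor_direct_sum_right[OF Xs(2) oS]]
        show ?thesis by auto
      qed
      then obtain X' where X': "X' \<in> set Xs" "linked (Unit C) (X' \<odot> S) \<or> linked (Unit C) (S \<odot> X')" by blast
      then obtain h where h: "h \<in> H" "X' \<in> Cg h" using deg[OF X'(1) Xs(1)] by blast
      have "h \<otimes>\<^bsub>U\<^esub> g = \<one>\<^bsub>U\<^esub> \<or> g \<otimes>\<^bsub>U\<^esub> h = \<one>\<^bsub>U\<^esub>"
        using component_product_unit[OF H.mem_carrier[OF h(1)] g(1) h(2) g(2)]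
          component_product_unit[OF g(1) H.mem_carrier[OF h(1)] g(2) h(2)] X'(2) by blast
      then have "g \<in> H" using inv_mem h(1) g(1) by blast
      then show "\<exists>h\<in>H. S \<in> Cg h" using g(2) by blast
    qed
  qed
qed

lemma sum_of_components_inj: "inj_on (sum_of_components C Cg) {H. subgroup H U}"
proof (rule inj_onI)
  have le: "H \<subseteq> K" if H: "subgroup H U" and K: "subgroup K U"
    and eq: "sum_of_components C Cg H = sum_of_components C Cg K" for H K
  proof
    fix h assume h: "h \<in> H"
    then have hU: "h \<in> carrier U" using subgroup.subset[OF H] by blast
    obtain S where S: "simple C S" "S \<in> Cg h" using component_simple[OF hU] .
    show "h \<in> K"
      using simple_in_sum_of_components[OF subgroup.subset[OF H] hU S] h
        simple_in_sum_of_components[OF subgroup.subset[OF K] hU S] eq by simp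
  qed
  fix H K assume "H \<in> {H. subgroup H U}" "K \<in> {H. subgroup H U}"
    "sum_of_components C Cg H = sum_of_components C Cg K"
  then show "H = K" using le[of H K] le[of K H] by auto
qed

text \<open>The evaluation is nonzero on some simple summand of the dual, and only objects of trivial
  degree admit a nonzero morphism to the unit.\<close>

lemma inverse_component:
  assumes g: "g \<in> carrier U" "X \<in> Cg g" and X: "\<not> is_direct_sum C X []" and d: "is_left_dual C Y X"
  obtains T where "simple C T" "is_summand C T Y" "T \<in> Cg (inv\<^bsub>U\<^esub> g)" "linked (T \<odot> X) (Unit C)"
proof -
  interpret U: group U by (rule group_U)
  obtain Ts where Ts: "\<forall>T\<in>set Ts. simple C T" "is_direct_sum C Y Ts"
    using semisimple left_dual_obj[OF d] by blast
  obtain T where T: "T \<in> set Ts" "linked (T \<odot> X) (Unit C)"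
    using linked_direct_sum_left[OF left_dual_linked(1)[OF d X] tensor_direct_sum_left[OF Ts(2)]]
      left_dual_obj[OF d] by auto
  have sT: "simple C T" using T(1) Ts(1) by blast
  obtain h where h: "h \<in> carrier U" "T \<in> Cg h" using simple_graded[OF sT] .
  have "h \<otimes>\<^bsub>U\<^esub> g = \<one>\<^bsub>U\<^esub>" using component_product_unit[OF h(1) g(1) h(2) g(2)] T(2) by blast
  then have "inv\<^bsub>U\<^esub> g = h" using U.inv_equality g(1) h(1) by blast
  then show ?thesis using that[OF sT direct_sum_summand[OF Ts(2) T(1)] _ T(2)] h(2) by simp
qed

text \<open>Let \<open>H\<close> be the set of degrees of the nonzero objects of \<open>D\<close>. If such an object \<open>X\<close> and \<open>S\<close> have the same degree,
  take \<open>T\<close> of inverse degree with a nonzero morphism from \<open>T \<otimes> X\<close> to the unit. Then \<open>S\<close> is a summand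
  of \<open>S \<otimes> (T \<otimes> X) \<cong> (S \<otimes> T) \<otimes> X\<close>, and \<open>S \<otimes> T\<close> has trivial degree, so it lies in the adjoint
  subcategory and in \<open>D\<close>. Thus \<open>D\<close> contains a whole component as soon as it contains a nonzero object of it.\<close>

lemma fusion_subcategory_containing_adjoint:
  assumes D: "fusion_subcategory C D" and ad: "adjoint_sub C \<subseteq> D"
  shows "\<exists>H. subgroup H U \<and> D = sum_of_components C Cg H"
proof -
  interpret U: group U by (rule group_U)
  note A = fusion_subcategoryD(1)[OF D]
  define H where "H = {g \<in> carrier U. \<exists>X\<in>Cg g \<inter> D. \<not> is_direct_sum C X []}"
  have HU: "H \<subseteq> carrier U" unfolding H_def by blast
  have comp: "S \<in> D" if g: "g \<in> H" and S: "S \<in> Cg g" for g S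
  proof -
    obtain X where gU: "g \<in> carrier U" and X: "X \<in> Cg g" "X \<in> D" "\<not> is_direct_sum C X []"
      using g unfolding H_def by blast
    have o: "S \<in> Obj C" "X \<in> Obj C"
      using additive_subD(1)[OF component_additive[OF gU]] S X(1) by blast+
    obtain Y where d: "is_left_dual C Y X" using left_rigid[OF o(2)] by blast
    obtain T where T: "simple C T" "T \<in> Cg (inv\<^bsub>U\<^esub> g)" "linked (T \<odot> X) (Unit C)"
      using inverse_component[OF gU X(1,3) d] by metis
    note oT = simple_obj[OF T(1)]
    have "S \<odot> T \<in> D"
      using component_tensor[OF gU U.inv_closed[OF gU] S T(2)] ad U.r_inv[OF gU] component_one by auto
    then have "(S \<odot> T) \<odot> X \<in> D" using fusion_subcategoryD(3)[OF D _ X(2)] by blast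
    moreover have "is_summand C (S \<odot> Unit C) (S \<odot> (T \<odot> X))"
      using summand_tensor[OF iso_summand[OF iso_refl[OF o(1)]] linked_to_simple_summand[OF T(3) unit_simple]] .
    then have "is_summand C S ((S \<odot> T) \<odot> X)"
      using summand_trans[OF iso_summand[OF iso_sym[OF iso_runit[OF o(1)]]]]
        summand_trans[OF _ iso_summand[OF iso_sym[OF iso_assoc[OF o(1) oT o(2)]]]] by blast
    ultimately show ?thesis using additive_subD(2)[OF A] by blast
  qed
  have "subgroup H U"
  proof (rule U.subgroupI[OF HU])
    show "H \<noteq> {}"
      using unit_component fusion_subcategoryD(2)[OF D] simple_nonzero[OF unit_simple] unfolding H_def by blast
  next
    fix g assume "g \<in> H"
    then obtain X where gU: "g \<in> carrier U" and X: "X \<in> Cg g" "X \<in> D" "\<not> is_direct_sum C X []"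
      unfolding H_def by blast
    obtain Y where d: "is_left_dual C Y X" using left_rigid additive_subD(1)[OF A X(2)] by blast
    obtain T where T: "simple C T" "is_summand C T Y" "T \<in> Cg (inv\<^bsub>U\<^esub> g)"
      using inverse_component[OF gU X(1,3) d] by metis
    have "T \<in> D" using additive_subD(2)[OF A fusion_subcategoryD(4)[OF D X(2) d] T(2)] .
    then show "inv\<^bsub>U\<^esub> g \<in> H" unfolding H_def using T simple_nonzero gU by blast
  next
    fix g h assume "g \<in> H" "h \<in> H"
    then obtain X Y where gU: "g \<in> carrier U" and X: "X \<in> Cg g" "X \<in> D" "\<not> is_direct_sum C X []"
      and hU: "h \<in> carrier U" and Y: "Y \<in> Cg h" "Y \<in> D" "\<not> is_direct_sum C Y []"
      unfolding H_def by blast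
    have "X \<odot> Y \<in> Cg (g \<otimes>\<^bsub>U\<^esub> h) \<inter> D"
      using component_tensor[OF gU hU X(1) Y(1)] fusion_subcategoryD(3)[OF D X(2) Y(2)] by blast
    moreover have "\<not> is_direct_sum C (X \<odot> Y) []"
      using tensor_nonzero X Y additive_subD(1)[OF A] by blast
    ultimately show "g \<otimes>\<^bsub>U\<^esub> h \<in> H" unfolding H_def using gU hU by blast
  qed
  moreover have "D = sum_of_components C Cg H"
  proof
    show "sum_of_components C Cg H \<subseteq> D"
      unfolding sum_of_components_def using comp additive_subD(3)[OF A] by blast
    show "D \<subseteq> sum_of_components C Cg H"
    proof
      fix X assume X: "X \<in> D"
      have "\<exists>h\<in>H. S \<in> Cg h" if S: "simple C S" "is_summand C S X" for S
      proof -
        obtain g where "g \<in> carrier U" "S \<in> Cg g" using simple_graded[OF S(1)] .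
        then show ?thesis
          unfolding H_def using additive_subD(2)[OF A X S(2)] simple_nonzero[OF S(1)] by blast
      qed
      then show "X \<in> sum_of_components C Cg H"
        unfolding sum_of_components_iff[OF HU] using additive_subD(1)[OF A X] by blast
    qed
  qed
  ultimately show ?thesis by blast
qed

text \<open>With the inverse \<open>b\<close> of \<open>a\<close>, the functors \<open>a \<otimes> -\<close> and \<open>b \<otimes> -\<close> exchange the simple objects of
  trivial degree with those of degree \<open>g\<close>. The head of the list is \<open>a\<close> itself in place of
  \<open>a \<otimes> Unit C\<close>; the proof compares the two lists entry by entry up to isomorphism.\<close>

lemma component_translates:
  assumes g: "g \<in> carrier U" and a: "a \<in> Cg g" "invertible C a"
    and Ys: "represents (full_sub C (adjoint_sub C)) (Unit C # Ys) (Irr (full_sub C (adjoint_sub C)))"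
  shows "represents (full_sub C (Cg g)) (a # map (\<lambda>Y. a \<odot> Y) Ys) (Irr (full_sub C (Cg g)))"
proof -
  interpret U: group U by (rule group_U)
  let ?Xs = "Unit C # Ys" and ?Zs = "a # map (\<lambda>Y. a \<odot> Y) Ys"
  note R = Ys[unfolded represents_full_sub_iff[OF fusion_subcategoryD(1)[OF fusion_subcategory_adjoint]]]
  have Xs: "X \<in> Cg \<one>\<^bsub>U\<^esub>" "simple C X" if "X \<in> set ?Xs" for X using R that component_one by blast+
  obtain b where ab: "inverse_pair a b" using a(2) unfolding invertible_iff by blast
  note sb = inverse_pair_simple[OF inverse_pair_sym[OF ab]]
  have o: "a \<in> Obj C" "b \<in> Obj C" using ab unfolding inverse_pair_def by simp_all
  have len: "length ?Zs = length ?Xs" by simp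
  have nth: "isomorphic C (a \<odot> ?Xs ! i) (?Zs ! i)" if "i < length ?Xs" for i
  proof (cases i)
    case 0 then show ?thesis using iso_runit[OF o(1)] by simp
  next
    case (Suc j)
    then have "Ys ! j \<in> Obj C" using Xs(2)[of "Ys ! j"] that simple_obj by simp
    then show ?thesis using Suc that iso_refl tenO_obj o(1) by simp
  qed
  have mem: "Z \<in> Cg g \<and> simple C Z" if "Z \<in> set ?Zs" for Z
  proof -
    obtain i where i: "i < length ?Xs" "Z = ?Zs ! i" using \<open>Z \<in> set ?Zs\<close> len by (metis in_set_conv_nth)
    have "a \<odot> ?Xs ! i \<in> Cg g"
      using component_tensor[OF g U.one_closed a(1) Xs(1)[OF nth_mem[OF i(1)]]] g by simp
    moreover have "simple C (a \<odot> ?Xs ! i)"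
      using inverse_pair_tensor_simple[OF ab Xs(2)[OF nth_mem[OF i(1)]]] .
    ultimately show ?thesis
      using additive_sub_iso[OF component_additive[OF g]] simple_iso nth[OF i(1)] i(2) by blast
  qed
  have inj: "i = j" if ij: "i < length ?Zs" "j < length ?Zs" and iso: "isomorphic C (?Zs ! i) (?Zs ! j)" for i j
  proof -
    have ij': "i < length ?Xs" "j < length ?Xs" using ij len by simp_all
    have oX: "?Xs ! k \<in> Obj C" if "k < length ?Xs" for k using simple_obj[OF Xs(2)[OF nth_mem[OF that]]] .
    have "isomorphic C (a \<odot> ?Xs ! i) (a \<odot> ?Xs ! j)"
      using iso_trans[OF nth[OF ij'(1)] iso_trans[OF iso iso_sym[OF nth[OF ij'(2)]]]] .
    from iso_tensor[OF iso_refl[OF o(2)] this]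
    have "isomorphic C (?Xs ! i) (?Xs ! j)"
      using iso_trans[OF iso_sym[OF inverse_pair_cancel[OF inverse_pair_sym[OF ab] oX[OF ij'(1)]]]
          iso_trans[OF _ inverse_pair_cancel[OF inverse_pair_sym[OF ab] oX[OF ij'(2)]]]] by blast
    then show ?thesis using R ij' by blast
  qed
  have sur: "\<exists>Z\<in>set ?Zs. isomorphic C Z S" if S: "S \<in> Cg g" "simple C S" for S
  proof -
    obtain k where k: "k \<in> carrier U" "b \<in> Cg k" using simple_graded[OF sb] .
    have "linked (Unit C) (a \<odot> b)"
      using linked_iso[OF nonzero_linked_self[OF unit_obj simple_nonzero[OF unit_simple]] iso_refl[OF unit_obj]]
        iso_sym ab unfolding inverse_pair_def by blast
    then have "g \<otimes>\<^bsub>U\<^esub> k = \<one>\<^bsub>U\<^esub>" using component_product_unit[OF g k(1) a(1) k(2)] by blast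
    then have "k \<otimes>\<^bsub>U\<^esub> g = \<one>\<^bsub>U\<^esub>" using U.inv_comm g k(1) by blast
    then have "b \<odot> S \<in> adjoint_sub C" using component_tensor[OF k(1) g k(2) S(1)] component_one by simp
    moreover have "simple C (b \<odot> S)" using inverse_pair_tensor_simple[OF inverse_pair_sym[OF ab] S(2)] .
    ultimately obtain X where X: "X \<in> set ?Xs" "isomorphic C X (b \<odot> S)" using R by blast
    then obtain i where i: "i < length ?Xs" "X = ?Xs ! i" by (metis in_set_conv_nth)
    have "isomorphic C (a \<odot> X) S"
      using iso_trans[OF iso_tensor[OF iso_refl[OF o(1)] X(2)] inverse_pair_cancel[OF ab simple_obj[OF S(2)]]] .
    then have "isomorphic C (?Zs ! i) S" using iso_trans[OF iso_sym[OF nth[OF i(1)]]] i(2) by blast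
    then show ?thesis using nth_mem i(1) len by metis
  qed
  show ?thesis
    unfolding represents_full_sub_iff[OF component_additive[OF g]] using mem inj sur by blast
qed

end

section \<open>Generalized near-group categories\<close>

lemma (in fusion_category) near_group_transitive:
  assumes C: "generalized_near_group C"
    and A: "simple C A" "\<not> invertible C A" and B: "simple C B" "\<not> invertible C B"
  shows "\<exists>a. invertible C a \<and> isomorphic C (a \<odot> A) B"
proof -
  have noninv: "iso_class C X \<in> noninv_Irr C" if X: "simple C X" "\<not> invertible C X" for X
  proof -
    have "iso_class C X \<noteq> iso_class C Y" if "invertible C Y" for Y
      using iso_class_eq[OF simple_obj[OF X(1)], of Y] invertible_iso[OF that] iso_sym X(2) by blast
    then show ?thesis using X(1) unfolding Irr_def inv_group_def by auto
  qed
  obtain g where g: "g \<in> carrier (inv_group C)" "class_tensor C g (iso_class C A) = iso_class C B"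
    using C noninv[OF A] noninv[OF B] unfolding generalized_near_group_def by blast
  then obtain a where a: "invertible C a" "g = iso_class C a" unfolding inv_group_def by auto
  have "B \<in> class_tensor C (iso_class C a) (iso_class C A)"
    using g(2) a(2) iso_refl[OF simple_obj[OF B(1)]] unfolding iso_class_def by auto
  then obtain x y where xy: "isomorphic C a x" "isomorphic C A y" "isomorphic C (x \<odot> y) B"
    unfolding class_tensor_def iso_class_def by blast
  then show ?thesis using a(1) iso_trans[OF iso_tensor[OF xy(1,2)] xy(3)] by blast
qed

lemma (in fusion_category) noninv_representative:
  assumes "represents C Xs (noninv_Irr C)" "X \<in> set Xs"
  shows "simple C X" "\<not> invertible C X"
proof -
  have X: "iso_class C X \<in> noninv_Irr C" using assms unfolding represents_def by blast
  then obtain S where S: "simple C S" "iso_class C X = iso_class C S" unfolding Irr_def by blast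
  then show "simple C X"
    using iso_class_eq[OF simple_obj[OF S(1)], of X] simple_iso[OF S(1)] by simp
  show "\<not> invertible C X" using X unfolding inv_group_def by auto
qed

text \<open>A multiplicity \<open>k\<^sub>i \<noteq> 0\<close> makes the \<open>i\<close>-th representative occur in the decomposition of the
  product of the first one with its dual.\<close>

lemma (in fusion_category) near_group_adjoint_noninvertible:
  assumes type: "near_group_type C G \<Gamma> ks" and ks: "ks \<noteq> replicate (length ks) 0"
  obtains N where "N \<in> adjoint_sub C" "simple C N" "\<not> invertible C N"
proof -
  obtain Xs hs where Xs: "represents C Xs (noninv_Irr C)" and len: "length Xs = length ks"
    and sum: "is_direct_sum C (hd Xs \<odot> dual C (hd Xs)) (hs @ concat (map2 replicate ks Xs))"
    using type unfolding near_group_type_def by blast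
  obtain i where i: "i < length ks" "ks ! i \<noteq> 0"
    using ks by (metis length_replicate nth_equalityI nth_replicate)
  have "Xs ! i \<in> set (replicate (ks ! i) (Xs ! i))" using i(2) by simp
  moreover have "replicate (ks ! i) (Xs ! i) \<in> set (map2 replicate ks Xs)"
    using i(1) len by (force simp: in_set_conv_nth)
  ultimately have "Xs ! i \<in> set (hs @ concat (map2 replicate ks Xs))" by auto
  then have "is_summand C (Xs ! i) (hd Xs \<odot> dual C (hd Xs))" using direct_sum_summand[OF sum] by blast
  moreover have mem: "Xs ! i \<in> set Xs" using i(1) len by simp
  moreover have "hd Xs \<in> set Xs" using mem by (cases Xs) auto
  ultimately show ?thesis
    using that adjoint_sub_contains noninv_representative[OF Xs] by blast
qed

theorem theorem3p6:
  fixes C :: "('o, 'm::ab_group_add) moncat"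
    and G :: "'o set monoid" and \<Gamma> :: "'o set set" and ks :: "nat list"
    and U :: "'g monoid" and Cg :: "'g \<Rightarrow> 'o set"
  assumes "generalized_near_group C"
    and "near_group_type C G \<Gamma> ks"
    and "ks \<noteq> replicate (length ks) 0"
    and "universal_grading C U Cg"
  shows "\<not> pointed (full_sub C (adjoint_sub C)) \<and>
     bij_betw (sum_of_components C Cg)
       {H. subgroup H U}
       {D. fusion_subcategory C D \<and> \<not> pointed (full_sub C D)} \<and>
     (\<forall>g\<in>carrier U.
        (\<exists>\<alpha>\<in>Cg g. invertible C \<alpha>) \<and>
        (\<forall>\<alpha>\<in>Cg g. \<forall>Ys. invertible C \<alpha> \<and>
           represents (full_sub C (adjoint_sub C)) (Unit C # Ys) (Irr (full_sub C (adjoint_sub C))) \<longrightarrow>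
           represents (full_sub C (Cg g)) (\<alpha> # map (\<lambda>Y. \<alpha> \<odot>\<^bsub>C\<^esub> Y) Ys) (Irr (full_sub C (Cg g)))))"
proof -
  interpret fusion_category C using assms(1) unfolding generalized_near_group_def by blast
  interpret graded_fusion_category C U Cg by unfold_locales (rule assms(4))
  note transitive = near_group_transitive[OF assms(1)]
  obtain N where N: "N \<in> adjoint_sub C" "simple C N" "\<not> invertible C N"
    using near_group_adjoint_noninvertible[OF assms(2,3)] .
  have nonpointed: "\<not> pointed (full_sub C D)" if "fusion_subcategory C D" "adjoint_sub C \<subseteq> D" for D
    unfolding pointed_full_sub[OF that(1)] using N that(2) by blast
  have ad_sub: "adjoint_sub C \<subseteq> sum_of_components C Cg H" if "subgroup H U" for H
  proof
    interpret U: group U by (rule group_U)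
    fix X assume X: "X \<in> adjoint_sub C"
    have "\<exists>h\<in>H. S \<in> Cg h" if "is_summand C S X" for S
      using additive_subD(2)[OF component_additive[OF U.one_closed] _ that] X component_one
        subgroup.one_closed[OF \<open>subgroup H U\<close>] by blast
    then show "X \<in> sum_of_components C Cg H"
      unfolding sum_of_components_iff[OF subgroup.subset[OF that]]
      using X additive_subD(1)[OF fusion_subcategoryD(1)[OF fusion_subcategory_adjoint]] by blast
  qed
  have "\<exists>a\<in>Cg g. invertible C a" if g: "g \<in> carrier U" for g
  proof -
    interpret U: group U by (rule group_U)
    obtain S where S: "simple C S" "S \<in> Cg g" using component_simple[OF g] .
    show ?thesis
    proof (cases "invertible C S")
      case False
      then obtain a where a: "invertible C a" "isomorphic C (a \<odot>\<^bsub>C\<^esub> N) S"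
        using transitive[OF N(2,3) S(1)] by blast
      obtain h where h: "h \<in> carrier U" "a \<in> Cg h" using simple_graded[OF invertible_simple[OF a(1)]] .
      \<comment> \<open>\<open>N\<close> has trivial degree, so \<open>a\<close> and \<open>a \<otimes> N\<close> have the same degree.\<close>
      have "a \<odot>\<^bsub>C\<^esub> N \<in> Cg (h \<otimes>\<^bsub>U\<^esub> \<one>\<^bsub>U\<^esub>)"
        by (rule component_tensor[OF h(1) U.one_closed h(2)]) (use N(1) component_one in simp)
      then have aN: "a \<odot>\<^bsub>C\<^esub> N \<in> Cg h" using h(1) by simp
      have "linked (a \<odot>\<^bsub>C\<^esub> N) S"
        using linked_iso[OF nonzero_linked_self[OF simple_obj[OF S(1)] simple_nonzero[OF S(1)]] iso_sym[OF a(2)]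
            iso_refl[OF simple_obj[OF S(1)]]] .
      then have "h = g" using component_linked[OF h(1) g aN S(2)] by blast
      then show ?thesis using a(1) h(2) by blast
    qed (use S(2) in blast)
  qed
  moreover have "bij_betw (sum_of_components C Cg) {H. subgroup H U}
      {D. fusion_subcategory C D \<and> \<not> pointed (full_sub C D)}"
    unfolding bij_betw_def
  proof (intro conjI sum_of_components_inj subset_antisym subsetI)
    fix D assume "D \<in> sum_of_components C Cg ` {H. subgroup H U}"
    then show "D \<in> {D. fusion_subcategory C D \<and> \<not> pointed (full_sub C D)}"
      using sum_of_components_fusion nonpointed ad_sub by blast
  next
    fix D assume D: "D \<in> {D. fusion_subcategory C D \<and> \<not> pointed (full_sub C D)}"
    then obtain W where "W \<in> D" "simple C W" "\<not> invertible C W" using pointed_full_sub by blast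
    then have "adjoint_sub C \<subseteq> D" using nonpointed_contains_adjoint[OF transitive, of D W] D by blast
    then show "D \<in> sum_of_components C Cg ` {H. subgroup H U}"
      using fusion_subcategory_containing_adjoint D by blast
  qed
  ultimately show ?thesis
    using nonpointed[OF fusion_subcategory_adjoint] component_translates by blast
qed

end
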